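(* For a class $\mathcal C$ of graphs: (1) $\mathcal C$ is locally monadically dependent if and only if $\mathcal C$ is monadically dependent; (2) $\mathcal C$ is locally monadically straight if and only if $\mathcal C$ is monadically straight; (3) $\mathcal C$ is locally monadically stable if and only if $\mathcal C$ is monadically stable.
   Context: All graphs are finite, simple, undirected. A $\Sigma$-expansion of a graph $G$ ($\Sigma$ a finite set of unary symbols) is $G$ with a subset of $V(G)$ for each symbol. A simple interpretation $(\nu(x),\eta(x,y))$ of first-order formulas over $\{E\}\cup\Sigma$ ($\eta$ symmetric, antireflexive) produces from $G^+$ the graph on $\nu(G^+)$ with edges $uv$ where $G^+\models\eta(u,v)$. A non-copying transduction is a pair $(\Sigma,\mathsf I)$, producing from $G$ all $\mathsf I(G^+)$ over $\Sigma$-expansions $G^+$. The $k$-copy operation maps $G$ to $k$ disjoint copies of $G$ with copies of each vertex made pairwise adjacent. A transduction is a finite composition of copy operations and non-copying transductions. $\mathcal C\sqsubseteq_{\mathrm{FO}}\mathcal D$ means there is a transduction $\mathsf T$ such that every graph of $\mathcal C$ is obtained by $\mathsf T$ from some graph of $\mathcal D$. Let $\mathcal G$ be the class of all graphs, $\mathcal H$ the class of half-graphs (for each $n$, the bipartite graph on $\{a_1,\dots,a_n\}\cup\{b_1,\dots,b_n\}$ with edges $a_ib_j$ for $1\le i\le j\le n$), and $\mathcal{TP}$ the class of trivially perfect graphs (comparability graphs of rooted forests: vertices adjacent iff one is an ancestor of the other). A class $\mathcal C$ is monadically dependent if $\mathcal G\not\sqsubseteq_{\mathrm{FO}}\mathcal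 C$, monadically stable if $\mathcal H\not\sqsubseteq_{\mathrm{FO}}\mathcal C$, monadically straight if $\mathcal{TP}\not\sqsubseteq_{\mathrm{FO}}\mathcal C$. For $r\ge0$, $\mathrm{loc}_r(\mathcal C)=\{B_r^G(v):G\in\mathcal C,v\in V(G)\}$, where $B_r^G(v)$ is the subgraph of $G$ induced by the vertices at distance at most $r$ from $v$. $\mathcal C$ is locally monadically dependent (resp. stable, straight) if $\mathrm{loc}_r(\mathcal C)$ is monadically dependent (resp. stable, straight) for every integer $r$. *)

theory Defs
  imports
    "Graph_Theory.Pair_Digraph"
    "Graph_Theory.Digraph_Isomorphism"
    "Graph_Theory.Shortest_Path"
begin

text \<open>
  A finite simple undirected graph is a \<^term>\<open>G :: 'a pair_pre_digraph\<close> with \<^term>\<open>pair_graph G\<close>;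
  an undirected edge is represented by its two arcs. Graph classes are sets of graphs with vertices
  in \<^typ>\<open>nat\<close>, which loses nothing because every finite graph is isomorphic to one of these and
  transduction outputs are compared up to isomorphism.
\<close>

type_synonym 'a ugraph = "'a pair_pre_digraph"

definition graph_iso :: "'a ugraph \<Rightarrow> 'b ugraph \<Rightarrow> bool" where
  "graph_iso G H \<longleftrightarrow> digraph_iso (with_proj G) (with_proj H)"


section \<open>First-order formulas over \<open>{E} \<union> \<Sigma>\<close>\<close>

text \<open>Unary symbols and variables are both named by natural numbers; the first argument of
  \<open>Mark\<close> is the symbol.\<close>

datatype fm =
    Eq nat nat
  | Edge nat nat
  | Mark nat nat
  | Neg fm
  | Conj fm fm
  | Ex nat fm

primrec free_vars :: "fm \<Rightarrow> nat set" where
  "free_vars (Eq x y) = {x, y}"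
| "free_vars (Edge x y) = {x, y}"
| "free_vars (Mark s x) = {x}"
| "free_vars (Neg \<phi>) = free_vars \<phi>"
| "free_vars (Conj \<phi> \<psi>) = free_vars \<phi> \<union> free_vars \<psi>"
| "free_vars (Ex x \<phi>) = free_vars \<phi> - {x}"

primrec symbols :: "fm \<Rightarrow> nat set" where
  "symbols (Eq x y) = {}"
| "symbols (Edge x y) = {}"
| "symbols (Mark s x) = {s}"
| "symbols (Neg \<phi>) = symbols \<phi>"
| "symbols (Conj \<phi> \<psi>) = symbols \<phi> \<union> symbols \<psi>"
| "symbols (Ex x \<phi>) = symbols \<phi>"

primrec sat :: "'a ugraph \<Rightarrow> (nat \<Rightarrow> 'a set) \<Rightarrow> (nat \<Rightarrow> 'a) \<Rightarrow> fm \<Rightarrow> bool" where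
  "sat G M e (Eq x y) \<longleftrightarrow> e x = e y"
| "sat G M e (Edge x y) \<longleftrightarrow> (e x, e y) \<in> parcs G"
| "sat G M e (Mark s x) \<longleftrightarrow> e x \<in> M s"
| "sat G M e (Neg \<phi>) \<longleftrightarrow> \<not> sat G M e \<phi>"
| "sat G M e (Conj \<phi> \<psi>) \<longleftrightarrow> sat G M e \<phi> \<and> sat G M e \<psi>"
| "sat G M e (Ex x \<phi>) \<longleftrightarrow> (\<exists>v \<in> pverts G. sat G M (e(x := v)) \<phi>)"


section \<open>Transductions\<close>

text \<open>The pair \<open>(G, M)\<close> is a \<open>\<Sigma>\<close>-expansion of \<open>G\<close>. The values of \<open>M\<close> outside \<open>\<Sigma>\<close> are irrelevant,
  since interpretations below only use symbols from \<open>\<Sigma>\<close>.\<close>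

definition expansion :: "nat set \<Rightarrow> 'a ugraph \<Rightarrow> (nat \<Rightarrow> 'a set) \<Rightarrow> bool" where
  "expansion \<Sigma> G M \<longleftrightarrow> (\<forall>s \<in> \<Sigma>. M s \<subseteq> pverts G)"

text \<open>In \<open>\<nu>(x)\<close> and \<open>\<eta>(x,y)\<close> the variables \<open>x\<close>, \<open>y\<close> are the variables \<open>0\<close>, \<open>1\<close>.\<close>

definition sat1 :: "'a ugraph \<Rightarrow> (nat \<Rightarrow> 'a set) \<Rightarrow> fm \<Rightarrow> 'a \<Rightarrow> bool" where
  "sat1 G M \<nu> u \<longleftrightarrow> sat G M ((\<lambda>_. undefined)(0 := u)) \<nu>"

definition sat2 :: "'a ugraph \<Rightarrow> (nat \<Rightarrow> 'a set) \<Rightarrow> fm \<Rightarrow> 'a \<Rightarrow> 'a \<Rightarrow> bool" where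
  "sat2 G M \<eta> u v \<longleftrightarrow> sat G M ((\<lambda>_. undefined)(0 := u, 1 := v)) \<eta>"

definition simple_interpretation :: "nat set \<Rightarrow> fm \<Rightarrow> fm \<Rightarrow> bool" where
  "simple_interpretation \<Sigma> \<nu> \<eta> \<longleftrightarrow>
     symbols \<nu> \<subseteq> \<Sigma> \<and> symbols \<eta> \<subseteq> \<Sigma> \<and> free_vars \<nu> \<subseteq> {0} \<and> free_vars \<eta> \<subseteq> {0, 1} \<and>
     (\<forall>(G :: nat ugraph) M. pair_graph G \<longrightarrow> expansion \<Sigma> G M \<longrightarrow>
        (\<forall>u \<in> pverts G. \<forall>v \<in> pverts G. sat2 G M \<eta> u v \<longrightarrow> sat2 G M \<eta> v u) \<and>
        (\<forall>u \<in> pverts G. \<not> sat2 G M \<eta> u u))"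

definition interpret_graph :: "fm \<Rightarrow> fm \<Rightarrow> 'a ugraph \<Rightarrow> (nat \<Rightarrow> 'a set) \<Rightarrow> 'a ugraph" where
  "interpret_graph \<nu> \<eta> G M =
     (let V = {v \<in> pverts G. sat1 G M \<nu> v}
      in \<lparr> pverts = V, parcs = {(u, v). u \<in> V \<and> v \<in> V \<and> sat2 G M \<eta> u v} \<rparr>)"

text \<open>The \<open>i\<close>-th copy of a vertex \<open>v\<close> is coded as \<^term>\<open>prod_encode (i, v)\<close>.\<close>

definition copy_graph :: "nat \<Rightarrow> nat ugraph \<Rightarrow> nat ugraph" where
  "copy_graph k G =
     \<lparr> pverts = {prod_encode (i, v) | i v. i < k \<and> v \<in> pverts G},
       parcs = {(prod_encode (i, u), prod_encode (i, v)) | i u v. i < k \<and> (u, v) \<in> parcs G} \<union>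
               {(prod_encode (i, v), prod_encode (j, v)) | i j v.
                  i < k \<and> j < k \<and> i \<noteq> j \<and> v \<in> pverts G} \<rparr>"

datatype step = Copy nat | NonCopying "nat set" fm fm

primrec valid_step :: "step \<Rightarrow> bool" where
  "valid_step (Copy k) \<longleftrightarrow> k \<ge> 1"
| "valid_step (NonCopying \<Sigma> \<nu> \<eta>) \<longleftrightarrow> finite \<Sigma> \<and> simple_interpretation \<Sigma> \<nu> \<eta>"

primrec step_outputs :: "step \<Rightarrow> nat ugraph \<Rightarrow> nat ugraph set" where
  "step_outputs (Copy k) G = {copy_graph k G}"
| "step_outputs (NonCopying \<Sigma> \<nu> \<eta>) G = {interpret_graph \<nu> \<eta> G M | M. expansion \<Sigma> G M}"

text \<open>A transduction is the list of its steps, applied from left to right.\<close>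

type_synonym transduction = "step list"

definition valid_transduction :: "transduction \<Rightarrow> bool" where
  "valid_transduction T \<longleftrightarrow> (\<forall>t \<in> set T. valid_step t)"

primrec outputs :: "transduction \<Rightarrow> nat ugraph \<Rightarrow> nat ugraph set" where
  "outputs [] G = {G}"
| "outputs (t # T) G = (\<Union>H \<in> step_outputs t G. outputs T H)"

definition FO_transducible :: "nat ugraph set \<Rightarrow> nat ugraph set \<Rightarrow> bool"
    (infix \<open>\<sqsubseteq>\<^sub>F\<^sub>O\<close> 50) where
  "C \<sqsubseteq>\<^sub>F\<^sub>O D \<longleftrightarrow>
     (\<exists>T. valid_transduction T \<and> (\<forall>G \<in> C. \<exists>H \<in> D. \<exists>K \<in> outputs T H. graph_iso K G))"


section \<open>Graph classes\<close>

definition all_graphs :: "nat ugraph set" where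
  "all_graphs = {G. pair_graph G}"

definition half_graphs :: "nat ugraph set" where
  "half_graphs = {G. \<exists>(n :: nat) a b.
     inj_on a {1..n} \<and> inj_on b {1..n} \<and> a ` {1..n} \<inter> b ` {1..n} = {} \<and>
     pverts G = a ` {1..n} \<union> b ` {1..n} \<and>
     parcs G = {(a i, b j) | i j. 1 \<le> i \<and> i \<le> j \<and> j \<le> n} \<union>
               {(b j, a i) | i j. 1 \<le> i \<and> i \<le> j \<and> j \<le> n}}"

text \<open>A rooted forest on \<open>V\<close> is given by its parent relation: \<open>(u, v) \<in> F\<close> means that \<open>v\<close> is the parent
  of \<open>u\<close>, so \<open>F\<^sup>+\<close> relates each vertex to its proper ancestors.\<close>

definition rooted_forest :: "'a set \<Rightarrow> 'a rel \<Rightarrow> bool" where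
  "rooted_forest V F \<longleftrightarrow> finite V \<and> F \<subseteq> V \<times> V \<and> single_valued F \<and> acyclic F"

definition trivially_perfect_graphs :: "nat ugraph set" where
  "trivially_perfect_graphs = {G. \<exists>F. rooted_forest (pverts G) F \<and>
     parcs G = {(u, v). (u, v) \<in> F\<^sup>+ \<or> (v, u) \<in> F\<^sup>+}}"

definition monadically_dependent :: "nat ugraph set \<Rightarrow> bool" where
  "monadically_dependent C \<longleftrightarrow> \<not> all_graphs \<sqsubseteq>\<^sub>F\<^sub>O C"

definition monadically_stable :: "nat ugraph set \<Rightarrow> bool" where
  "monadically_stable C \<longleftrightarrow> \<not> half_graphs \<sqsubseteq>\<^sub>F\<^sub>O C"

definition monadically_straight :: "nat ugraph set \<Rightarrow> bool" where
  "monadically_straight C \<longleftrightarrow> \<not> trivially_perfect_graphs \<sqsubseteq>\<^sub>F\<^sub>O C"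


section \<open>Local properties\<close>

definition graph_dist :: "'a ugraph \<Rightarrow> 'a \<Rightarrow> 'a \<Rightarrow> ereal" where
  "graph_dist G = wf_digraph.\<mu> (with_proj G) (\<lambda>_. 1)"

definition ball_graph :: "nat \<Rightarrow> 'a ugraph \<Rightarrow> 'a \<Rightarrow> 'a ugraph" where
  "ball_graph r G v =
     (let B = {u \<in> pverts G. graph_dist G v u \<le> ereal (real r)}
      in \<lparr> pverts = B, parcs = parcs G \<inter> B \<times> B \<rparr>)"

definition loc :: "nat \<Rightarrow> 'a ugraph set \<Rightarrow> 'a ugraph set" where
  "loc r C = {ball_graph r G v | G v. G \<in> C \<and> v \<in> pverts G}"

definition locally_monadically_dependent :: "nat ugraph set \<Rightarrow> bool" where
  "locally_monadically_dependent C \<longleftrightarrow> (\<forall>r. monadically_dependent (loc r C))"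

definition locally_monadically_stable :: "nat ugraph set \<Rightarrow> bool" where
  "locally_monadically_stable C \<longleftrightarrow> (\<forall>r. monadically_stable (loc r C))"

definition locally_monadically_straight :: "nat ugraph set \<Rightarrow> bool" where
  "locally_monadically_straight C \<longleftrightarrow> (\<forall>r. monadically_straight (loc r C))"

end

theory Submission
  imports Defs "HOL-Library.FuncSet"
begin

text \<open>
  By Gaifman's theorem, whether a formula holds for a far pair of vertices depends only on the unary
  local types of the two vertices, and for a close pair only on a neighbourhood. So, up to flipping
  the adjacency between boundedly many colour classes, the output of a transduction has edges only
  between close vertices, and its balls are transductions of balls of the input; this property
  survives composition, because the flips can be undone in the next step. For each of the three
  target classes, every member embeds into a larger one in such a way that it stays within a ball of
  bounded radius whatever flips are applied. Hence a transduction from \<open>\<C>\<close> onto the target class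
  yields one from the balls of \<open>\<C>\<close>.
\<close>

section \<open>Neighbourhoods and induced subgraphs\<close>

text \<open>Flips are unavoidable, since a formula such as non-adjacency joins far vertices, but
  they can be undone inside any ball: a flip is described by boundedly many unary marks and reversed
  without quantifiers. Gaifman locality is put in a form that suits balls. A ball cannot evaluate
  the sentences of a Gaifman normal form, so for each marked graph one of finitely many local
  queries is correct for all tuples at once, and the index of that query is handed to the ball as a
  mark. The proof of locality combines a Feferman-Vaught splitting with scattered sets of witnesses.
  The order of choices shapes the statements: the radius \<open>s\<close> comes from the target
  class, the number \<open>c\<close> of colours from the transduction alone, and only then comes the
  larger member, which has to resist every flip with \<open>c\<close> colours. Some enlargement is
  essential, because a flip can tear a member apart: flipping a complete graph leaves no
  edges.\<close>

lemma pair_graph_iff: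
  "pair_graph G \<longleftrightarrow> finite (pverts G) \<and> parcs G \<subseteq> pverts G \<times> pverts G \<and>
     (\<forall>u v. (u, v) \<in> parcs G \<longrightarrow> (v, u) \<in> parcs G) \<and> (\<forall>v. (v, v) \<notin> parcs G)"
  (is "?L \<longleftrightarrow> ?R")
proof
  assume ?L
  then interpret pair_graph G .
  show ?R
    using pair_finite_verts arcs_symmetric no_loops' in_arcsD1 in_arcsD2 by fast
next
  assume R: ?R
  then have "finite (parcs G)"
    by (meson finite_SigmaI finite_subset)
  with R show ?L
    by unfold_locales (auto simp: symmetric_def sym_def)
qed

primrec nbh :: "'a ugraph \<Rightarrow> nat \<Rightarrow> 'a set \<Rightarrow> 'a set" where
  "nbh G 0 S = S \<inter> pverts G"
| "nbh G (Suc r) S = nbh G r S \<union> {u \<in> pverts G. \<exists>w \<in> nbh G r S. (w, u) \<in> parcs G}"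

definition ind :: "'a ugraph \<Rightarrow> 'a set \<Rightarrow> 'a ugraph" where
  "ind G S = \<lparr> pverts = pverts G \<inter> S, parcs = parcs G \<inter> S \<times> S \<rparr>"

lemma ind_simps [simp]:
  "pverts (ind G S) = pverts G \<inter> S"
  "parcs (ind G S) = parcs G \<inter> S \<times> S"
  by (simp_all add: ind_def)

lemma ind_ind: "S \<subseteq> B \<Longrightarrow> ind (ind G B) S = ind G S"
  by (auto simp: ind_def)

lemma pair_graph_ind: "pair_graph G \<Longrightarrow> pair_graph (ind G S)"
  by (auto simp: pair_graph_iff)

lemma nbh_subset: "nbh G r S \<subseteq> pverts G"
  by (induction r) auto

lemma nbh_mono: "S \<subseteq> T \<Longrightarrow> nbh G r S \<subseteq> nbh G r T"
  by (induction r) auto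

lemma nbh_mono_radius: "r \<le> r' \<Longrightarrow> nbh G r S \<subseteq> nbh G r' S"
  by (induction r' rule: dec_induct) auto

lemma nbh_self: "S \<subseteq> pverts G \<Longrightarrow> S \<subseteq> nbh G r S"
  using nbh_mono_radius[of 0 r G S] by auto

lemma nbh_Un: "nbh G r (S \<union> T) = nbh G r S \<union> nbh G r T"
  by (induction r) auto

lemma nbh_iff: "u \<in> nbh G r S \<longleftrightarrow> (\<exists>s \<in> S. u \<in> nbh G r {s})"
proof (induction r arbitrary: u)
  case (Suc r)
  show ?case
    unfolding nbh.simps Un_iff mem_Collect_eq using Suc.IH by blast
qed auto

lemma nbh_nbh: "nbh G a (nbh G b S) = nbh G (a + b) S"
  using nbh_subset[of G b S] by (induction a) auto

lemma nbh_sym: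
  assumes "pair_graph G"
  shows "u \<in> nbh G r {v} \<longleftrightarrow> v \<in> nbh G r {u}"
proof -
  have "v \<in> nbh G r {u}" if "u \<in> nbh G r {v}" for u v
    using that
  proof (induction r arbitrary: u)
    case (Suc r)
    consider "u \<in> nbh G r {v}" | w where "w \<in> nbh G r {v}" "(w, u) \<in> parcs G" "u \<in> pverts G"
      using Suc.prems by auto
    then show ?case
    proof cases
      case 1
      then show ?thesis using Suc.IH by auto
    next
      case 2
      have "w \<in> nbh G 1 {u}"
        using 2 assms by (auto simp: pair_graph_iff)
      then have "nbh G r {w} \<subseteq> nbh G r (nbh G 1 {u})"
        by (intro nbh_mono) auto
      then show ?thesis
        using Suc.IH[OF 2(1)] nbh_nbh[of G r 1 "{u}"] by (simp only: Suc_eq_plus1) blast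
    qed
  qed auto
  then show ?thesis by blast
qed

lemma nbh_trans: "u \<in> nbh G a {v} \<Longrightarrow> v \<in> nbh G b S \<Longrightarrow> u \<in> nbh G (a + b) S"
  by (metis nbh_iff nbh_nbh)

lemma nbh_ind: "nbh G r S \<subseteq> B \<Longrightarrow> nbh (ind G B) r S = nbh G r S"
proof (induction r)
  case (Suc r)
  then have "nbh G r S \<subseteq> B" by simp
  with Suc show ?case by (auto 4 4)
qed auto

text \<open>With unit costs the cost of a walk is its length, and a finite distance is attained by a
  path. The recursion of \<open>nbh\<close> corresponds to removing the last arc of a walk.\<close>

lemma graph_dist_le_iff:
  assumes "pair_graph G" "v \<in> pverts G"
  shows "graph_dist G v u \<le> ereal (real r) \<longleftrightarrow> u \<in> nbh G r {v}"
proof -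
  interpret pair_graph G by fact
  have cost: "awalk_cost (\<lambda>_. 1) p = real (length p)" for p :: "('a \<times> 'a) list"
    by (induction p) (auto simp: awalk_cost_def)
  have nbh_walk: "u \<in> nbh G r {v} \<longleftrightarrow> (\<exists>p. awalk v p u \<and> length p \<le> r)" for u r
  proof (induction r arbitrary: u)
    case 0
    show ?case using assms by (auto simp: awalk_Nil_iff)
  next
    case (Suc r)
    show ?case
    proof
      assume "u \<in> nbh G (Suc r) {v}"
      then consider "u \<in> nbh G r {v}" | w where "w \<in> nbh G r {v}" "(w, u) \<in> parcs G"
        by auto
      then show "\<exists>p. awalk v p u \<and> length p \<le> Suc r"
      proof cases
        case 1
        then show ?thesis using Suc.IH le_Suc_eq by blast
      next
        case 2
        then obtain p where "awalk v p w" "length p \<le> r" using Suc.IH by blast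
        with 2 have "awalk v (p @ [(w, u)]) u"
          by (auto simp: awalk_simps dest: in_arcsD2)
        with \<open>length p \<le> r\<close> show ?thesis
          by (intro exI[of _ "p @ [(w, u)]"]) auto
      qed
    next
      assume "\<exists>p. awalk v p u \<and> length p \<le> Suc r"
      then obtain p where p: "awalk v p u" "length p \<le> Suc r" by blast
      show "u \<in> nbh G (Suc r) {v}"
      proof (cases p rule: rev_cases)
        case Nil
        then have "u \<in> nbh G r {v}" using p Suc.IH by (metis le0 list.size(3))
        then show ?thesis by simp
      next
        case (snoc q a)
        then have "awalk v q (fst a)" "a \<in> parcs G" "snd a = u" "length q \<le> r"
          using p by (auto simp: awalk_simps)
        then show ?thesis
          using Suc.IH[of "fst a"] in_arcsD2[of "fst a" "snd a"] by (cases a) auto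
      qed
    qed
  qed
  show ?thesis
  proof
    assume le: "graph_dist G v u \<le> ereal (real r)"
    then have "\<mu> (\<lambda>_. 1) v u < \<infinity>"
      unfolding graph_dist_def by (rule le_less_trans) simp
    then have "v \<rightarrow>\<^sup>*\<^bsub>with_proj G\<^esub> u" using \<mu>_reach_conv by blast
    then obtain p where "apath v p u" "\<mu> (\<lambda>_. 1) v u = awalk_cost (\<lambda>_. 1) p"
      using min_cost_awalk[of v u "\<lambda>_. 1"] by auto
    then show "u \<in> nbh G r {v}"
      using le unfolding graph_dist_def nbh_walk cost by (auto simp: apath_def)
  next
    assume "u \<in> nbh G r {v}"
    then obtain p where "awalk v p u" "length p \<le> r" using nbh_walk by blast
    then show "graph_dist G v u \<le> ereal (real r)"
      using min_cost_le_walk_cost[of v p u "\<lambda>_. 1"] unfolding graph_dist_def cost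
      by (meson ereal_less_eq(3) of_nat_le_iff order_trans)
  qed
qed

lemma ball_graph_eq:
  assumes "pair_graph G" "v \<in> pverts G"
  shows "ball_graph r G v = ind G (nbh G r {v})"
proof -
  have "{u \<in> pverts G. graph_dist G v u \<le> ereal (real r)} = nbh G r {v}"
    using nbh_subset[of G r "{v}"] graph_dist_le_iff[OF assms] by auto
  moreover have "pverts G \<inter> nbh G r {v} = nbh G r {v}"
    using nbh_subset by (rule Int_absorb1)
  ultimately show ?thesis
    by (simp add: ball_graph_def ind_def Let_def)
qed


section \<open>Definable queries\<close>

type_synonym query = "nat ugraph \<Rightarrow> (nat \<Rightarrow> nat set) \<Rightarrow> (nat \<Rightarrow> nat) \<Rightarrow> bool"

text \<open>Definability is a property of semantic predicates, so formulas can be combined without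
  being written out. Agreement is demanded only on graphs and on parameters that are
  vertices.\<close>

definition dfn :: "nat set \<Rightarrow> query \<Rightarrow> bool" where
  "dfn X F \<longleftrightarrow> (\<exists>\<alpha>. free_vars \<alpha> \<subseteq> X \<and>
     (\<forall>H M e. pair_graph H \<longrightarrow> e ` X \<subseteq> pverts H \<longrightarrow> F H M e = sat H M e \<alpha>))"

lemma finite_free_vars: "finite (free_vars \<phi>)"
  by (induction \<phi>) auto

lemma finite_symbols: "finite (symbols \<phi>)"
  by (induction \<phi>) auto

lemma sat_env_cong: "(\<And>x. x \<in> free_vars \<phi> \<Longrightarrow> e x = e' x) \<Longrightarrow> sat H M e \<phi> = sat H M e' \<phi>"
proof (induction \<phi> arbitrary: e e')
  case (Ex v \<phi>)
  have "sat H M (e(v := a)) \<phi> = sat H M (e'(v := a)) \<phi>" for a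
    using Ex.prems by (intro Ex.IH) auto
  then show ?case by simp
next
  case (Neg \<phi>)
  then show ?case by (metis free_vars.simps(4) sat.simps(4))
next
  case (Conj \<phi> \<psi>)
  then show ?case by (metis UnCI free_vars.simps(5) sat.simps(5))
qed auto

lemma sat_mark_cong:
  assumes "\<And>s. s \<in> symbols \<phi> \<Longrightarrow> M s \<inter> pverts H = M' s \<inter> pverts H" "e ` free_vars \<phi> \<subseteq> pverts H"
  shows "sat H M e \<phi> = sat H M' e \<phi>"
  using assms
proof (induction \<phi> arbitrary: e)
  case (Ex v \<phi>)
  have "sat H M (e(v := a)) \<phi> = sat H M' (e(v := a)) \<phi>" if "a \<in> pverts H" for a
    using Ex.prems that by (intro Ex.IH) auto
  then show ?case by simp
next
  case (Conj \<phi> \<psi>)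
  then show ?case by (simp add: image_Un)
qed auto

lemma dfn_sat: "free_vars \<alpha> \<subseteq> X \<Longrightarrow> dfn X (\<lambda>H M e. sat H M e \<alpha>)"
  by (auto simp: dfn_def)

lemma dfn_cong:
  assumes "dfn X F" "\<And>H M e. pair_graph H \<Longrightarrow> e ` X \<subseteq> pverts H \<Longrightarrow> G H M e = F H M e"
  shows "dfn X G"
proof -
  obtain \<alpha> where "free_vars \<alpha> \<subseteq> X"
    "\<forall>H M e. pair_graph H \<longrightarrow> e ` X \<subseteq> pverts H \<longrightarrow> F H M e = sat H M e \<alpha>"
    using assms(1) unfolding dfn_def by blast
  then show ?thesis
    unfolding dfn_def using assms(2) by (intro exI[of _ \<alpha>]) simp
qed

lemma dfn_mono: "dfn X F \<Longrightarrow> X \<subseteq> Y \<Longrightarrow> dfn Y F"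
  unfolding dfn_def by (meson image_mono order_trans)

lemma dfn_env:
  assumes "dfn X F" "pair_graph H" "e ` X \<subseteq> pverts H" "\<And>x. x \<in> X \<Longrightarrow> e x = e' x"
  shows "F H M e = F H M e'"
proof -
  obtain \<alpha> where \<alpha>: "free_vars \<alpha> \<subseteq> X"
    "\<And>H M e. pair_graph H \<Longrightarrow> e ` X \<subseteq> pverts H \<Longrightarrow> F H M e = sat H M e \<alpha>"
    using assms(1) unfolding dfn_def by blast
  have "e' ` X \<subseteq> pverts H" using assms by force
  moreover have "sat H M e \<alpha> = sat H M e' \<alpha>"
    using \<alpha>(1) assms(4) by (intro sat_env_cong) auto
  ultimately show ?thesis using \<alpha>(2) assms by metis
qed

lemma dfn_eq: "dfn (insert x (insert y X)) (\<lambda>H M e. e x = e y)"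
  unfolding dfn_def by (rule exI[of _ "Eq x y"]) auto

lemma dfn_edge: "dfn (insert x (insert y X)) (\<lambda>H M e. (e x, e y) \<in> parcs H)"
  unfolding dfn_def by (rule exI[of _ "Edge x y"]) auto

lemma dfn_mark: "dfn (insert x X) (\<lambda>H M e. e x \<in> M s)"
  unfolding dfn_def by (rule exI[of _ "Mark s x"]) auto

lemma dfn_not: "dfn X F \<Longrightarrow> dfn X (\<lambda>H M e. \<not> F H M e)"
  unfolding dfn_def by (elim exE, rule_tac x = "Neg \<alpha>" in exI) auto

lemma dfn_conj: "dfn X F \<Longrightarrow> dfn X G \<Longrightarrow> dfn X (\<lambda>H M e. F H M e \<and> G H M e)"
  unfolding dfn_def by (elim exE, rule_tac x = "Conj \<alpha> \<alpha>'" in exI) auto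

lemma dfn_disj:
  assumes "dfn X F" "dfn X G"
  shows "dfn X (\<lambda>H M e. F H M e \<or> G H M e)"
  using dfn_not[OF dfn_conj[OF dfn_not[OF assms(1)] dfn_not[OF assms(2)]]] by simp

lemma dfn_const: "dfn X (\<lambda>H M e. b)"
proof -
  have "dfn X (\<lambda>H M e. True)"
    unfolding dfn_def by (rule exI[of _ "Neg (Ex 0 (Neg (Eq 0 0)))"]) auto
  then show ?thesis using dfn_not[of X "\<lambda>H M e. True"] by (cases b) auto
qed

lemma dfn_Ex:
  assumes "dfn (insert w X) F" "w \<notin> X"
  shows "dfn X (\<lambda>H M e. \<exists>v \<in> pverts H. F H M (e(w := v)))"
proof -
  obtain \<alpha> where \<alpha>: "free_vars \<alpha> \<subseteq> insert w X"
    "\<And>H M e. pair_graph H \<Longrightarrow> e ` insert w X \<subseteq> pverts H \<Longrightarrow> F H M e = sat H M e \<alpha>"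
    using assms(1) unfolding dfn_def by blast
  have "F H M (e(w := v)) = sat H M (e(w := v)) \<alpha>"
    if "pair_graph H" "e ` X \<subseteq> pverts H" "v \<in> pverts H" for H M e v
    using that by (intro \<alpha>(2)) auto
  then show ?thesis
    unfolding dfn_def using \<alpha>(1) by (intro exI[of _ "Ex w \<alpha>"]) auto
qed

lemma dfn_bex:
  assumes "finite I" "\<And>i. i \<in> I \<Longrightarrow> dfn X (F i)"
  shows "dfn X (\<lambda>H M e. \<exists>i \<in> I. F i H M e)"
  using assms
  by (induction I rule: finite_induct) (auto simp: dfn_const intro: dfn_disj)

text \<open>Quantifiers are relativised to \<open>U\<close>; the renaming \<open>\<pi>\<close> keeps them from capturing the
  parameters \<open>C\<close> of \<open>U\<close>.\<close>

lemma dfn_relativise: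
  assumes U: "\<And>w. dfn (insert w C) (\<lambda>H M e. e w \<in> U H e)"
    and cong: "\<And>H e e'. (\<And>c. c \<in> C \<Longrightarrow> e c = e' c) \<Longrightarrow> U H e = U H e'"
    and C: "finite C"
  shows "dfn (C \<union> \<pi> ` free_vars \<alpha>) (\<lambda>H M e. sat (ind H (U H e)) M (e \<circ> \<pi>) \<alpha>)"
proof (induction \<alpha> arbitrary: \<pi>)
  case (Eq x y)
  have "dfn (C \<union> \<pi> ` {x, y}) (\<lambda>H M e. e (\<pi> x) = e (\<pi> y))"
    by (rule dfn_mono[OF dfn_eq[of _ _ C]]) auto
  then show ?case by simp
next
  case (Edge x y)
  have "dfn (insert (\<pi> x) (insert (\<pi> y) C))
     (\<lambda>H M e. (e (\<pi> x), e (\<pi> y)) \<in> parcs H \<and> e (\<pi> x) \<in> U H e \<and> e (\<pi> y) \<in> U H e)"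
    by (intro dfn_conj dfn_edge dfn_mono[OF U]) auto
  then show ?case by (simp add: comp_def)
next
  case (Mark s x)
  then show ?case using dfn_mark[of "\<pi> x" C s] by simp
next
  case (Neg \<alpha>)
  then show ?case using dfn_not by simp
next
  case (Conj \<alpha> \<beta>)
  then show ?case
    unfolding sat.simps free_vars.simps
    by (intro dfn_conj dfn_mono[OF Conj.IH(1)] dfn_mono[OF Conj.IH(2)]) auto
next
  case (Ex v \<alpha>)
  let ?X = "C \<union> \<pi> ` (free_vars \<alpha> - {v})"
  obtain w where w: "w \<notin> C \<union> \<pi> ` free_vars \<alpha>"
    using ex_new_if_finite[OF infinite_UNIV_nat, of "C \<union> \<pi> ` free_vars \<alpha>"] C finite_free_vars
    by auto
  have "dfn (insert w ?X) (\<lambda>H M e. e w \<in> U H e \<and> sat (ind H (U H e)) M (e \<circ> \<pi>(v := w)) \<alpha>)"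
    by (intro dfn_conj dfn_mono[OF U] dfn_mono[OF Ex.IH]) auto
  then have "dfn ?X (\<lambda>H M e. \<exists>a \<in> pverts H. (e(w := a)) w \<in> U H (e(w := a)) \<and>
      sat (ind H (U H (e(w := a)))) M (e(w := a) \<circ> \<pi>(v := w)) \<alpha>)"
    by (rule dfn_Ex) (use w in auto)
  moreover have "sat (ind H (U H e)) M (e \<circ> \<pi>) (Ex v \<alpha>) =
      (\<exists>a \<in> pverts H. (e(w := a)) w \<in> U H (e(w := a)) \<and>
        sat (ind H (U H (e(w := a)))) M (e(w := a) \<circ> \<pi>(v := w)) \<alpha>)" for H M e
  proof -
    have "U H (e(w := a)) = U H e" for a
      using w by (intro cong) auto
    moreover have "sat K M (e(w := a) \<circ> \<pi>(v := w)) \<alpha> = sat K M ((e \<circ> \<pi>)(v := a)) \<alpha>" for K a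
      using w by (intro sat_env_cong) auto
    ultimately show ?thesis by auto
  qed
  ultimately show ?case unfolding free_vars.simps by presburger
qed

text \<open>Relativisation to the set of all vertices, with no parameters, already contains a
  capture-avoiding renaming of variables.\<close>

lemma dfn_subst:
  assumes "dfn X F"
  shows "dfn (\<pi> ` X) (\<lambda>H M e. F H M (e \<circ> \<pi>))"
proof -
  obtain \<alpha> where \<alpha>: "free_vars \<alpha> \<subseteq> X"
    "\<And>H M e. pair_graph H \<Longrightarrow> e ` X \<subseteq> pverts H \<Longrightarrow> F H M e = sat H M e \<alpha>"
    using assms(1) unfolding dfn_def by blast
  have "dfn {w} (\<lambda>H M e. e w \<in> pverts H)" for w
    by (rule dfn_cong[OF dfn_const[of _ True]]) auto
  then have "dfn ({} \<union> \<pi> ` free_vars \<alpha>) (\<lambda>H M e. sat (ind H (pverts H)) M (e \<circ> \<pi>) \<alpha>)"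
    by (intro dfn_relativise) auto
  then have "dfn (\<pi> ` X) (\<lambda>H M e. sat (ind H (pverts H)) M (e \<circ> \<pi>) \<alpha>)"
    using \<alpha>(1) by (elim dfn_mono) auto
  moreover have "ind H (pverts H) = H" if "pair_graph H" for H :: "nat ugraph"
    using that by (auto simp: ind_def pair_graph_iff Int_absorb2)
  ultimately show ?thesis
    using \<alpha>(2) by (elim dfn_cong) (auto simp: image_comp)
qed

primrec map_symbols :: "(nat \<Rightarrow> nat) \<Rightarrow> fm \<Rightarrow> fm" where
  "map_symbols h (Eq x y) = Eq x y"
| "map_symbols h (Edge x y) = Edge x y"
| "map_symbols h (Mark s x) = Mark (h s) x"
| "map_symbols h (Neg \<phi>) = Neg (map_symbols h \<phi>)"
| "map_symbols h (Conj \<phi> \<psi>) = Conj (map_symbols h \<phi>) (map_symbols h \<psi>)"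
| "map_symbols h (Ex x \<phi>) = Ex x (map_symbols h \<phi>)"

lemma free_vars_map_symbols: "free_vars (map_symbols h \<phi>) = free_vars \<phi>"
  by (induction \<phi>) auto

lemma sat_map_symbols: "sat H M e (map_symbols h \<phi>) = sat H (\<lambda>s. M (h s)) e \<phi>"
  by (induction \<phi> arbitrary: e) auto

lemma dfn_map_symbols:
  assumes "dfn X F"
  shows "dfn X (\<lambda>H M e. F H (\<lambda>s. M (h s)) e)"
  using assms unfolding dfn_def
  by (elim exE, rule_tac x = "map_symbols h \<alpha>" in exI)
     (auto simp: free_vars_map_symbols sat_map_symbols)

lemma dfn_nbh:
  assumes "finite X"
  shows "dfn (insert w X) (\<lambda>H M e. e w \<in> nbh H r (e ` X))"
proof (induction r arbitrary: w)
  case 0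
  have "dfn (insert w X) (\<lambda>H M e. \<exists>x \<in> X. e w = e x)"
    using assms by (intro dfn_bex dfn_mono[OF dfn_eq[of w _ "{}"]]) auto
  then show ?case by (rule dfn_cong) auto
next
  case (Suc r)
  obtain w' where w': "w' \<notin> insert w X"
    using ex_new_if_finite[OF infinite_UNIV_nat, of "insert w X"] assms by auto
  have "dfn (insert w' (insert w X)) (\<lambda>H M e. e w' \<in> nbh H r (e ` X) \<and> (e w', e w) \<in> parcs H)"
    by (intro dfn_conj dfn_mono[OF Suc.IH] dfn_mono[OF dfn_edge[of w' w "{}"]]) auto
  then have "dfn (insert w X) (\<lambda>H M e. \<exists>v \<in> pverts H. (e(w' := v)) w' \<in> nbh H r (e(w' := v) ` X) \<and>
      ((e(w' := v)) w', (e(w' := v)) w) \<in> parcs H)"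
    using w' by (rule dfn_Ex)
  with Suc.IH have "dfn (insert w X) (\<lambda>H M e. e w \<in> nbh H r (e ` X) \<or>
    (\<exists>v \<in> pverts H. (e(w' := v)) w' \<in> nbh H r (e(w' := v) ` X) \<and>
      ((e(w' := v)) w', (e(w' := v)) w) \<in> parcs H))"
    by (rule dfn_disj)
  then show ?case
  proof (rule dfn_cong)
    fix H :: "nat ugraph" and M :: "nat \<Rightarrow> nat set" and e :: "nat \<Rightarrow> nat"
    assume "e ` insert w X \<subseteq> pverts H"
    moreover have "e(w' := v) ` X = e ` X" for v
      using w' by auto
    ultimately show "(e w \<in> nbh H (Suc r) (e ` X)) = (e w \<in> nbh H r (e ` X) \<or>
        (\<exists>v \<in> pverts H. (e(w' := v)) w' \<in> nbh H r (e(w' := v) ` X) \<and>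
      ((e(w' := v)) w', (e(w' := v)) w) \<in> parcs H))"
      using w' nbh_subset[of H r "e ` X"] by auto
  qed
qed


section \<open>Local queries\<close>

text \<open>Invariance is required for every \<open>B\<close> containing the \<open>d\<close>-ball
  of the parameters, not just for the ball itself. This makes locality monotone in \<open>d\<close>
  and lets queries of different radii be evaluated in one common ball.\<close>

definition local :: "nat \<Rightarrow> nat set \<Rightarrow> query \<Rightarrow> bool" where
  "local d X F \<longleftrightarrow> dfn X F \<and>
     (\<forall>H M e B. pair_graph H \<longrightarrow> e ` X \<subseteq> pverts H \<longrightarrow> nbh H d (e ` X) \<subseteq> B \<longrightarrow>
        F (ind H B) M e = F H M e)"

lemma local_dfn: "local d X F \<Longrightarrow> dfn X F"
  by (simp add: local_def)

lemma local_ind: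
  "local d X F \<Longrightarrow> pair_graph H \<Longrightarrow> e ` X \<subseteq> pverts H \<Longrightarrow> nbh H d (e ` X) \<subseteq> B \<Longrightarrow>
    F (ind H B) M e = F H M e"
  by (simp add: local_def)

lemma local_mono:
  assumes "local d X F" "d \<le> d'" "X \<subseteq> X'"
  shows "local d' X' F"
proof -
  have "F (ind H B) M e = F H M e"
    if "pair_graph H" "e ` X' \<subseteq> pverts H" "nbh H d' (e ` X') \<subseteq> B" for H M e B
  proof (rule local_ind[OF assms(1) that(1)])
    show "e ` X \<subseteq> pverts H" using that assms by auto
    show "nbh H d (e ` X) \<subseteq> B"
      using that(3) nbh_mono_radius[OF assms(2), of H "e ` X"] nbh_mono[of "e ` X" "e ` X'" H d']
        assms(3) by (meson image_mono order_trans)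
  qed
  then show ?thesis
    using assms dfn_mono unfolding local_def by blast
qed

lemma local_const: "local d X (\<lambda>H M e. b)"
  by (simp add: local_def dfn_const)

lemma local_not: "local d X F \<Longrightarrow> local d X (\<lambda>H M e. \<not> F H M e)"
  by (simp add: local_def dfn_not)

lemma local_conj: "local d X F \<Longrightarrow> local d X G \<Longrightarrow> local d X (\<lambda>H M e. F H M e \<and> G H M e)"
  by (simp add: local_def dfn_conj)

lemma local_subst:
  assumes "local d X F"
  shows "local d (\<pi> ` X) (\<lambda>H M e. F H M (e \<circ> \<pi>))"
  using assms unfolding local_def by (auto intro!: dfn_subst simp: image_comp)

lemma local_nbh:
  assumes "finite X"
  shows "local r (insert w X) (\<lambda>H M e. e w \<in> nbh H r (e ` X))"
proof -
  have "nbh (ind H B) r (e ` X) = nbh H r (e ` X)"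
    if "nbh H r (e ` insert w X) \<subseteq> B" for H :: "nat ugraph" and e :: "nat \<Rightarrow> nat" and B
    using that nbh_mono[of "e ` X" "e ` insert w X" H r] by (intro nbh_ind) blast
  then show ?thesis
    unfolding local_def using dfn_nbh[OF assms] by simp
qed

text \<open>The radii add up: the \<open>d\<close>-ball of a witness at distance at most
  \<open>r\<close> from the parameters lies in their \<open>(d + r)\<close>-ball.\<close>

lemma local_nbh_Ex:
  assumes "local d (insert w X) F" "w \<notin> X" "finite X"
  shows "local (d + r) X (\<lambda>H M e. \<exists>v \<in> nbh H r (e ` X). F H M (e(w := v)))"
  unfolding local_def
proof (intro conjI allI impI)
  have "dfn (insert w X) (\<lambda>H M e. e w \<in> nbh H r (e ` X) \<and> F H M e)"
    using assms by (intro dfn_conj dfn_nbh local_dfn)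
  then have "dfn X (\<lambda>H M e. \<exists>v \<in> pverts H. (e(w := v)) w \<in> nbh H r (e(w := v) ` X) \<and> F H M (e(w := v)))"
    using assms(2) by (rule dfn_Ex)
  then show "dfn X (\<lambda>H M e. \<exists>v \<in> nbh H r (e ` X). F H M (e(w := v)))"
  proof (rule dfn_cong)
    fix H :: "nat ugraph" and M :: "nat \<Rightarrow> nat set" and e :: "nat \<Rightarrow> nat"
    have "e(w := v) ` X = e ` X" for v
      using assms(2) by auto
    then show "(\<exists>v \<in> nbh H r (e ` X). F H M (e(w := v))) =
        (\<exists>v \<in> pverts H. (e(w := v)) w \<in> nbh H r (e(w := v) ` X) \<and> F H M (e(w := v)))"
      using nbh_subset[of H r "e ` X"] by auto
  qed
next
  fix H :: "nat ugraph" and M :: "nat \<Rightarrow> nat set" and e :: "nat \<Rightarrow> nat" and B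
  assume H: "pair_graph H" and e: "e ` X \<subseteq> pverts H" and B: "nbh H (d + r) (e ` X) \<subseteq> B"
  have "nbh (ind H B) r (e ` X) = nbh H r (e ` X)"
    using B nbh_mono_radius[of r "d + r" H "e ` X"] by (intro nbh_ind) auto
  moreover have "F (ind H B) M (e(w := v)) = F H M (e(w := v))" if v: "v \<in> nbh H r (e ` X)" for v
  proof (rule local_ind[OF assms(1) H])
    show "e(w := v) ` insert w X \<subseteq> pverts H"
      using e v nbh_subset by fastforce
    have "e(w := v) ` insert w X \<subseteq> nbh H r (e ` X)"
      using v nbh_self[OF e, of r] assms(2) by auto
    then have "nbh H d (e(w := v) ` insert w X) \<subseteq> nbh H d (nbh H r (e ` X))"
      by (rule nbh_mono)
    then show "nbh H d (e(w := v) ` insert w X) \<subseteq> B"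
      using B by (simp add: nbh_nbh)
  qed
  ultimately show "(\<exists>v \<in> nbh (ind H B) r (e ` X). F (ind H B) M (e(w := v))) =
      (\<exists>v \<in> nbh H r (e ` X). F H M (e(w := v)))"
    by auto
qed

lemma local_relativise:
  assumes "free_vars \<alpha> \<subseteq> X" "finite X"
  shows "local d X (\<lambda>H M e. sat (ind H (nbh H d (e ` X))) M e \<alpha>)"
  unfolding local_def
proof (intro conjI allI impI)
  have "dfn (X \<union> id ` free_vars \<alpha>) (\<lambda>H M e. sat (ind H (nbh H d (e ` X))) M (e \<circ> id) \<alpha>)"
    using assms(2) by (intro dfn_relativise dfn_nbh) (auto cong: image_cong)
  then show "dfn X (\<lambda>H M e. sat (ind H (nbh H d (e ` X))) M e \<alpha>)"
    using assms(1) by (simp add: Un_absorb2)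
next
  fix H :: "nat ugraph" and M :: "nat \<Rightarrow> nat set" and e :: "nat \<Rightarrow> nat" and B
  assume B: "nbh H d (e ` X) \<subseteq> B"
  then have "ind (ind H B) (nbh (ind H B) d (e ` X)) = ind H (nbh H d (e ` X))"
    by (simp add: nbh_ind ind_ind)
  then show "sat (ind (ind H B) (nbh (ind H B) d (e ` X))) M e \<alpha> = sat (ind H (nbh H d (e ` X))) M e \<alpha>"
    by simp
qed


section \<open>Splitting formulas over disjoint unions\<close>

definition separated :: "nat ugraph \<Rightarrow> nat set \<Rightarrow> nat set \<Rightarrow> bool" where
  "separated H A B \<longleftrightarrow> pair_graph H \<and> A \<subseteq> pverts H \<and> B \<subseteq> pverts H \<and> A \<inter> B = {} \<and>
     (\<forall>a \<in> A. \<forall>b \<in> B. (a, b) \<notin> parcs H)"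

definition split_holds :: "(fm \<times> fm) list \<Rightarrow> nat ugraph \<Rightarrow> (nat \<Rightarrow> nat set) \<Rightarrow> (nat \<Rightarrow> nat) \<Rightarrow>
    nat set \<Rightarrow> nat set \<Rightarrow> bool" where
  "split_holds L H M e A B \<longleftrightarrow> (\<exists>(\<beta>, \<gamma>) \<in> set L. sat (ind H A) M e \<beta> \<and> sat (ind H B) M e \<gamma>)"

text \<open>This is the Feferman-Vaught normal form: a finite disjunction of conjunctions of a
  condition on \<open>A\<close> and a condition on \<open>B\<close>. The list \<open>L\<close> is
  fixed before \<open>H\<close>, \<open>M\<close>, \<open>e\<close>, \<open>A\<close> and
  \<open>B\<close>; \<open>X\<close> and \<open>Y\<close> are the variables with values in
  \<open>A\<close> and \<open>B\<close>.\<close>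

definition union_query :: "nat set \<Rightarrow> nat set \<Rightarrow>
    (nat ugraph \<Rightarrow> (nat \<Rightarrow> nat set) \<Rightarrow> (nat \<Rightarrow> nat) \<Rightarrow> nat set \<Rightarrow> nat set \<Rightarrow> bool) \<Rightarrow> bool" where
  "union_query X Y Q \<longleftrightarrow> (\<exists>L. (\<forall>(\<beta>, \<gamma>) \<in> set L. free_vars \<beta> \<subseteq> X \<and> free_vars \<gamma> \<subseteq> Y) \<and>
     (\<forall>H M e A B. separated H A B \<longrightarrow> e ` X \<subseteq> A \<longrightarrow> e ` Y \<subseteq> B \<longrightarrow>
        Q H M e A B = split_holds L H M e A B))"

lemma union_queryI:
  assumes "\<And>\<beta> \<gamma>. (\<beta>, \<gamma>) \<in> set L \<Longrightarrow> free_vars \<beta> \<subseteq> X \<and> free_vars \<gamma> \<subseteq> Y"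
    and "\<And>H M e A B. separated H A B \<Longrightarrow> e ` X \<subseteq> A \<Longrightarrow> e ` Y \<subseteq> B \<Longrightarrow>
      Q H M e A B = split_holds L H M e A B"
  shows "union_query X Y Q"
  unfolding union_query_def using assms by (intro exI[of _ L]) auto

lemma union_queryE:
  assumes "union_query X Y Q"
  obtains L where "\<And>\<beta> \<gamma>. (\<beta>, \<gamma>) \<in> set L \<Longrightarrow> free_vars \<beta> \<subseteq> X \<and> free_vars \<gamma> \<subseteq> Y"
    and "\<And>H M e A B. separated H A B \<Longrightarrow> e ` X \<subseteq> A \<Longrightarrow> e ` Y \<subseteq> B \<Longrightarrow>
      Q H M e A B = split_holds L H M e A B"
  using assms that unfolding union_query_def by blast

definition top_fm :: fm where
  "top_fm = Neg (Ex 0 (Neg (Eq 0 0)))"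

lemma top_fm [simp]: "free_vars top_fm = {}" "sat H M e top_fm"
  by (auto simp: top_fm_def)

lemma union_query_cong:
  assumes "union_query X Y Q"
    and "\<And>H M e A B. separated H A B \<Longrightarrow> e ` X \<subseteq> A \<Longrightarrow> e ` Y \<subseteq> B \<Longrightarrow> Q' H M e A B = Q H M e A B"
  shows "union_query X Y Q'"
  using assms(1) by (rule union_queryE) (rule union_queryI, auto simp: assms(2))

lemma union_query_left:
  assumes "free_vars \<beta> \<subseteq> X"
  shows "union_query X Y (\<lambda>H M e A B. sat (ind H A) M e \<beta>)"
  by (rule union_queryI[of "[(\<beta>, top_fm)]"]) (use assms in \<open>auto simp: split_holds_def\<close>)

lemma union_query_right:
  assumes "free_vars \<beta> \<subseteq> Y"
  shows "union_query X Y (\<lambda>H M e A B. sat (ind H B) M e \<beta>)"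
  by (rule union_queryI[of "[(top_fm, \<beta>)]"]) (use assms in \<open>auto simp: split_holds_def\<close>)

lemma union_query_False: "union_query X Y (\<lambda>H M e A B. False)"
  by (rule union_queryI[of "[]"]) (auto simp: split_holds_def)

lemma union_query_True: "union_query X Y (\<lambda>H M e A B. True)"
  by (rule union_queryI[of "[(top_fm, top_fm)]"]) (auto simp: split_holds_def)

lemma union_query_disj:
  assumes "union_query X Y Q" "union_query X Y Q'"
  shows "union_query X Y (\<lambda>H M e A B. Q H M e A B \<or> Q' H M e A B)"
proof -
  from assms obtain L L' where
    L: "\<And>\<beta> \<gamma>. (\<beta>, \<gamma>) \<in> set L \<Longrightarrow> free_vars \<beta> \<subseteq> X \<and> free_vars \<gamma> \<subseteq> Y"
      "\<And>H M e A B. separated H A B \<Longrightarrow> e ` X \<subseteq> A \<Longrightarrow> e ` Y \<subseteq> B \<Longrightarrow>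
        Q H M e A B = split_holds L H M e A B" and
    L': "\<And>\<beta> \<gamma>. (\<beta>, \<gamma>) \<in> set L' \<Longrightarrow> free_vars \<beta> \<subseteq> X \<and> free_vars \<gamma> \<subseteq> Y"
      "\<And>H M e A B. separated H A B \<Longrightarrow> e ` X \<subseteq> A \<Longrightarrow> e ` Y \<subseteq> B \<Longrightarrow>
        Q' H M e A B = split_holds L' H M e A B"
    by (elim union_queryE) blast
  show ?thesis
  proof (rule union_queryI[of "L @ L'"])
    fix \<beta> \<gamma> assume "(\<beta>, \<gamma>) \<in> set (L @ L')"
    then show "free_vars \<beta> \<subseteq> X \<and> free_vars \<gamma> \<subseteq> Y"
      using L(1)[of \<beta> \<gamma>] L'(1)[of \<beta> \<gamma>] by auto
  qed (simp add: L L' split_holds_def bex_Un)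
qed

lemma union_query_conj:
  assumes "union_query X Y Q" "union_query X Y Q'"
  shows "union_query X Y (\<lambda>H M e A B. Q H M e A B \<and> Q' H M e A B)"
proof -
  from assms obtain L L' where
    L: "\<And>\<beta> \<gamma>. (\<beta>, \<gamma>) \<in> set L \<Longrightarrow> free_vars \<beta> \<subseteq> X \<and> free_vars \<gamma> \<subseteq> Y"
      "\<And>H M e A B. separated H A B \<Longrightarrow> e ` X \<subseteq> A \<Longrightarrow> e ` Y \<subseteq> B \<Longrightarrow>
        Q H M e A B = split_holds L H M e A B" and
    L': "\<And>\<beta> \<gamma>. (\<beta>, \<gamma>) \<in> set L' \<Longrightarrow> free_vars \<beta> \<subseteq> X \<and> free_vars \<gamma> \<subseteq> Y"
      "\<And>H M e A B. separated H A B \<Longrightarrow> e ` X \<subseteq> A \<Longrightarrow> e ` Y \<subseteq> B \<Longrightarrow>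
        Q' H M e A B = split_holds L' H M e A B"
    by (elim union_queryE) blast
  let ?L = "[(Conj \<beta> \<beta>', Conj \<gamma> \<gamma>'). (\<beta>, \<gamma>) \<leftarrow> L, (\<beta>', \<gamma>') \<leftarrow> L']"
  show ?thesis
  proof (rule union_queryI[of ?L])
    fix \<beta> \<gamma> assume "(\<beta>, \<gamma>) \<in> set ?L"
    then show "free_vars \<beta> \<subseteq> X \<and> free_vars \<gamma> \<subseteq> Y" using L(1) L'(1) by fastforce
  next
    fix H :: "nat ugraph" and M :: "nat \<Rightarrow> nat set" and e :: "nat \<Rightarrow> nat" and A B
    assume *: "separated H A B" "e ` X \<subseteq> A" "e ` Y \<subseteq> B"
    have "split_holds ?L H M e A B \<longleftrightarrow> split_holds L H M e A B \<and> split_holds L' H M e A B"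
      unfolding split_holds_def by fastforce
    then show "(Q H M e A B \<and> Q' H M e A B) = split_holds ?L H M e A B"
      using L(2)[OF *] L'(2)[OF *] by blast
  qed
qed

text \<open>By De Morgan the negation is a conjunction of clauses, one for each pair in the list,
  and each clause is a disjunction of a left and a right condition. Induction on the list brings it
  back to normal form.\<close>

lemma union_query_not:
  assumes "union_query X Y Q"
  shows "union_query X Y (\<lambda>H M e A B. \<not> Q H M e A B)"
proof -
  from assms obtain L where
    L: "\<And>\<beta> \<gamma>. (\<beta>, \<gamma>) \<in> set L \<Longrightarrow> free_vars \<beta> \<subseteq> X \<and> free_vars \<gamma> \<subseteq> Y"
      "\<And>H M e A B. separated H A B \<Longrightarrow> e ` X \<subseteq> A \<Longrightarrow> e ` Y \<subseteq> B \<Longrightarrow>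
        Q H M e A B = split_holds L H M e A B"
    by (elim union_queryE) blast
  have "union_query X Y (\<lambda>H M e A B. \<not> split_holds L H M e A B)"
    using L(1)
  proof (induction L)
    case Nil
    then show ?case by (simp add: union_query_True split_holds_def)
  next
    case (Cons p L)
    obtain \<beta> \<gamma> where p: "p = (\<beta>, \<gamma>)" by fastforce
    have "union_query X Y (\<lambda>H M e A B. (sat (ind H A) M e (Neg \<beta>) \<or> sat (ind H B) M e (Neg \<gamma>)) \<and>
        \<not> split_holds L H M e A B)"
      using Cons p
      by (intro union_query_conj union_query_disj union_query_left union_query_right) auto
    then show ?case by (rule union_query_cong) (auto simp: p split_holds_def)
  qed
  then show ?thesis
    by (rule union_query_cong) (simp add: L(2))
qed

text \<open>The quantifier distributes over the disjunction and affects only the left conjunct,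
  because \<open>v\<close> is not free in the right one. If \<open>v\<close> belongs to
  \<open>Y\<close>, the quantifier shadows it, hence \<open>Y - {v}\<close> in the
  hypothesis.\<close>

lemma union_query_Ex_left:
  assumes "union_query (insert v X) (Y - {v}) Q"
  shows "union_query X Y (\<lambda>H M e A B. \<exists>a \<in> A. Q H M (e(v := a)) A B)"
proof -
  from assms obtain L where
    L: "\<And>\<beta> \<gamma>. (\<beta>, \<gamma>) \<in> set L \<Longrightarrow> free_vars \<beta> \<subseteq> insert v X \<and> free_vars \<gamma> \<subseteq> Y - {v}"
      "\<And>H M e A B. separated H A B \<Longrightarrow> e ` insert v X \<subseteq> A \<Longrightarrow> e ` (Y - {v}) \<subseteq> B \<Longrightarrow>
        Q H M e A B = split_holds L H M e A B"
    by (elim union_queryE) blast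
  let ?L = "map (\<lambda>(\<beta>, \<gamma>). (Ex v \<beta>, \<gamma>)) L"
  show ?thesis
  proof (rule union_queryI[of ?L])
    fix \<beta> \<gamma> assume "(\<beta>, \<gamma>) \<in> set ?L"
    then show "free_vars \<beta> \<subseteq> X \<and> free_vars \<gamma> \<subseteq> Y" using L(1) by fastforce
  next
    fix H :: "nat ugraph" and M :: "nat \<Rightarrow> nat set" and e :: "nat \<Rightarrow> nat" and A B
    assume *: "separated H A B" and e: "e ` X \<subseteq> A" "e ` Y \<subseteq> B"
    have "Q H M (e(v := a)) A B \<longleftrightarrow>
        (\<exists>(\<beta>, \<gamma>) \<in> set L. sat (ind H A) M (e(v := a)) \<beta> \<and> sat (ind H B) M e \<gamma>)"
      if "a \<in> A" for a
    proof -
      have "Q H M (e(v := a)) A B \<longleftrightarrow> split_holds L H M (e(v := a)) A B"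
        using that e by (intro L(2) *) auto
      moreover have "sat (ind H B) M (e(v := a)) \<gamma> = sat (ind H B) M e \<gamma>" if "(\<beta>, \<gamma>) \<in> set L" for \<beta> \<gamma>
        using L(1)[OF that] by (intro sat_env_cong) auto
      ultimately show ?thesis unfolding split_holds_def by fast
    qed
    then have "(\<exists>a \<in> A. Q H M (e(v := a)) A B) \<longleftrightarrow>
        (\<exists>a \<in> A. \<exists>(\<beta>, \<gamma>) \<in> set L. sat (ind H A) M (e(v := a)) \<beta> \<and> sat (ind H B) M e \<gamma>)"
      by blast
    also have "\<dots> \<longleftrightarrow> (\<exists>(\<beta>, \<gamma>) \<in> set L. (\<exists>a \<in> A. sat (ind H A) M (e(v := a)) \<beta>) \<and> sat (ind H B) M e \<gamma>)"
      by fast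
    also have "\<dots> \<longleftrightarrow> (\<exists>(\<beta>, \<gamma>) \<in> set L. sat (ind H A) M e (Ex v \<beta>) \<and> sat (ind H B) M e \<gamma>)"
      using * by (simp add: separated_def Int_absorb1)
    finally show "(\<exists>a \<in> A. Q H M (e(v := a)) A B) \<longleftrightarrow> split_holds ?L H M e A B"
      by (simp add: split_holds_def case_prod_beta)
  qed
qed

lemma separated_commute: "separated H A B \<Longrightarrow> separated H B A"
  unfolding separated_def pair_graph_iff by blast

lemma union_query_swap:
  assumes "union_query X Y Q"
  shows "union_query Y X (\<lambda>H M e A B. Q H M e B A)"
proof -
  from assms obtain L where
    L: "\<And>\<beta> \<gamma>. (\<beta>, \<gamma>) \<in> set L \<Longrightarrow> free_vars \<beta> \<subseteq> X \<and> free_vars \<gamma> \<subseteq> Y"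
      "\<And>H M e A B. separated H A B \<Longrightarrow> e ` X \<subseteq> A \<Longrightarrow> e ` Y \<subseteq> B \<Longrightarrow>
        Q H M e A B = split_holds L H M e A B"
    by (elim union_queryE) blast
  show ?thesis
    by (rule union_queryI[of "map prod.swap L"])
       (use L(1) in \<open>auto simp: L(2)[OF separated_commute] split_holds_def\<close>)
qed

text \<open>Atoms with one variable on each side are false, since the two parts are disjoint and
  have no edges between them. A quantifier splits into a witness in \<open>A\<close> and a witness
  in \<open>B\<close>, which changes the partition of the variables; hence the induction generalises
  over \<open>X\<close> and \<open>Y\<close>.\<close>

lemma union_query_sat:
  assumes "free_vars \<alpha> \<subseteq> X \<union> Y" "X \<inter> Y = {}"
  shows "union_query X Y (\<lambda>H M e A B. sat (ind H (A \<union> B)) M e \<alpha>)"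
  using assms
proof (induction \<alpha> arbitrary: X Y)
  case (Eq x y)
  consider "x \<in> X" "y \<in> X" | "x \<in> Y" "y \<in> Y" | "x \<in> X" "y \<in> Y" | "x \<in> Y" "y \<in> X"
    using Eq by auto
  then show ?case
  proof cases
    case 1
    then show ?thesis using union_query_left[of "Eq x y" X Y] by simp
  next
    case 2
    then show ?thesis using union_query_right[of "Eq x y" Y X] by simp
  qed (rule union_query_cong[OF union_query_False], force simp: separated_def)+
next
  case (Edge x y)
  consider "x \<in> X" "y \<in> X" | "x \<in> Y" "y \<in> Y" | "x \<in> X" "y \<in> Y" | "x \<in> Y" "y \<in> X"
    using Edge by auto
  then show ?case
  proof cases
    case 1
    then have "free_vars (Edge x y) \<subseteq> X" by simp
    from union_query_left[OF this, of Y] show ?thesis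
      by (rule union_query_cong) (use 1 in auto)
  next
    case 2
    then have "free_vars (Edge x y) \<subseteq> Y" by simp
    from union_query_right[OF this, of X] show ?thesis
      by (rule union_query_cong) (use 2 in auto)
  next
    case 3
    show ?thesis
    proof (rule union_query_cong[OF union_query_False])
      fix H :: "nat ugraph" and M :: "nat \<Rightarrow> nat set" and e :: "nat \<Rightarrow> nat" and A B
      assume "separated H A B" "e ` X \<subseteq> A" "e ` Y \<subseteq> B"
      moreover from this have "e x \<in> A" "e y \<in> B" using 3 by auto
      ultimately show "sat (ind H (A \<union> B)) M e (Edge x y) = False"
        by (simp add: separated_def)
    qed
  next
    case 4
    show ?thesis
    proof (rule union_query_cong[OF union_query_False])
      fix H :: "nat ugraph" and M :: "nat \<Rightarrow> nat set" and e :: "nat \<Rightarrow> nat" and A B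
      assume "separated H A B" "e ` X \<subseteq> A" "e ` Y \<subseteq> B"
      then have "separated H B A" "e x \<in> B" "e y \<in> A"
        using 4 separated_commute by auto
      then show "sat (ind H (A \<union> B)) M e (Edge x y) = False"
        by (simp add: separated_def)
    qed
  qed
next
  case (Mark s x)
  then consider "x \<in> X" | "x \<in> Y" by auto
  then show ?case
  proof cases
    case 1
    then show ?thesis using union_query_left[of "Mark s x" X Y] by simp
  next
    case 2
    then show ?thesis using union_query_right[of "Mark s x" Y X] by simp
  qed
next
  case (Neg \<alpha>)
  then show ?case using union_query_not by simp
next
  case (Conj \<alpha> \<beta>)
  then show ?case using union_query_conj by simp
next
  case (Ex v \<alpha>)
  have "union_query (insert v X) (Y - {v}) (\<lambda>H M e A B. sat (ind H (A \<union> B)) M e \<alpha>)"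
    using Ex.prems by (intro Ex.IH) auto
  then have 1: "union_query X Y (\<lambda>H M e A B. \<exists>a \<in> A. sat (ind H (A \<union> B)) M (e(v := a)) \<alpha>)"
    by (rule union_query_Ex_left)
  have "union_query (X - {v}) (insert v Y) (\<lambda>H M e A B. sat (ind H (A \<union> B)) M e \<alpha>)"
    using Ex.prems by (intro Ex.IH) auto
  from union_query_swap[OF union_query_Ex_left[OF union_query_swap[OF this]]]
  have 2: "union_query X Y (\<lambda>H M e A B. \<exists>a \<in> B. sat (ind H (A \<union> B)) M (e(v := a)) \<alpha>)" .
  show ?case
    by (rule union_query_cong[OF union_query_disj[OF 1 2]]) (auto simp: separated_def)
qed

text \<open>If the distance from \<open>X\<close> to \<open>Y\<close> exceeds
  \<open>2 * d + 1\<close>, then the two \<open>d\<close>-balls are disjoint and no edge joins them.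
  Locality restricts \<open>F\<close> to their union, and there the Feferman-Vaught form
  applies.\<close>

lemma local_split:
  assumes "local d (X \<union> Y) F" "X \<inter> Y = {}" "finite X" "finite Y"
  obtains L where "\<And>G G'. (G, G') \<in> set L \<Longrightarrow> local d X G \<and> local d Y G'"
    and "\<And>H M e. pair_graph H \<Longrightarrow> e ` (X \<union> Y) \<subseteq> pverts H \<Longrightarrow>
      nbh H (2 * d + 1) (e ` X) \<inter> e ` Y = {} \<Longrightarrow>
      F H M e \<longleftrightarrow> (\<exists>(G, G') \<in> set L. G H M e \<and> G' H M e)"
proof -
  obtain \<alpha> where \<alpha>: "free_vars \<alpha> \<subseteq> X \<union> Y"
    "\<And>H M e. pair_graph H \<Longrightarrow> e ` (X \<union> Y) \<subseteq> pverts H \<Longrightarrow> F H M e = sat H M e \<alpha>"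
    using local_dfn[OF assms(1)] unfolding dfn_def by blast
  from union_query_sat[OF \<alpha>(1) assms(2)] obtain L where
    L: "\<And>\<beta> \<gamma>. (\<beta>, \<gamma>) \<in> set L \<Longrightarrow> free_vars \<beta> \<subseteq> X \<and> free_vars \<gamma> \<subseteq> Y"
      "\<And>H M e A B. separated H A B \<Longrightarrow> e ` X \<subseteq> A \<Longrightarrow> e ` Y \<subseteq> B \<Longrightarrow>
        sat (ind H (A \<union> B)) M e \<alpha> = split_holds L H M e A B"
    by (elim union_queryE) blast
  define near :: "nat set \<Rightarrow> fm \<Rightarrow> query"
    where "near Z \<beta> = (\<lambda>H M e. sat (ind H (nbh H d (e ` Z))) M e \<beta>)" for Z \<beta>
  show ?thesis
  proof (rule that[of "map (\<lambda>(\<beta>, \<gamma>). (near X \<beta>, near Y \<gamma>)) L"])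
    fix G G' assume "(G, G') \<in> set (map (\<lambda>(\<beta>, \<gamma>). (near X \<beta>, near Y \<gamma>)) L)"
    then show "local d X G \<and> local d Y G'"
      using L(1) assms(3,4) unfolding near_def by (auto intro!: local_relativise)
  next
    fix H :: "nat ugraph" and M :: "nat \<Rightarrow> nat set" and e :: "nat \<Rightarrow> nat"
    assume H: "pair_graph H" and e: "e ` (X \<union> Y) \<subseteq> pverts H"
      and far: "nbh H (2 * d + 1) (e ` X) \<inter> e ` Y = {}"
    let ?A = "nbh H d (e ` X)" and ?B = "nbh H d (e ` Y)"
    \<comment> \<open>Distance at most 1 covers both a common vertex and an edge between the two
      balls.\<close>
    have apart: False if ab: "a \<in> ?A" "b \<in> ?B" "b \<in> nbh H 1 {a}" for a b
    proof -
      obtain y where y: "y \<in> e ` Y" "b \<in> nbh H d {y}"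
        using ab(2) nbh_iff by metis
      have "y \<in> nbh H d {b}" using y(2) nbh_sym[OF H] by blast
      then have "y \<in> nbh H (d + (1 + d)) (e ` X)"
        using ab nbh_trans by metis
      moreover have "d + (1 + d) = 2 * d + 1" by simp
      ultimately show False using far y(1) by (metis disjoint_iff)
    qed
    have "?A \<inter> ?B = {}"
      using apart nbh_subset[of H d] nbh_self[of "{_}" H 1] by blast
    moreover have "\<forall>a \<in> ?A. \<forall>b \<in> ?B. (a, b) \<notin> parcs H"
      using apart H by (fastforce simp: pair_graph_iff)
    moreover have "e ` X \<subseteq> ?A" "e ` Y \<subseteq> ?B"
      using e by (auto intro!: nbh_self[THEN subsetD])
    ultimately have "sat (ind H (?A \<union> ?B)) M e \<alpha> = split_holds L H M e ?A ?B"
      using H nbh_subset[of H d] by (intro L(2)) (simp_all add: separated_def)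
    moreover have "F H M e = sat (ind H (?A \<union> ?B)) M e \<alpha>"
    proof -
      have *: "nbh H d (e ` (X \<union> Y)) = ?A \<union> ?B"
        by (simp add: image_Un nbh_Un)
      have "F H M e = F (ind H (?A \<union> ?B)) M e"
        using local_ind[OF assms(1) H e] * by auto
      also have "\<dots> = sat (ind H (?A \<union> ?B)) M e \<alpha>"
        using e nbh_self[OF e, of d] * by (intro \<alpha>(2) pair_graph_ind H) auto
      finally show ?thesis .
    qed
    ultimately show "F H M e \<longleftrightarrow>
        (\<exists>(G, G') \<in> set (map (\<lambda>(\<beta>, \<gamma>). (near X \<beta>, near Y \<gamma>)) L). G H M e \<and> G' H M e)"
      by (simp add: near_def case_prod_beta split_holds_def)
  qed
qed


section \<open>Gaifman locality\<close>

text \<open>The sentences of Gaifman's theorem are replaced by a choice of \<open>F\<close> from a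
  finite set, which may depend on \<open>H\<close> and \<open>M\<close> but not on \<open>e\<close>.
  The radius \<open>d\<close> is common to all candidates.\<close>

definition qlocal :: "nat set \<Rightarrow> query \<Rightarrow> bool" where
  "qlocal X P \<longleftrightarrow> (\<exists>d \<Phi>. finite \<Phi> \<and> (\<forall>F \<in> \<Phi>. local d X F) \<and>
     (\<forall>H M. pair_graph H \<longrightarrow> (\<exists>F \<in> \<Phi>. \<forall>e. e ` X \<subseteq> pverts H \<longrightarrow> P H M e = F H M e)))"

lemma local_cong:
  assumes "local d X F" "\<And>H M e. pair_graph H \<Longrightarrow> e ` X \<subseteq> pverts H \<Longrightarrow> G H M e = F H M e"
  shows "local d X G"
  unfolding local_def
proof (intro conjI allI impI)
  show "dfn X G"
    using local_dfn[OF assms(1)] by (rule dfn_cong) (rule assms(2))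
next
  fix H :: "nat ugraph" and M :: "nat \<Rightarrow> nat set" and e :: "nat \<Rightarrow> nat" and B
  assume *: "pair_graph H" "e ` X \<subseteq> pverts H" "nbh H d (e ` X) \<subseteq> B"
  moreover have "e ` X \<subseteq> pverts (ind H B)"
    using * nbh_self[OF *(2), of d] by auto
  ultimately show "G (ind H B) M e = G H M e"
    using local_ind[OF assms(1) *] assms(2)[OF *(1,2)] assms(2)[OF pair_graph_ind[OF *(1)]] by simp
qed

lemma nbh_empty [simp]: "nbh G r {} = {}"
  by (induction r) auto

lemma local_qlocal:
  assumes "local d X F"
  shows "qlocal X F"
  unfolding qlocal_def using assms by (intro exI[of _ d] exI[of _ "{F}"]) auto

lemma qlocal_choice:
  assumes "finite I" "\<And>i. i \<in> I \<Longrightarrow> qlocal X (T i)"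
    and "\<And>H M. pair_graph H \<Longrightarrow> \<exists>i \<in> I. \<forall>e. e ` X \<subseteq> pverts H \<longrightarrow> P H M e = T i H M e"
  shows "qlocal X P"
proof -
  have "\<forall>i \<in> I. \<exists>d \<Phi>. finite \<Phi> \<and> (\<forall>F \<in> \<Phi>. local d X F) \<and>
     (\<forall>H M. pair_graph H \<longrightarrow> (\<exists>F \<in> \<Phi>. \<forall>e. e ` X \<subseteq> pverts H \<longrightarrow> T i H M e = F H M e))"
    using assms(2) unfolding qlocal_def by blast
  then obtain d \<Phi> where \<Phi>: "\<And>i. i \<in> I \<Longrightarrow> finite (\<Phi> i) \<and> (\<forall>F \<in> \<Phi> i. local (d i) X F) \<and>
     (\<forall>H M. pair_graph H \<longrightarrow> (\<exists>F \<in> \<Phi> i. \<forall>e. e ` X \<subseteq> pverts H \<longrightarrow> T i H M e = F H M e))"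
    by metis
  show ?thesis
    unfolding qlocal_def
  \<comment> \<open>The sum is a convenient upper bound for all the radii
    \<open>d i\<close>.\<close>
  proof (intro exI[of _ "sum d I"] exI[of _ "\<Union>i \<in> I. \<Phi> i"] conjI allI impI ballI)
    show "finite (\<Union>i \<in> I. \<Phi> i)" using assms(1) \<Phi> by blast
  next
    fix F assume "F \<in> (\<Union>i \<in> I. \<Phi> i)"
    then obtain i where "i \<in> I" "F \<in> \<Phi> i" by blast
    moreover from this have "d i \<le> sum d I" using assms(1) by (intro member_le_sum) auto
    ultimately show "local (sum d I) X F" using \<Phi> local_mono by blast
  next
    fix H :: "nat ugraph" and M :: "nat \<Rightarrow> nat set"
    assume H: "pair_graph H"
    from assms(3)[OF H] obtain i where "i \<in> I" "\<forall>e. e ` X \<subseteq> pverts H \<longrightarrow> P H M e = T i H M e"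
      by blast
    moreover from \<Phi>[OF this(1)] H obtain F where
      "F \<in> \<Phi> i" "\<forall>e. e ` X \<subseteq> pverts H \<longrightarrow> T i H M e = F H M e" by blast
    ultimately show "\<exists>F \<in> \<Union>i \<in> I. \<Phi> i. \<forall>e. e ` X \<subseteq> pverts H \<longrightarrow> P H M e = F H M e"
      by (intro bexI[of _ F]) auto
  qed
qed

lemma qlocal_mono:
  assumes "qlocal X P" "X \<subseteq> Y"
  shows "qlocal Y P"
proof -
  obtain d \<Phi> where \<Phi>: "finite \<Phi>" "\<And>F. F \<in> \<Phi> \<Longrightarrow> local d X F"
    "\<And>H M. pair_graph H \<Longrightarrow> \<exists>F \<in> \<Phi>. \<forall>e. e ` X \<subseteq> pverts H \<longrightarrow> P H M e = F H M e"
    using assms(1) unfolding qlocal_def by blast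
  show ?thesis
  proof (rule qlocal_choice[OF \<Phi>(1), where T = "\<lambda>F. F"])
    show "qlocal Y F" if "F \<in> \<Phi>" for F
      using local_qlocal[OF local_mono[OF \<Phi>(2)[OF that] order_refl assms(2)]] .
    show "\<exists>F \<in> \<Phi>. \<forall>e. e ` Y \<subseteq> pverts H \<longrightarrow> P H M e = F H M e" if "pair_graph H" for H M
      using \<Phi>(3)[OF that, of M] assms(2) by (meson image_mono order_trans)
  qed
qed

lemma qlocal_not:
  assumes "qlocal X P"
  shows "qlocal X (\<lambda>H M e. \<not> P H M e)"
proof -
  obtain d \<Phi> where \<Phi>: "finite \<Phi>" "\<And>F. F \<in> \<Phi> \<Longrightarrow> local d X F"
    "\<And>H M. pair_graph H \<Longrightarrow> \<exists>F \<in> \<Phi>. \<forall>e. e ` X \<subseteq> pverts H \<longrightarrow> P H M e = F H M e"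
    using assms unfolding qlocal_def by blast
  show ?thesis
  proof (rule qlocal_choice[OF \<Phi>(1), where T = "\<lambda>F H M e. \<not> F H M e"])
    show "qlocal X (\<lambda>H M e. \<not> F H M e)" if "F \<in> \<Phi>" for F
      using local_qlocal[OF local_not[OF \<Phi>(2)[OF that]]] .
    show "\<exists>F \<in> \<Phi>. \<forall>e. e ` X \<subseteq> pverts H \<longrightarrow> (\<not> P H M e) = (\<not> F H M e)"
      if "pair_graph H" for H M
      using \<Phi>(3)[OF that, of M] by (elim bexE) (rule bexI, auto)
  qed
qed

lemma qlocal_conj:
  assumes "qlocal X P" "qlocal X Q"
  shows "qlocal X (\<lambda>H M e. P H M e \<and> Q H M e)"
proof -
  obtain d \<Phi> where \<Phi>: "finite \<Phi>" "\<And>F. F \<in> \<Phi> \<Longrightarrow> local d X F"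
    "\<And>H M. pair_graph H \<Longrightarrow> \<exists>F \<in> \<Phi>. \<forall>e. e ` X \<subseteq> pverts H \<longrightarrow> P H M e = F H M e"
    using assms(1) unfolding qlocal_def by blast
  obtain d' \<Psi> where \<Psi>: "finite \<Psi>" "\<And>F. F \<in> \<Psi> \<Longrightarrow> local d' X F"
    "\<And>H M. pair_graph H \<Longrightarrow> \<exists>F \<in> \<Psi>. \<forall>e. e ` X \<subseteq> pverts H \<longrightarrow> Q H M e = F H M e"
    using assms(2) unfolding qlocal_def by blast
  have "finite (\<Phi> \<times> \<Psi>)" using \<Phi>(1) \<Psi>(1) by simp
  then show ?thesis
  proof (rule qlocal_choice[where T = "\<lambda>p H M e. fst p H M e \<and> snd p H M e"])
    show "qlocal X (\<lambda>H M e. fst p H M e \<and> snd p H M e)" if "p \<in> \<Phi> \<times> \<Psi>" for p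
      using that
      by (intro local_qlocal[of "max d d'"] local_conj local_mono[OF \<Phi>(2)] local_mono[OF \<Psi>(2)]) auto
    show "\<exists>p \<in> \<Phi> \<times> \<Psi>. \<forall>e. e ` X \<subseteq> pverts H \<longrightarrow> (P H M e \<and> Q H M e) = (fst p H M e \<and> snd p H M e)"
      if H: "pair_graph H" for H M
    proof -
      obtain F where "F \<in> \<Phi>" "\<forall>e. e ` X \<subseteq> pverts H \<longrightarrow> P H M e = F H M e"
        using \<Phi>(3)[OF H, of M] by blast
      moreover obtain G where "G \<in> \<Psi>" "\<forall>e. e ` X \<subseteq> pverts H \<longrightarrow> Q H M e = G H M e"
        using \<Psi>(3)[OF H, of M] by blast
      ultimately show ?thesis by (intro bexI[of _ "(F, G)"]) auto
    qed
  qed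
qed

lemma qlocal_disj:
  assumes "qlocal X P" "qlocal X Q"
  shows "qlocal X (\<lambda>H M e. P H M e \<or> Q H M e)"
  using qlocal_not[OF qlocal_conj[OF qlocal_not[OF assms(1)] qlocal_not[OF assms(2)]]] by simp

lemma qlocal_bex_list:
  assumes "\<And>p. p \<in> set L \<Longrightarrow> qlocal X (T p)"
  shows "qlocal X (\<lambda>H M e. \<exists>p \<in> set L. T p H M e)"
  using assms
proof (induction L)
  case Nil
  then show ?case using local_qlocal[OF local_const[of 0 X False]] by simp
next
  case (Cons p L)
  then show ?case using qlocal_disj[of X "T p"] by simp
qed

text \<open>Distance greater than \<open>2 * D\<close> means that no ball of radius \<open>D\<close>
  contains two elements of \<open>Z\<close>.\<close>

definition scattered :: "nat ugraph \<Rightarrow> nat \<Rightarrow> nat \<Rightarrow> nat set \<Rightarrow> bool" where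
  "scattered H D m Z \<longleftrightarrow> finite Z \<and> card Z = m \<and> Z \<subseteq> pverts H \<and> pairwise (\<lambda>a b. b \<notin> nbh H (2 * D) {a}) Z"

lemma scattered_insert:
  assumes "pair_graph H" "v \<in> pverts H"
  shows "v \<notin> Z \<and> scattered H D (Suc m) (insert v Z) \<longleftrightarrow>
    scattered H D m Z \<and> (\<forall>z \<in> Z. z \<notin> nbh H (2 * D) {v})"
proof
  assume "v \<notin> Z \<and> scattered H D (Suc m) (insert v Z)"
  then show "scattered H D m Z \<and> (\<forall>z \<in> Z. z \<notin> nbh H (2 * D) {v})"
    by (auto simp: scattered_def pairwise_insert)
next
  assume "scattered H D m Z \<and> (\<forall>z \<in> Z. z \<notin> nbh H (2 * D) {v})"
  moreover from this have "v \<notin> Z"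
    using nbh_self[of "{v}" H "2 * D"] assms(2) by auto
  ultimately show "v \<notin> Z \<and> scattered H D (Suc m) (insert v Z)"
    using assms nbh_sym[OF assms(1)] by (auto simp: scattered_def pairwise_insert)
qed

lemma scattered_subset:
  assumes "scattered H D m Z" "n \<le> m"
  obtains Z' where "Z' \<subseteq> Z" "scattered H D n Z'"
proof -
  obtain Z' where "Z' \<subseteq> Z" "card Z' = n" "finite Z'"
    using obtain_subset_with_card_n[of n Z] assms by (auto simp: scattered_def)
  then show ?thesis
    using assms(1) that pairwise_subset by (force simp: scattered_def)
qed

text \<open>The elements of \<open>Z\<close> are quantified one at a time, each within distance
  \<open>D\<close> of \<open>X\<close>. The set \<open>Y\<close> collects the vertices that later
  elements must avoid, so a chosen element joins it through a fresh variable. The radius grows with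
  \<open>m\<close> but not with the graph. Writing the unary query as
  \<open>F H M (\<lambda>_. z)\<close> makes the name of its variable immaterial.\<close>

lemma local_scattered:
  assumes F: "local d {y} F" and X: "finite X" and Y: "finite Y"
  shows "\<exists>d'. local d' (X \<union> Y) (\<lambda>H M e. \<exists>Z \<subseteq> nbh H D (e ` X). scattered H D m Z \<and>
    (\<forall>z \<in> Z. F H M (\<lambda>_. z)) \<and> Z \<inter> nbh H (2 * D) (e ` Y) = {})"
  using Y
proof (induction m arbitrary: Y)
  case 0
  have "scattered H D 0 {}" for H by (simp add: scattered_def)
  then have "(\<exists>Z \<subseteq> nbh H D (e ` X). scattered H D 0 Z \<and>
    (\<forall>z \<in> Z. F H M (\<lambda>_. z)) \<and> Z \<inter> nbh H (2 * D) (e ` Y) = {})" for H M and e :: "nat \<Rightarrow> nat"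
    by (intro exI[of _ "{}"]) simp
  then show ?case using local_const[of 0 "X \<union> Y" True] by auto
next
  case (Suc m)
  obtain w where w: "w \<notin> X \<union> Y"
    using ex_new_if_finite[OF infinite_UNIV_nat, of "X \<union> Y"] X Suc.prems by auto
  let ?Q = "\<lambda>m Y H M e. \<exists>Z \<subseteq> nbh H D (e ` X). scattered H D m Z \<and>
    (\<forall>z \<in> Z. F H M (\<lambda>_. z)) \<and> Z \<inter> nbh H (2 * D) (e ` Y) = {}"
  obtain d' where d': "local d' (X \<union> insert w Y) (?Q m (insert w Y))"
    using Suc.IH[of "insert w Y"] Suc.prems by auto
  have F': "local d {w} (\<lambda>H M e. F H M (\<lambda>_. e w))"
    using local_subst[OF F, of "\<lambda>_. w"] by (simp add: comp_def)
  let ?d = "D + d + 2 * D + d'"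
  have "local ?d (insert w (X \<union> Y)) (\<lambda>H M e. e w \<in> nbh H D (e ` X) \<and> F H M (\<lambda>_. e w) \<and>
      e w \<notin> nbh H (2 * D) (e ` Y) \<and> ?Q m (insert w Y) H M e)"
    using X Suc.prems
    by (intro local_conj local_not local_mono[OF local_nbh] local_mono[OF F'] local_mono[OF d']) auto
  then have "local (?d + D) (X \<union> Y) (\<lambda>H M e. \<exists>v \<in> nbh H D (e ` (X \<union> Y)).
      (e(w := v)) w \<in> nbh H D (e(w := v) ` X) \<and> F H M (\<lambda>_. (e(w := v)) w) \<and>
      (e(w := v)) w \<notin> nbh H (2 * D) (e(w := v) ` Y) \<and> ?Q m (insert w Y) H M (e(w := v)))"
    by (rule local_nbh_Ex) (use w X Suc.prems in auto)
  then have "local (?d + D) (X \<union> Y) (?Q (Suc m) Y)"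
  proof (rule local_cong)
    fix H :: "nat ugraph" and M :: "nat \<Rightarrow> nat set" and e :: "nat \<Rightarrow> nat"
    assume H: "pair_graph H" and e: "e ` (X \<union> Y) \<subseteq> pverts H"
    have upd: "e(w := v) ` X = e ` X" "e(w := v) ` Y = e ` Y"
      "e(w := v) ` insert w Y = insert v (e ` Y)" for v
      using w by auto
    have ins: "nbh H r (insert v (e ` Y)) = nbh H r {v} \<union> nbh H r (e ` Y)" for v r
      using nbh_Un[of H r "{v}" "e ` Y"] by simp
    show "?Q (Suc m) Y H M e = (\<exists>v \<in> nbh H D (e ` (X \<union> Y)).
      (e(w := v)) w \<in> nbh H D (e(w := v) ` X) \<and> F H M (\<lambda>_. (e(w := v)) w) \<and>
      (e(w := v)) w \<notin> nbh H (2 * D) (e(w := v) ` Y) \<and> ?Q m (insert w Y) H M (e(w := v)))"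
      unfolding upd ins fun_upd_same
    proof (rule iffI, goal_cases)
      case 1
      then obtain Z where Z: "Z \<subseteq> nbh H D (e ` X)" "scattered H D (Suc m) Z"
        "\<forall>z \<in> Z. F H M (\<lambda>_. z)" "Z \<inter> nbh H (2 * D) (e ` Y) = {}" by blast
      then obtain v Z' where v: "Z = insert v Z'" "v \<notin> Z'"
        by (metis Suc_neq_Zero card.empty mk_disjoint_insert all_not_in_conv scattered_def)
      have "v \<in> pverts H" using v Z by (auto simp: scattered_def)
      then have "scattered H D m Z'" "\<forall>z \<in> Z'. z \<notin> nbh H (2 * D) {v}"
        using scattered_insert[OF H, of v Z' D m] v Z(2) by auto
      moreover have "v \<in> nbh H D (e ` (X \<union> Y))"
        using Z(1) v nbh_mono[of "e ` X" "e ` (X \<union> Y)" H D] by auto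
      ultimately show ?case
        using Z v by (intro bexI[of _ v] conjI exI[of _ Z']) auto
    next
      case 2
      then obtain v Z where v: "v \<in> nbh H D (e ` X)" "F H M (\<lambda>_. v)" "v \<notin> nbh H (2 * D) (e ` Y)"
        and Z: "Z \<subseteq> nbh H D (e ` X)" "scattered H D m Z" "\<forall>z \<in> Z. F H M (\<lambda>_. z)"
          "Z \<inter> nbh H (2 * D) {v} = {}" "Z \<inter> nbh H (2 * D) (e ` Y) = {}"
        by blast
      have "v \<in> pverts H" using v(1) nbh_subset by fast
      then have "scattered H D (Suc m) (insert v Z)"
        using scattered_insert[OF H, of v Z D m] Z by blast
      then show ?case using Z v by (intro exI[of _ "insert v Z"]) auto
    qed
  qed
  then show ?case by blast
qed

text \<open>A maximum scattered set of witnesses decides which case applies. If it has more than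
  \<open>card X\<close> elements, some element is far from \<open>X\<close>; otherwise, a witness very far from \<open>X\<close>
  exists only if no scattered set of maximum size lies close to \<open>X\<close>.\<close>

lemma qlocal_far:
  assumes F: "local d {y} F" and X: "finite X"
  shows "qlocal X (\<lambda>H M e. \<exists>v \<in> pverts H - nbh H D (e ` X). F H M (\<lambda>_. v))"
proof -
  define k where "k = card X"
  define near where "near m = (\<lambda>H M e. \<exists>Z \<subseteq> nbh H D (e ` X). scattered H D m Z \<and> (\<forall>z \<in> Z. F H M (\<lambda>_. z)))"
    for m :: nat and H :: "nat ugraph" and M :: "nat \<Rightarrow> nat set" and e :: "nat \<Rightarrow> nat"
  \<comment> \<open>A witness farther than \<open>3 * D\<close> from \<open>X\<close> has distance
    greater than \<open>2 * D\<close> from everything in the \<open>D\<close>-ball of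
    \<open>X\<close>; witnesses that are not so far are found locally.\<close>
  define mid where "mid = (\<lambda>H M e. \<exists>v \<in> nbh H (3 * D) (e ` X). v \<notin> nbh H D (e ` X) \<and> F H M (\<lambda>_. v))"
    for H :: "nat ugraph" and M :: "nat \<Rightarrow> nat set" and e :: "nat \<Rightarrow> nat"
  have near: "qlocal X (near m)" for m
    using local_scattered[OF F X finite.emptyI, of D m] unfolding near_def
    by (auto intro: local_qlocal)
  have mid: "qlocal X mid"
  proof -
    obtain w where w: "w \<notin> X"
      using ex_new_if_finite[OF infinite_UNIV_nat X] by auto
    have F': "local d {w} (\<lambda>H M e. F H M (\<lambda>_. e w))"
      using local_subst[OF F, of "\<lambda>_. w"] by (simp add: comp_def)
    have "local (d + D) (insert w X) (\<lambda>H M e. e w \<notin> nbh H D (e ` X) \<and> F H M (\<lambda>_. e w))"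
      using X by (intro local_conj local_not local_mono[OF local_nbh] local_mono[OF F']) auto
    from local_nbh_Ex[OF this w X, of "3 * D"] have "local (d + D + 3 * D) X mid"
    proof (rule local_cong)
      fix H :: "nat ugraph" and M :: "nat \<Rightarrow> nat set" and e :: "nat \<Rightarrow> nat"
      have "e(w := v) ` X = e ` X" for v
        using w by auto
      then show "mid H M e = (\<exists>v \<in> nbh H (3 * D) (e ` X).
          (e(w := v)) w \<notin> nbh H D (e(w := v) ` X) \<and> F H M (\<lambda>_. (e(w := v)) w))"
        by (simp add: mid_def)
    qed
    then show ?thesis by (rule local_qlocal)
  qed
  \<comment> \<open>An index \<open>m \<le> k\<close> stands for graphs in which \<open>m\<close> is
    the maximum size of a scattered set of witnesses; \<open>Suc k\<close> stands for those with a
    scattered set of more than \<open>k\<close> witnesses, where a far witness exists for every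
    \<open>e\<close>.\<close>
  define T where "T m = (if m \<le> k then (\<lambda>H M e. \<not> near m H M e \<or> mid H M e) else (\<lambda>H M e. True))" for m
  show ?thesis
  proof (rule qlocal_choice[where T = T])
    show "finite {..Suc k}" by simp
    show "qlocal X (T m)" for m
      unfolding T_def using qlocal_disj[OF qlocal_not[OF near] mid] local_qlocal[OF local_const[of 0 X True]]
      by simp
  next
    fix H :: "nat ugraph" and M :: "nat \<Rightarrow> nat set"
    assume H: "pair_graph H"
    let ?S = "\<lambda>m Z. scattered H D m Z \<and> (\<forall>z \<in> Z. F H M (\<lambda>_. z))"
    show "\<exists>m \<in> {..Suc k}. \<forall>e. e ` X \<subseteq> pverts H \<longrightarrow>
        (\<exists>v \<in> pverts H - nbh H D (e ` X). F H M (\<lambda>_. v)) = T m H M e"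
    proof (cases "\<exists>Z. ?S (Suc k) Z")
      case True
      then obtain Z where Z: "scattered H D (Suc k) Z" "\<forall>z \<in> Z. F H M (\<lambda>_. z)" by blast
      have "\<exists>v \<in> pverts H - nbh H D (e ` X). F H M (\<lambda>_. v)" for e :: "nat \<Rightarrow> nat"
      proof (rule ccontr)
        assume "\<not> ?thesis"
        then have "Z \<subseteq> nbh H D (e ` X)"
          using Z by (auto simp: scattered_def)
        then have "\<forall>z \<in> Z. \<exists>x \<in> e ` X. z \<in> nbh H D {x}"
          using nbh_iff[of _ H D "e ` X"] by blast
        then obtain f where f: "\<And>z. z \<in> Z \<Longrightarrow> f z \<in> e ` X \<and> z \<in> nbh H D {f z}" by metis
        \<comment> \<open>Two elements of \<open>Z\<close> near the same parameter would be within
          \<open>2 * D\<close> of each other. Hence there would be at least \<open>Suc k\<close>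
          parameter values, more than \<open>card X\<close>.\<close>
        have "inj_on f Z"
        proof (rule inj_onI, rule ccontr)
          fix a b assume ab: "a \<in> Z" "b \<in> Z" "f a = f b" "a \<noteq> b"
          then have "f a \<in> nbh H D {a}" "b \<in> nbh H D {f a}"
            using f nbh_sym[OF H] by metis+
          then have "b \<in> nbh H (2 * D) {a}"
            using nbh_trans by (metis mult_2)
          then show False using Z(1) ab by (auto simp: scattered_def pairwise_def)
        qed
        then have "card Z \<le> card (e ` X)"
          using f X by (intro card_inj_on_le) auto
        also have "\<dots> \<le> k" unfolding k_def using X by (rule card_image_le)
        finally show False using Z(1) by (simp add: scattered_def)
      qed
      then show ?thesis by (intro bexI[of _ "Suc k"]) (auto simp: T_def)
    next
      case False
      have bound: "m \<le> k" if S: "?S m Z" for m Z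
      proof (rule ccontr)
        assume "\<not> m \<le> k"
        then obtain Z' where "Z' \<subseteq> Z" "scattered H D (Suc k) Z'"
          using S scattered_subset[of H D m Z "Suc k"] by (metis not_less_eq_eq)
        then show False using False S by blast
      qed
      \<comment> \<open>Counting the empty set makes the maximum exist even if no vertex satisfies
        \<open>F\<close>.\<close>
      have S0: "?S 0 {}" by (simp add: scattered_def)
      define N where "N = Max {m. \<exists>Z. ?S m Z}"
      have fin: "finite {m. \<exists>Z. ?S m Z}"
        by (rule finite_subset[of _ "{..k}"]) (use bound in blast, simp)
      have N: "\<exists>Z. ?S N Z" "\<And>m. \<exists>Z. ?S m Z \<Longrightarrow> m \<le> N"
        using Max_in[OF fin] Max_ge[OF fin] S0 unfolding N_def by blast+
      have "N \<le> k" using N(1) bound by blast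
      show ?thesis
      proof (intro bexI[of _ N] allI impI)
        fix e :: "nat \<Rightarrow> nat" assume e: "e ` X \<subseteq> pverts H"
        have "(\<exists>v \<in> pverts H - nbh H D (e ` X). F H M (\<lambda>_. v)) \<longleftrightarrow> \<not> near N H M e \<or> mid H M e"
        proof
          assume "\<exists>v \<in> pverts H - nbh H D (e ` X). F H M (\<lambda>_. v)"
          then obtain v where v: "v \<in> pverts H" "v \<notin> nbh H D (e ` X)" "F H M (\<lambda>_. v)" by blast
          show "\<not> near N H M e \<or> mid H M e"
          proof (cases "v \<in> nbh H (3 * D) (e ` X)")
            case True
            then show ?thesis using v by (auto simp: mid_def)
          next
            case False
            \<comment> \<open>Otherwise \<open>v\<close> could be added to a scattered set of size
              \<open>N\<close> near \<open>X\<close>, against the maximality of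
              \<open>N\<close>.\<close>
            have "\<not> near N H M e"
            proof
              assume "near N H M e"
              then obtain Z where Z: "Z \<subseteq> nbh H D (e ` X)" "?S N Z" by (auto simp: near_def)
              have "z \<notin> nbh H (2 * D) {v}" if "z \<in> Z" for z
              proof
                assume "z \<in> nbh H (2 * D) {v}"
                then have "v \<in> nbh H (2 * D) {z}" using nbh_sym[OF H] by blast
                then have "v \<in> nbh H (2 * D + D) (e ` X)"
                  using nbh_trans[of v H "2 * D" z D "e ` X"] Z that by blast
                moreover have "2 * D + D = 3 * D" by simp
                ultimately show False using False by metis
              qed
              then have "?S (Suc N) (insert v Z)"
                using scattered_insert[OF H v(1), of Z D N] Z v by auto
              then show False using N(2) by fastforce
            qed
            then show ?thesis by blast
          qed
        next
          assume "\<not> near N H M e \<or> mid H M e"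
          then show "\<exists>v \<in> pverts H - nbh H D (e ` X). F H M (\<lambda>_. v)"
          proof
            assume "\<not> near N H M e"
            moreover obtain Z where Z: "?S N Z" using N(1) by blast
            \<comment> \<open>A maximum scattered set that does not fit into the
              \<open>D\<close>-ball of \<open>X\<close> has an element outside it, and that element
              is the far witness.\<close>
            ultimately have "\<not> Z \<subseteq> nbh H D (e ` X)" by (auto simp: near_def)
            then show ?thesis using Z by (auto simp: scattered_def)
          next
            assume "mid H M e"
            then show ?thesis using nbh_subset[of H "3 * D" "e ` X"] by (auto simp: mid_def)
          qed
        qed
        then show "(\<exists>v \<in> pverts H - nbh H D (e ` X). F H M (\<lambda>_. v)) = T N H M e"
          using \<open>N \<le> k\<close> by (simp add: T_def)
      qed (use \<open>N \<le> k\<close> in simp)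
    qed
  qed
qed

text \<open>A witness near \<open>X\<close> is found by a local query. For a far witness
  \<open>v\<close>, \<open>local_split\<close> separates the condition into one on the parameters
  and one on \<open>v\<close> alone, and the existence of such a far \<open>v\<close> is
  \<open>qlocal_far\<close>.\<close>

lemma qlocal_Ex:
  assumes F: "local d (insert w X) F" and w: "w \<notin> X" and X: "finite X"
  shows "qlocal X (\<lambda>H M e. \<exists>v \<in> pverts H. F H M (e(w := v)))"
proof -
  define D where "D = 2 * d + 1"
  from F have "local d (X \<union> {w}) F" by simp
  then obtain L where L: "\<And>G G'. (G, G') \<in> set L \<Longrightarrow> local d X G \<and> local d {w} G'"
    and L2: "\<And>H M e. pair_graph H \<Longrightarrow> e ` (X \<union> {w}) \<subseteq> pverts H \<Longrightarrow>
      nbh H D (e ` X) \<inter> e ` {w} = {} \<Longrightarrow>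
      F H M e \<longleftrightarrow> (\<exists>(G, G') \<in> set L. G H M e \<and> G' H M e)"
    unfolding D_def by (rule local_split) (use w X in auto)
  let ?far = "\<lambda>p H M e. fst p H M e \<and> (\<exists>v \<in> pverts H - nbh H D (e ` X). snd p H M (\<lambda>_. v))"
  have "qlocal X (\<lambda>H M e. \<exists>p \<in> set L. ?far p H M e)"
  proof (rule qlocal_bex_list)
    fix p assume "p \<in> set L"
    then have "local d X (fst p)" "local d {w} (snd p)"
      using L[of "fst p" "snd p"] by auto
    then show "qlocal X (?far p)"
      using X by (intro qlocal_conj qlocal_far) (auto intro: local_qlocal)
  qed
  with local_qlocal[OF local_nbh_Ex[OF F w X, of D]]
  have *: "qlocal X (\<lambda>H M e. (\<exists>v \<in> nbh H D (e ` X). F H M (e(w := v))) \<or> (\<exists>p \<in> set L. ?far p H M e))"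
    by (rule qlocal_disj)
  have eq: "(\<exists>v \<in> pverts H. F H M (e(w := v))) \<longleftrightarrow>
      (\<exists>v \<in> nbh H D (e ` X). F H M (e(w := v))) \<or> (\<exists>p \<in> set L. ?far p H M e)"
    if H: "pair_graph H" and e: "e ` X \<subseteq> pverts H" for H M e
  proof -
    have "F H M (e(w := v)) \<longleftrightarrow> (\<exists>p \<in> set L. fst p H M e \<and> snd p H M (\<lambda>_. v))"
      if v: "v \<in> pverts H - nbh H D (e ` X)" for v
    proof -
      have im: "e(w := v) ` X = e ` X" using w by auto
      have "F H M (e(w := v)) \<longleftrightarrow> (\<exists>(G, G') \<in> set L. G H M (e(w := v)) \<and> G' H M (e(w := v)))"
        using v e im by (intro L2 H) auto
      also have "\<dots> \<longleftrightarrow> (\<exists>p \<in> set L. fst p H M e \<and> snd p H M (\<lambda>_. v))"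
      proof (rule bex_cong[OF refl])
        fix p assume "p \<in> set L"
        then have p: "local d X (fst p)" "local d {w} (snd p)"
          using L[of "fst p" "snd p"] by auto
        have "fst p H M (e(w := v)) = fst p H M e"
          using w e im by (intro dfn_env[OF local_dfn[OF p(1)] H]) auto
        moreover have "snd p H M (e(w := v)) = snd p H M (\<lambda>_. v)"
          using v by (intro dfn_env[OF local_dfn[OF p(2)] H]) auto
        ultimately show "(case p of (G, G') \<Rightarrow> G H M (e(w := v)) \<and> G' H M (e(w := v))) =
            (fst p H M e \<and> snd p H M (\<lambda>_. v))"
          by (simp add: case_prod_beta)
      qed
      finally show ?thesis .
    qed
    then have "(\<exists>v \<in> pverts H - nbh H D (e ` X). F H M (e(w := v))) \<longleftrightarrow>
        (\<exists>v \<in> pverts H - nbh H D (e ` X). \<exists>p \<in> set L. fst p H M e \<and> snd p H M (\<lambda>_. v))"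
      by (rule bex_cong[OF refl])
    moreover have "(\<exists>v \<in> pverts H. F H M (e(w := v))) \<longleftrightarrow> (\<exists>v \<in> nbh H D (e ` X). F H M (e(w := v))) \<or>
        (\<exists>v \<in> pverts H - nbh H D (e ` X). F H M (e(w := v)))"
      using nbh_subset[of H D "e ` X"] by blast
    moreover have "(\<exists>v \<in> A. \<exists>p \<in> set L. fst p H M e \<and> snd p H M (\<lambda>_. v)) \<longleftrightarrow>
        (\<exists>p \<in> set L. fst p H M e \<and> (\<exists>v \<in> A. snd p H M (\<lambda>_. v)))" for A
      by blast
    ultimately show ?thesis by simp
  qed
  show ?thesis
  proof (rule qlocal_choice[of "{()}", OF _ *])
    fix H :: "nat ugraph" and M :: "nat \<Rightarrow> nat set"
    assume "pair_graph H"
    then show "\<exists>u \<in> {()}. \<forall>e. e ` X \<subseteq> pverts H \<longrightarrow> (\<exists>v \<in> pverts H. F H M (e(w := v))) =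
        ((\<exists>v \<in> nbh H D (e ` X). F H M (e(w := v))) \<or> (\<exists>p \<in> set L. ?far p H M e))"
      using eq[of H _ M] by blast
  qed simp
qed

text \<open>This is Gaifman locality, by induction on the formula; all the work is in the quantifier
  case.\<close>

theorem qlocal_sat:
  assumes "free_vars \<phi> \<subseteq> X" "finite X"
  shows "qlocal X (\<lambda>H M e. sat H M e \<phi>)"
  using assms
proof (induction \<phi> arbitrary: X)
  case (Eq x y)
  have "local 0 X (\<lambda>H M e. sat H M e (Eq x y))"
    unfolding local_def using Eq by (intro conjI dfn_sat) auto
  then show ?case by (rule local_qlocal)
next
  case (Edge x y)
  have "(e x, e y) \<in> B \<times> B" if "e ` X \<subseteq> pverts H" "nbh H 0 (e ` X) \<subseteq> B"
    for H :: "nat ugraph" and e :: "nat \<Rightarrow> nat" and B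
    using that Edge.prems by auto
  then have "local 0 X (\<lambda>H M e. sat H M e (Edge x y))"
    unfolding local_def using Edge.prems by (intro conjI dfn_sat) auto
  then show ?case by (rule local_qlocal)
next
  case (Mark s x)
  have "local 0 X (\<lambda>H M e. sat H M e (Mark s x))"
    unfolding local_def using Mark by (intro conjI dfn_sat) auto
  then show ?case by (rule local_qlocal)
next
  case (Neg \<phi>)
  then show ?case using qlocal_not by simp
next
  case (Conj \<phi> \<psi>)
  then show ?case using qlocal_conj by simp
next
  case (Ex w \<phi>)
  \<comment> \<open>The bound variable may belong to \<open>X\<close>, whereas
    \<open>qlocal_Ex\<close> needs it to be fresh; \<open>qlocal_mono\<close> restores
    \<open>X\<close> at the end.\<close>
  let ?X = "X - {w}"
  have "qlocal (insert w ?X) (\<lambda>H M e. sat H M e \<phi>)"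
    using Ex.prems by (intro Ex.IH) auto
  then obtain d \<Phi> where \<Phi>: "finite \<Phi>" "\<And>F. F \<in> \<Phi> \<Longrightarrow> local d (insert w ?X) F"
    "\<And>H M. pair_graph H \<Longrightarrow> \<exists>F \<in> \<Phi>. \<forall>e. e ` insert w ?X \<subseteq> pverts H \<longrightarrow> sat H M e \<phi> = F H M e"
    unfolding qlocal_def by blast
  have "qlocal ?X (\<lambda>H M e. sat H M e (Ex w \<phi>))"
  proof (rule qlocal_choice[OF \<Phi>(1)])
    fix F assume "F \<in> \<Phi>"
    then show "qlocal ?X (\<lambda>H M e. \<exists>v \<in> pverts H. F H M (e(w := v)))"
      using Ex.prems by (intro qlocal_Ex[OF \<Phi>(2)]) auto
  next
    fix H :: "nat ugraph" and M :: "nat \<Rightarrow> nat set"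
    assume "pair_graph H"
    \<comment> \<open>One \<open>F\<close> is correct for all environments simultaneously, hence for
      every value of the quantified variable.\<close>
    then obtain F where F: "F \<in> \<Phi>" "\<And>e. e ` insert w ?X \<subseteq> pverts H \<Longrightarrow> sat H M e \<phi> = F H M e"
      using \<Phi>(3) by blast
    have "sat H M (e(w := v)) \<phi> = F H M (e(w := v))" if "e ` ?X \<subseteq> pverts H" "v \<in> pverts H" for e v
      using that by (intro F(2)) auto
    then show "\<exists>F \<in> \<Phi>. \<forall>e. e ` ?X \<subseteq> pverts H \<longrightarrow>
        sat H M e (Ex w \<phi>) = (\<exists>v \<in> pverts H. F H M (e(w := v)))"
      using F(1) by (intro bexI[of _ F]) auto
  qed
  then show ?case by (rule qlocal_mono) auto
qed


section \<open>Perturbations and transductions\<close>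

definition env2 :: "nat \<Rightarrow> nat \<Rightarrow> nat \<Rightarrow> nat" where
  "env2 u v = (\<lambda>_. undefined)(0 := u, 1 := v)"

lemma env2_simps [simp]: "env2 u v 0 = u" "env2 u v (Suc 0) = v" "env2 u v ` {0, 1} = {u, v}"
  by (simp_all add: env2_def)

lemma env2_one: "env2 u v 1 = v"
  by simp

lemma sat2_env2: "sat2 G M \<eta> u v = sat G M (env2 u v) \<eta>"
  by (simp add: sat2_def env2_def)

definition graph_on :: "nat set \<Rightarrow> (nat \<Rightarrow> nat \<Rightarrow> bool) \<Rightarrow> nat ugraph" where
  "graph_on W R = \<lparr> pverts = W, parcs = {(u, v). u \<in> W \<and> v \<in> W \<and> R u v} \<rparr>"

lemma graph_on_simps [simp]:
  "pverts (graph_on W R) = W"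
  "(u, v) \<in> parcs (graph_on W R) \<longleftrightarrow> u \<in> W \<and> v \<in> W \<and> R u v"
  by (simp_all add: graph_on_def)

lemma graph_on_cong: "(\<And>u v. u \<in> W \<Longrightarrow> v \<in> W \<Longrightarrow> R u v = R' u v) \<Longrightarrow> graph_on W R = graph_on W R'"
  by (auto simp: graph_on_def)

lemma ind_eq_graph_on: "W \<subseteq> pverts H \<Longrightarrow> ind H W = graph_on W (\<lambda>u v. (u, v) \<in> parcs H)"
  by (auto simp: ind_def graph_on_def)

lemma dfn_mark_cong:
  assumes "dfn X F" "pair_graph H" "e ` X \<subseteq> pverts H" "\<And>s. M s \<inter> pverts H = M' s \<inter> pverts H"
  shows "F H M e = F H M' e"
proof -
  obtain \<alpha> where \<alpha>: "free_vars \<alpha> \<subseteq> X"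
    "\<And>H M e. pair_graph H \<Longrightarrow> e ` X \<subseteq> pverts H \<Longrightarrow> F H M e = sat H M e \<alpha>"
    using assms(1) unfolding dfn_def by blast
  have "sat H M e \<alpha> = sat H M' e \<alpha>"
    using \<alpha>(1) assms(3,4) by (intro sat_mark_cong) auto
  then show ?thesis using \<alpha>(2)[OF assms(2,3)] by simp
qed

lemma dfn_xor:
  assumes "dfn X F" "dfn X G"
  shows "dfn X (\<lambda>H M e. F H M e \<noteq> G H M e)"
proof -
  have "dfn X (\<lambda>H M e. F H M e \<and> \<not> G H M e \<or> \<not> F H M e \<and> G H M e)"
    using assms by (intro dfn_disj dfn_conj dfn_not)
  then show ?thesis by (rule dfn_cong) blast
qed

text \<open>Symmetrising the formula makes it a simple interpretation on all graphs; it is unchanged on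
  the intended ones.\<close>

lemma step_exists:
  assumes "dfn {0, 1} F"
  obtains t where "valid_step t"
    and "\<And>H M W. pair_graph H \<Longrightarrow> W \<subseteq> pverts H \<Longrightarrow>
      (\<And>u v. u \<in> W \<Longrightarrow> v \<in> W \<Longrightarrow> F H M (env2 u v) \<Longrightarrow> u \<noteq> v \<and> F H M (env2 v u)) \<Longrightarrow>
      graph_on W (\<lambda>u v. F H M (env2 u v)) \<in> step_outputs t H"
proof -
  define \<pi> :: "nat \<Rightarrow> nat" where "\<pi> x = (if x = 0 then 1 else if x = 1 then 0 else x)" for x
  have \<pi>: "env2 u v \<circ> \<pi> = env2 v u" for u v
    by (auto simp: \<pi>_def env2_def fun_eq_iff)
  have \<pi>_im: "\<pi> ` {0, 1} = {0, 1}" by (auto simp: \<pi>_def)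
  \<comment> \<open>Shifting the symbols by one frees symbol 0, which will mark the vertex set
    \<open>W\<close> of the output.\<close>
  define F' where "F' = (\<lambda>H M. F H (\<lambda>s. M (Suc s)))"
  have F': "dfn {0, 1} F'"
    unfolding F'_def by (rule dfn_map_symbols[OF assms])
  have "dfn {0, 1} (\<lambda>H M e. F' H M (e \<circ> \<pi>))"
    using dfn_subst[OF F', of \<pi>] unfolding \<pi>_im .
  then have "dfn {0, 1} (\<lambda>H M e. e 0 \<noteq> e 1 \<and> (F' H M e \<or> F' H M (e \<circ> \<pi>)))"
    using dfn_eq[of 0 1 "{}"] by (intro dfn_conj dfn_not dfn_disj F')
  then obtain \<eta> where \<eta>: "free_vars \<eta> \<subseteq> {0, 1}" and
    "\<And>H M e. pair_graph H \<Longrightarrow> e ` {0, 1} \<subseteq> pverts H \<Longrightarrow>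
      (e 0 \<noteq> e 1 \<and> (F' H M e \<or> F' H M (e \<circ> \<pi>))) = sat H M e \<eta>"
    unfolding dfn_def by blast
  then have \<eta>2: "sat2 H M \<eta> u v \<longleftrightarrow> u \<noteq> v \<and> (F' H M (env2 u v) \<or> F' H M (env2 v u))"
    if "pair_graph H" "u \<in> pverts H" "v \<in> pverts H" for H M u v
    using that \<pi> by (metis One_nat_def empty_subsetI env2_simps insert_subset sat2_env2)
  let ?\<Sigma> = "insert 0 (symbols \<eta>)" and ?\<nu> = "Mark 0 0"
  have simple: "simple_interpretation ?\<Sigma> ?\<nu> \<eta>"
    unfolding simple_interpretation_def using \<eta> \<eta>2 by auto
  show ?thesis
  proof (rule that[of "NonCopying ?\<Sigma> ?\<nu> \<eta>"])
    show "valid_step (NonCopying ?\<Sigma> ?\<nu> \<eta>)"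
      using simple finite_symbols by simp
  next
    fix H :: "nat ugraph" and M :: "nat \<Rightarrow> nat set" and W
    assume H: "pair_graph H" and W: "W \<subseteq> pverts H"
      and sym: "\<And>u v. u \<in> W \<Longrightarrow> v \<in> W \<Longrightarrow> F H M (env2 u v) \<Longrightarrow> u \<noteq> v \<and> F H M (env2 v u)"
    \<comment> \<open>An expansion admits only sets of vertices, so the marks are truncated; by
      \<open>dfn_mark_cong\<close> this does not change \<open>F\<close>.\<close>
    define N where "N = case_nat W (\<lambda>s. M s \<inter> pverts H)"
    have exp: "expansion ?\<Sigma> H N"
      using W by (auto simp: expansion_def N_def split: nat.split)
    have "F' H N (env2 u v) = F H M (env2 u v)" if "u \<in> W" "v \<in> W" for u v
      unfolding F'_def N_def using that W by (intro dfn_mark_cong[OF assms H]) auto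
    then have "sat2 H N \<eta> u v = F H M (env2 u v)" if "u \<in> W" "v \<in> W" for u v
      using \<eta>2[OF H, of u v N] sym that W by blast
    moreover have "{v \<in> pverts H. sat1 H N ?\<nu> v} = W"
      using W by (auto simp: sat1_def N_def)
    ultimately have "interpret_graph ?\<nu> \<eta> H N = graph_on W (\<lambda>u v. F H M (env2 u v))"
      by (auto simp: interpret_graph_def graph_on_def Let_def)
    then show "graph_on W (\<lambda>u v. F H M (env2 u v)) \<in> step_outputs (NonCopying ?\<Sigma> ?\<nu> \<eta>) H"
      using exp by force
  qed
qed

lemma ind_step_exists:
  obtains t where "valid_step t"
    and "\<And>H W. pair_graph H \<Longrightarrow> W \<subseteq> pverts H \<Longrightarrow> ind H W \<in> step_outputs t H"
proof -
  obtain t where "valid_step t"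
    and t: "\<And>H M W. pair_graph H \<Longrightarrow> W \<subseteq> pverts H \<Longrightarrow>
      (\<And>u v. u \<in> W \<Longrightarrow> v \<in> W \<Longrightarrow> (env2 u v 0, env2 u v 1) \<in> parcs H \<Longrightarrow>
        u \<noteq> v \<and> (env2 v u 0, env2 v u 1) \<in> parcs H) \<Longrightarrow>
      graph_on W (\<lambda>u v. (env2 u v 0, env2 u v 1) \<in> parcs H) \<in> step_outputs t H"
    by (rule step_exists[OF dfn_edge[of 0 1 "{}"]]) blast
  moreover have "ind H W \<in> step_outputs t H" if "pair_graph H" "W \<subseteq> pverts H" for H W
  proof -
    have "u \<noteq> v \<and> (v, u) \<in> parcs H" if "(u, v) \<in> parcs H" for u v
      using that \<open>pair_graph H\<close> unfolding pair_graph_iff by blast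
    then show ?thesis
      using t[OF that] by (simp add: ind_eq_graph_on[OF that(2)])
  qed
  ultimately show ?thesis using that by blast
qed

section \<open>Flips and their reversal by unary marks\<close>

definition flip :: "nat \<Rightarrow> nat ugraph \<Rightarrow> nat ugraph \<Rightarrow> bool" where
  "flip c K\<^sub>0 K \<longleftrightarrow> pair_graph K\<^sub>0 \<and> pair_graph K \<and> pverts K\<^sub>0 = pverts K \<and>
     (\<exists>col R. (\<forall>u \<in> pverts K. col u < c) \<and>
        (\<forall>u \<in> pverts K. \<forall>v \<in> pverts K. u \<noteq> v \<longrightarrow>
           ((u, v) \<in> parcs K\<^sub>0 \<longleftrightarrow> ((u, v) \<in> parcs K) \<noteq> R (col u) (col v))))"

text \<open>The flip is encoded by \<open>2 * c\<close> unary sets: \<open>A i\<close> is intended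
  as the colour class \<open>i\<close>, and \<open>B i\<close> as the union of the classes flipped
  against it. Adjacency in the result depends only on adjacency in \<open>K\<^sub>0\<close> and on
  the marks of the two ends.\<close>

definition unflip :: "nat \<Rightarrow> nat ugraph \<Rightarrow> (nat \<Rightarrow> nat set) \<Rightarrow> (nat \<Rightarrow> nat set) \<Rightarrow> nat ugraph" where
  "unflip c K\<^sub>0 A B = graph_on (pverts K\<^sub>0)
     (\<lambda>u v. u \<noteq> v \<and> ((u, v) \<in> parcs K\<^sub>0) \<noteq> (\<exists>i \<in> {..<c}. u \<in> A i \<and> v \<in> B i))"

lemma flip_unflip:
  assumes "flip c K\<^sub>0 K"
  obtains A B where "K = unflip c K\<^sub>0 A B"
proof -
  obtain col and R :: "nat \<Rightarrow> nat \<Rightarrow> bool" where col: "\<And>u. u \<in> pverts K \<Longrightarrow> col u < c"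
    and R: "\<And>u v. u \<in> pverts K \<Longrightarrow> v \<in> pverts K \<Longrightarrow> u \<noteq> v \<Longrightarrow>
      (u, v) \<in> parcs K\<^sub>0 \<longleftrightarrow> ((u, v) \<in> parcs K) \<noteq> R (col u) (col v)"
    using assms unfolding flip_def by blast
  let ?A = "\<lambda>i. {u. col u = i}" and ?B = "\<lambda>i. {v. R i (col v)}"
  have K: "pair_graph K" "pverts K\<^sub>0 = pverts K"
    using assms by (auto simp: flip_def)
  have "K = graph_on (pverts K) (\<lambda>u v. (u, v) \<in> parcs K)"
    using K(1) by (cases K) (auto simp: graph_on_def pair_graph_iff)
  also have "\<dots> = unflip c K\<^sub>0 ?A ?B"
    unfolding unflip_def K(2)
  proof (rule graph_on_cong)
    fix u v assume uv: "u \<in> pverts K" "v \<in> pverts K"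
    show "(u, v) \<in> parcs K \<longleftrightarrow> u \<noteq> v \<and> ((u, v) \<in> parcs K\<^sub>0) \<noteq> (\<exists>i \<in> {..<c}. u \<in> ?A i \<and> v \<in> ?B i)"
    proof (cases "u = v")
      case True
      then show ?thesis using K(1) by (simp add: pair_graph_iff)
    next
      case False
      have "(\<exists>i \<in> {..<c}. u \<in> ?A i \<and> v \<in> ?B i) = R (col u) (col v)"
        using col[OF uv(1)] by auto
      then show ?thesis using R[OF uv False] False by auto
    qed
  qed
  finally show ?thesis by (rule that)
qed

text \<open>The residue of a symbol modulo 3 tells whether it encodes an original mark, a colour class or
  the set flipped against that class.\<close>

lemma dfn_unflip:
  "dfn (free_vars \<alpha>)
     (\<lambda>K\<^sub>0 N e. sat (unflip c K\<^sub>0 (\<lambda>i. N (3 * i + 1)) (\<lambda>i. N (3 * i + 2))) (\<lambda>i. N (3 * i)) e \<alpha>)"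
proof (induction \<alpha>)
  case (Eq x y)
  then show ?case using dfn_eq[of x y "{}"] by simp
next
  case (Edge x y)
  have "dfn {x, y} (\<lambda>K\<^sub>0 N e. e x \<noteq> e y \<and> ((e x, e y) \<in> parcs K\<^sub>0) \<noteq>
      (\<exists>i \<in> {..<c}. e x \<in> N (3 * i + 1) \<and> e y \<in> N (3 * i + 2)))"
    by (intro dfn_conj dfn_not dfn_xor dfn_bex dfn_mono[OF dfn_eq[of x y "{}"]]
        dfn_mono[OF dfn_edge[of x y "{}"]] dfn_mono[OF dfn_mark[of x "{}"]]
        dfn_mono[OF dfn_mark[of y "{}"]]) auto
  then have "dfn (free_vars (Edge x y)) (\<lambda>K\<^sub>0 N e. e x \<noteq> e y \<and> ((e x, e y) \<in> parcs K\<^sub>0) \<noteq>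
      (\<exists>i \<in> {..<c}. e x \<in> N (3 * i + 1) \<and> e y \<in> N (3 * i + 2)))"
    by simp
  then show ?case
    by (rule dfn_cong) (simp add: unflip_def)
next
  case (Mark s x)
  then show ?case using dfn_mark[of x "{}" "3 * s"] by simp
next
  case (Neg \<alpha>)
  then show ?case using dfn_not by simp
next
  case (Conj \<alpha> \<beta>)
  then show ?case
    unfolding sat.simps free_vars.simps
    by (intro dfn_conj dfn_mono[OF Conj.IH(1)] dfn_mono[OF Conj.IH(2)]) auto
next
  case (Ex v \<alpha>)
  have "dfn (insert v (free_vars \<alpha> - {v})) (\<lambda>K\<^sub>0 N e.
      sat (unflip c K\<^sub>0 (\<lambda>i. N (3 * i + 1)) (\<lambda>i. N (3 * i + 2))) (\<lambda>i. N (3 * i)) e \<alpha>)"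
    by (rule dfn_mono[OF Ex.IH]) auto
  then have "dfn (free_vars \<alpha> - {v}) (\<lambda>K\<^sub>0 N e. \<exists>a \<in> pverts K\<^sub>0.
      sat (unflip c K\<^sub>0 (\<lambda>i. N (3 * i + 1)) (\<lambda>i. N (3 * i + 2))) (\<lambda>i. N (3 * i)) (e(v := a)) \<alpha>)"
    by (rule dfn_Ex) simp
  then show ?case by (simp add: unflip_def)
qed

text \<open>Unflipping is quantifier-free, so it can be done inside any induced subgraph of
  \<open>K\<^sub>0\<close> that contains \<open>W\<close>, in particular inside a ball.\<close>

lemma unflip_step_exists:
  obtains t where "valid_step t"
    and "\<And>K\<^sub>0 K S W. flip c K\<^sub>0 K \<Longrightarrow> W \<subseteq> pverts K\<^sub>0 \<Longrightarrow> W \<subseteq> S \<Longrightarrow> ind K W \<in> step_outputs t (ind K\<^sub>0 S)"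
proof -
  define F where "F = (\<lambda>K\<^sub>0 N e. sat (unflip c K\<^sub>0 (\<lambda>i. N (3 * i + 1)) (\<lambda>i. N (3 * i + 2)))
    (\<lambda>i. N (3 * i)) e (Edge 0 1))"
  have "dfn {0, 1} F"
    using dfn_unflip[of "Edge 0 1" c] by (simp add: F_def)
  then obtain t where "valid_step t"
    and t: "\<And>H M W. pair_graph H \<Longrightarrow> W \<subseteq> pverts H \<Longrightarrow>
      (\<And>u v. u \<in> W \<Longrightarrow> v \<in> W \<Longrightarrow> F H M (env2 u v) \<Longrightarrow> u \<noteq> v \<and> F H M (env2 v u)) \<Longrightarrow>
      graph_on W (\<lambda>u v. F H M (env2 u v)) \<in> step_outputs t H"
    by (rule step_exists) blast
  moreover have "ind K W \<in> step_outputs t (ind K\<^sub>0 S)"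
    if fl: "flip c K\<^sub>0 K" and W: "W \<subseteq> pverts K\<^sub>0" "W \<subseteq> S" for K\<^sub>0 K S W
  proof -
    obtain A B where K: "K = unflip c K\<^sub>0 A B" using flip_unflip[OF fl] by blast
    define N where "N s = (if s mod 3 = 1 then A (s div 3) else B (s div 3))" for s
    have N: "N (3 * i + 1) = A i" "N (3 * i + 2) = B i" for i
    proof -
      have "(3 * i + 1) mod 3 = 1" "(3 * i + 1) div 3 = i" "(3 * i + 2) mod 3 = 2" "(3 * i + 2) div 3 = i"
        by presburger+
      then show "N (3 * i + 1) = A i" "N (3 * i + 2) = B i"
        by (simp_all add: N_def)
    qed
    have F: "F (ind K\<^sub>0 S) N (env2 u v) \<longleftrightarrow> (u, v) \<in> parcs K" if "u \<in> W" "v \<in> W" for u v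
      using that W unfolding F_def N K unflip_def by auto
    have "pair_graph K\<^sub>0" "pair_graph K" "pverts K\<^sub>0 = pverts K"
      using fl by (auto simp: flip_def)
    moreover have "ind K W = graph_on W (\<lambda>u v. F (ind K\<^sub>0 S) N (env2 u v))"
      using W calculation by (simp add: ind_eq_graph_on F cong: graph_on_cong)
    moreover have "graph_on W (\<lambda>u v. F (ind K\<^sub>0 S) N (env2 u v)) \<in> step_outputs t (ind K\<^sub>0 S)"
      using calculation W by (intro t pair_graph_ind) (auto simp: F pair_graph_iff)
    ultimately show ?thesis by simp
  qed
  ultimately show ?thesis using that by blast
qed

text \<open>On far pairs, membership in \<open>K\<close> depends only on the unary types of the two ends, so flipping
  pairs of types leaves only edges between close vertices.\<close>

lemma locality_step:
  assumes "dfn {0, 1} F"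
  shows "\<exists>c. \<forall>s. \<exists>t s'. valid_step t \<and> (\<forall>H M K. pair_graph H \<longrightarrow> pair_graph K \<longrightarrow>
    pverts K \<subseteq> pverts H \<longrightarrow>
    (\<forall>u \<in> pverts K. \<forall>v \<in> pverts K. (u, v) \<in> parcs K \<longleftrightarrow> F H M (env2 u v)) \<longrightarrow>
    (\<exists>K\<^sub>0. flip c K\<^sub>0 K \<and> (\<forall>z \<in> pverts K\<^sub>0. ball_graph s K\<^sub>0 z \<in> step_outputs t (ball_graph s' H z))))"
proof -
  obtain \<alpha> where \<alpha>: "free_vars \<alpha> \<subseteq> {0, 1}"
    "\<And>H M e. pair_graph H \<Longrightarrow> e ` {0, 1} \<subseteq> pverts H \<Longrightarrow> F H M e = sat H M e \<alpha>"
    using assms unfolding dfn_def by blast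
  obtain d \<Phi> where \<Phi>: "finite \<Phi>" "\<And>G. G \<in> \<Phi> \<Longrightarrow> local d {0, 1} G"
    "\<And>H M. pair_graph H \<Longrightarrow> \<exists>G \<in> \<Phi>. \<forall>e. e ` {0, 1} \<subseteq> pverts H \<longrightarrow> sat H M e \<alpha> = G H M e"
    using qlocal_sat[OF \<alpha>(1)] unfolding qlocal_def by (metis finite.emptyI finite.insertI)
  \<comment> \<open>Beyond distance \<open>2 * d + 1\<close> every query in \<open>\<Phi>\<close>
    splits into unary conditions, by \<open>local_split\<close>.\<close>
  define D where "D = 2 * d + 1"
  define splits where "splits G L \<longleftrightarrow> (\<forall>(P, Q) \<in> set L. local d {0} P \<and> local d {1} Q) \<and>
    (\<forall>H M e. pair_graph H \<longrightarrow> e ` {0, 1} \<subseteq> pverts H \<longrightarrow> e 1 \<notin> nbh H D {e 0} \<longrightarrow>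
      G H M e = (\<exists>(P, Q) \<in> set L. P H M e \<and> Q H M e))" for G L
  have "\<exists>L. splits G L" if "G \<in> \<Phi>" for G
  proof -
    from \<Phi>(2)[OF that] have "local d ({0} \<union> {1}) G" by (simp add: insert_commute)
    then show ?thesis
    proof (rule local_split)
      fix L
      assume loc: "\<And>P Q. (P, Q) \<in> set L \<Longrightarrow> local d {0} P \<and> local d {1} Q"
        and eq: "\<And>H M e. pair_graph H \<Longrightarrow> e ` ({0} \<union> {1}) \<subseteq> pverts H \<Longrightarrow>
          nbh H (2 * d + 1) (e ` {0}) \<inter> e ` {1} = {} \<Longrightarrow>
          G H M e = (\<exists>(P, Q) \<in> set L. P H M e \<and> Q H M e)"
      have "G H M e = (\<exists>(P, Q) \<in> set L. P H M e \<and> Q H M e)"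
        if "pair_graph H" "e ` {0, 1} \<subseteq> pverts H" "e 1 \<notin> nbh H D {e 0}" for H M e
        using that by (intro eq) (simp_all add: D_def)
      then have "splits G L"
        unfolding splits_def using loc by (intro conjI allI impI) auto
      then show ?thesis by blast
    qed auto
  qed
  then obtain L where L: "\<And>G. G \<in> \<Phi> \<Longrightarrow> splits G (L G)" by metis
  \<comment> \<open>The bound \<open>n\<close> exceeds every index into any of the lists
    \<open>L G\<close>. A colour will be a pair of subsets of these indices, so \<open>c\<close>
    depends on \<open>F\<close> only, not on the graph, its marks or the radius.\<close>
  define n where "n = (\<Sum>G \<in> \<Phi>. length (L G))"
  define c where "c = card (Pow {..<n} \<times> Pow {..<n})"
  obtain h where h: "bij_betw h (Pow {..<n} \<times> Pow {..<n}) {0..<c}"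
    using ex_bij_betw_finite_nat[of "Pow {..<n} \<times> Pow {..<n}"] by (auto simp: c_def)
  obtain gs where gs: "set gs = \<Phi>" using \<Phi>(1) finite_list by blast
  \<comment> \<open>Symbols modulo 4: original marks, the choice of the local query valid for \<open>H\<close>, colour classes,
    and the sets flipped against them.\<close>
  define \<Theta> :: query where "\<Theta> = (\<lambda>H N e. e 0 \<noteq> e 1 \<and>
    (\<exists>j \<in> {..<length gs}. e 0 \<in> N (4 * j + 1) \<and> (gs ! j) H (\<lambda>i. N (4 * i)) e) \<noteq>
    (\<exists>i \<in> {..<c}. e 0 \<in> N (4 * i + 2) \<and> e 1 \<in> N (4 * i + 3)))"
  have "dfn {0, 1} \<Theta>"
    unfolding \<Theta>_def
  proof (rule dfn_conj[OF dfn_not[OF dfn_eq] dfn_xor])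
    show "dfn {0, 1} (\<lambda>H N e. \<exists>j \<in> {..<length gs}.
        e 0 \<in> N (4 * j + 1) \<and> (gs ! j) H (\<lambda>i. N (4 * i)) e)"
    proof (rule dfn_bex[OF finite_lessThan], rule dfn_conj)
      fix j assume "j \<in> {..<length gs}"
      then have "local d {0, 1} (gs ! j)" using \<Phi>(2) gs nth_mem by blast
      then show "dfn {0, 1} (\<lambda>H N e. (gs ! j) H (\<lambda>i. N (4 * i)) e)"
        by (rule dfn_map_symbols[OF local_dfn])
    qed (rule dfn_mark)
    show "dfn {0, 1} (\<lambda>H N e. \<exists>i \<in> {..<c}. e 0 \<in> N (4 * i + 2) \<and> e 1 \<in> N (4 * i + 3))"
      by (rule dfn_bex[OF finite_lessThan], rule dfn_conj, rule dfn_mark, subst insert_commute, rule dfn_mark)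
  qed
  then obtain t where "valid_step t"
    and t: "\<And>H M W. pair_graph H \<Longrightarrow> W \<subseteq> pverts H \<Longrightarrow>
      (\<And>u v. u \<in> W \<Longrightarrow> v \<in> W \<Longrightarrow> \<Theta> H M (env2 u v) \<Longrightarrow> u \<noteq> v \<and> \<Theta> H M (env2 v u)) \<Longrightarrow>
      graph_on W (\<lambda>u v. \<Theta> H M (env2 u v)) \<in> step_outputs t H"
    by (rule step_exists) blast
  have main: "\<exists>K\<^sub>0. flip c K\<^sub>0 K \<and>
      (\<forall>z \<in> pverts K\<^sub>0. ball_graph s K\<^sub>0 z \<in> step_outputs t (ball_graph (d + s * D) H z))"
    if H: "pair_graph H" and K: "pair_graph K" and KH: "pverts K \<subseteq> pverts H"
      and edge: "\<And>u v. u \<in> pverts K \<Longrightarrow> v \<in> pverts K \<Longrightarrow> (u, v) \<in> parcs K \<longleftrightarrow> F H M (env2 u v)"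
    for H M K s
  proof -
    obtain G where G: "G \<in> \<Phi>" and "\<And>e. e ` {0, 1} \<subseteq> pverts H \<Longrightarrow> sat H M e \<alpha> = G H M e"
      using \<Phi>(3)[OF H, of M] by blast
    then have FG: "F H M (env2 u v) = G H M (env2 u v)" if "u \<in> pverts H" "v \<in> pverts H" for u v
      using \<alpha>(2)[OF H, of "env2 u v" M] that by simp
    \<comment> \<open>The unary type of \<open>u\<close>: \<open>I fst u\<close> and
      \<open>I snd u\<close> are the disjuncts of the split form whose left and right halves hold at
      \<open>u\<close>. A far pair is adjacent exactly if some disjunct has its left half true at
      \<open>u\<close> and its right half at \<open>v\<close>.\<close>
    define I where "I sel u = {i. i < length (L G) \<and> sel (L G ! i) H M (\<lambda>_. u)}"
      for sel :: "query \<times> query \<Rightarrow> query" and u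
    define col where "col u = h (I fst u, I snd u)" for u
    have len: "length (L G) \<le> n"
      unfolding n_def using \<Phi>(1) G by (intro member_le_sum) auto
    then have I: "(I fst u, I snd u) \<in> Pow {..<n} \<times> Pow {..<n}" for u
      by (auto simp: I_def)
    have col_less: "col u < c" for u
      using bij_betwE[OF h] I[of u] by (auto simp: col_def)
    have col_eq: "I fst u = I fst u' \<and> I snd u = I snd u'" if "col u = col u'" for u u'
      using bij_betw_imp_inj_on[OF h] I[of u] I[of u'] that unfolding col_def inj_on_def by blast
    have far: "F H M (env2 u v) \<longleftrightarrow> I fst u \<inter> I snd v \<noteq> {}"
      if uv: "u \<in> pverts H" "v \<in> pverts H" "v \<notin> nbh H D {u}" for u v
    proof -
      have "F H M (env2 u v) \<longleftrightarrow> (\<exists>(P, Q) \<in> set (L G). P H M (env2 u v) \<and> Q H M (env2 u v))"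
        using L[OF G] H uv FG[OF uv(1,2)] unfolding splits_def by simp
      also have "\<dots> \<longleftrightarrow> (\<exists>i < length (L G). fst (L G ! i) H M (env2 u v) \<and> snd (L G ! i) H M (env2 u v))"
        unfolding case_prod_beta by (metis (no_types, lifting) in_set_conv_nth)
      also have "\<dots> \<longleftrightarrow> (\<exists>i < length (L G). i \<in> I fst u \<and> i \<in> I snd v)"
      proof -
        have "fst (L G ! i) H M (env2 u v) \<longleftrightarrow> i \<in> I fst u"
          "snd (L G ! i) H M (env2 u v) \<longleftrightarrow> i \<in> I snd v" if i: "i < length (L G)" for i
        proof -
          have loc: "local d {0} (fst (L G ! i))" "local d {1} (snd (L G ! i))"
            using L[OF G] nth_mem[OF i] unfolding splits_def by (auto simp: case_prod_beta)
          have "fst (L G ! i) H M (env2 u v) = fst (L G ! i) H M (\<lambda>_. u)"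
            using uv by (intro dfn_env[OF local_dfn[OF loc(1)] H]) auto
          then show "fst (L G ! i) H M (env2 u v) \<longleftrightarrow> i \<in> I fst u"
            using i by (simp add: I_def)
          have "snd (L G ! i) H M (env2 u v) = snd (L G ! i) H M (\<lambda>_. v)"
            using uv by (intro dfn_env[OF local_dfn[OF loc(2)] H]) auto
          then show "snd (L G ! i) H M (env2 u v) \<longleftrightarrow> i \<in> I snd v"
            using i by (simp add: I_def)
        qed
        then show ?thesis by blast
      qed
      also have "\<dots> \<longleftrightarrow> I fst u \<inter> I snd v \<noteq> {}"
        by (auto simp: I_def)
      finally show ?thesis .
    qed
    \<comment> \<open>Reading \<open>R\<close> off the actual far edges of \<open>K\<close>, instead
      of off the types, makes it symmetric at once. By \<open>far\<close> all far pairs with the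
      same two colours agree, so one such edge decides for all of them.\<close>
    define R where "R a b \<longleftrightarrow> (\<exists>u \<in> pverts K. \<exists>v \<in> pverts K. col u = a \<and> col v = b \<and>
      v \<notin> nbh H D {u} \<and> (u, v) \<in> parcs K)" for a b
    have R_sym: "R a b \<Longrightarrow> R b a" for a b
      unfolding R_def using nbh_sym[OF H] K by (auto simp: pair_graph_iff) blast
    have R_far: "(u, v) \<in> parcs K \<longleftrightarrow> R (col u) (col v)"
      if uv: "u \<in> pverts K" "v \<in> pverts K" "v \<notin> nbh H D {u}" for u v
    proof
      assume "R (col u) (col v)"
      then obtain u' v' where *: "u' \<in> pverts K" "v' \<in> pverts K" "col u' = col u" "col v' = col v"
        "v' \<notin> nbh H D {u'}" "(u', v') \<in> parcs K"
        by (auto simp: R_def)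
      then have "I fst u' \<inter> I snd v' \<noteq> {}"
        using far[of u' v'] edge KH by auto
      then have "I fst u \<inter> I snd v \<noteq> {}"
        using col_eq *(3,4) by metis
      then show "(u, v) \<in> parcs K"
        using far[of u v] edge KH uv by auto
    qed (use uv in \<open>auto simp: R_def\<close>)
    define K\<^sub>0 where "K\<^sub>0 = graph_on (pverts K) (\<lambda>u v. u \<noteq> v \<and> ((u, v) \<in> parcs K) \<noteq> R (col u) (col v))"
    have K\<^sub>0: "pair_graph K\<^sub>0" "pverts K\<^sub>0 = pverts K"
      using K R_sym unfolding K\<^sub>0_def pair_graph_iff by auto
    have flip: "flip c K\<^sub>0 K"
      unfolding flip_def using K\<^sub>0 K col_less by (auto intro!: exI[of _ col] exI[of _ R] simp: K\<^sub>0_def)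
    \<comment> \<open>Far pairs are cancelled by the flip, so each edge of \<open>K\<^sub>0\<close>
      spans distance at most \<open>D\<close> in \<open>H\<close>, and \<open>s\<close> such edges
      span at most \<open>s * D\<close>.\<close>
    have close: "v \<in> nbh H D {u}" if "(u, v) \<in> parcs K\<^sub>0" for u v
      using that R_far[of u v] by (auto simp: K\<^sub>0_def)
    have nbh_K\<^sub>0: "nbh K\<^sub>0 s {z} \<subseteq> nbh H (s * D) {z}" for s z
    proof (induction s)
      case 0
      show ?case using K\<^sub>0 KH by auto
    next
      case (Suc s)
      have "v \<in> nbh H (D + s * D) {z}" if "w \<in> nbh K\<^sub>0 s {z}" "(w, v) \<in> parcs K\<^sub>0" for v w
        using nbh_trans[OF close[OF that(2)]] Suc that(1) by blast
      then show ?case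
        using Suc nbh_mono_radius[of "s * D" "D + s * D" H "{z}"] by auto
    qed
    have "ball_graph s K\<^sub>0 z \<in> step_outputs t (ball_graph (d + s * D) H z)" if z: "z \<in> pverts K\<^sub>0" for z
    proof -
      \<comment> \<open>The term \<open>s * D\<close> covers the ball in \<open>K\<^sub>0\<close>;
        the additional \<open>d\<close> leaves room to evaluate the local query at each of its
        vertices.\<close>
      define B where "B = nbh H (d + s * D) {z}"
      define W where "W = nbh K\<^sub>0 s {z}"
      obtain j where j: "j < length gs" "gs ! j = G"
        using G gs by (metis in_set_conv_nth)
      \<comment> \<open>The symbol \<open>4 * j + 1\<close> is full for the index \<open>j\<close>
        of the correct query \<open>G\<close> and empty for the other indices, so the disjunction in
        \<open>\<Theta>\<close> reduces to \<open>G\<close>.\<close>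
      define N where "N s = (if s mod 4 = 0 then M (s div 4)
        else if s mod 4 = 1 then (if s div 4 = j then UNIV else {})
        else if s mod 4 = 2 then {u. col u = s div 4}
        else {v. R (s div 4) (col v)})" for s
      have N: "N (4 * i) = M i" "N (4 * i + 1) = (if i = j then UNIV else {})"
        "N (4 * i + 2) = {u. col u = i}" "N (4 * i + 3) = {v. R i (col v)}" for i
      proof -
        have "(4 * i + 1) mod 4 = 1" "(4 * i + 1) div 4 = i" "(4 * i + 2) mod 4 = 2"
          "(4 * i + 2) div 4 = i" "(4 * i + 3) mod 4 = 3" "(4 * i + 3) div 4 = i"
          by presburger+
        then show "N (4 * i) = M i" "N (4 * i + 1) = (if i = j then UNIV else {})"
          "N (4 * i + 2) = {u. col u = i}" "N (4 * i + 3) = {v. R i (col v)}"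
          by (simp_all add: N_def)
      qed
      have WB: "W \<subseteq> B" "W \<subseteq> pverts K\<^sub>0"
        using nbh_K\<^sub>0[of s z] nbh_mono_radius[of "s * D" "d + s * D" H "{z}"] nbh_subset[of K\<^sub>0 s "{z}"]
        unfolding W_def B_def by auto
      have \<Theta>: "\<Theta> (ind H B) N (env2 u v) \<longleftrightarrow> (u, v) \<in> parcs K\<^sub>0" if uv: "u \<in> W" "v \<in> W" for u v
      proof -
        have uvK: "u \<in> pverts K" "v \<in> pverts K" using uv WB K\<^sub>0 by auto
        have "nbh H d {u, v} \<subseteq> nbh H d (nbh H (s * D) {z})"
          using uv nbh_K\<^sub>0[of s z] by (intro nbh_mono) (auto simp: W_def)
        then have "G (ind H B) M (env2 u v) = G H M (env2 u v)"
          using uvK KH unfolding B_def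
          by (intro local_ind[OF \<Phi>(2)[OF G] H]) (auto simp: nbh_nbh)
        also have "\<dots> = ((u, v) \<in> parcs K)"
          using FG[of u v] edge[of u v] uvK KH by auto
        finally have "(\<exists>i \<in> {..<length gs}. u \<in> N (4 * i + 1) \<and> (gs ! i) (ind H B) (\<lambda>i. N (4 * i)) (env2 u v)) =
            ((u, v) \<in> parcs K)"
          using j unfolding N by auto
        moreover have "(\<exists>i \<in> {..<c}. u \<in> N (4 * i + 2) \<and> v \<in> N (4 * i + 3)) = R (col u) (col v)"
          using col_less unfolding N by auto
        ultimately show ?thesis
          unfolding \<Theta>_def K\<^sub>0_def graph_on_simps env2_simps(1) env2_one using uvK by blast
      qed
      have "graph_on W (\<lambda>u v. \<Theta> (ind H B) N (env2 u v)) \<in> step_outputs t (ind H B)"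
        using WB KH K\<^sub>0 by (intro t pair_graph_ind H) (auto simp: \<Theta> pair_graph_iff)
      moreover have "ind K\<^sub>0 W = graph_on W (\<lambda>u v. \<Theta> (ind H B) N (env2 u v))"
        using WB by (simp add: ind_eq_graph_on \<Theta> cong: graph_on_cong)
      moreover have "z \<in> pverts H" using z K\<^sub>0 KH by auto
      ultimately show ?thesis
        using K\<^sub>0 z H by (simp add: ball_graph_eq W_def B_def)
    qed
    then show ?thesis using flip by blast
  qed
  show ?thesis
  proof (rule exI[of _ c], rule allI, rule exI[of _ t], rule exI, intro conjI allI impI)
    show "valid_step t" by fact
  next
    fix s H M K
    assume "pair_graph H" "pair_graph K" "pverts K \<subseteq> pverts H"
      "\<forall>u \<in> pverts K. \<forall>v \<in> pverts K. (u, v) \<in> parcs K \<longleftrightarrow> F H M (env2 u v)"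
    then show "\<exists>K\<^sub>0. flip c K\<^sub>0 K \<and>
        (\<forall>z \<in> pverts K\<^sub>0. ball_graph s K\<^sub>0 z \<in> step_outputs t (ball_graph (d + s * D) H z))"
      using main by simp
  qed
qed


section \<open>Copying and composition of transduction steps\<close>

lemma pair_graph_copy_graph:
  assumes "pair_graph G"
  shows "pair_graph (copy_graph k G)"
proof -
  have "pverts (copy_graph k G) = prod_encode ` ({..<k} \<times> pverts G)"
    by (auto simp: copy_graph_def)
  then show ?thesis
    using assms unfolding pair_graph_iff by (auto simp: copy_graph_def)
qed

lemma pair_graph_step:
  assumes "valid_step t" "pair_graph G" "K \<in> step_outputs t G"
  shows "pair_graph K"
proof (cases t)
  case (Copy k)
  then show ?thesis using assms pair_graph_copy_graph by simp
next
  case (NonCopying \<Sigma> \<nu> \<eta>)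
  then obtain M where M: "expansion \<Sigma> G M" "K = interpret_graph \<nu> \<eta> G M"
    using assms by auto
  have "\<forall>u \<in> pverts G. \<forall>v \<in> pverts G. sat2 G M \<eta> u v \<longrightarrow> sat2 G M \<eta> v u"
    "\<forall>u \<in> pverts G. \<not> sat2 G M \<eta> u u"
    using assms(1,2) M(1) unfolding NonCopying by (auto simp: simple_interpretation_def)
  then show ?thesis
    using assms(2) unfolding M(2) interpret_graph_def pair_graph_iff by auto
qed

lemma outputs_append: "outputs (T @ T') G = (\<Union>K \<in> outputs T G. outputs T' K)"
  by (induction T arbitrary: G) auto

lemma outputs_snoc: "outputs (T @ [t]) G = (\<Union>K \<in> outputs T G. step_outputs t K)"
  by (simp add: outputs_append)

lemma in_copy_graph [simp]:
  "prod_encode (i, v) \<in> pverts (copy_graph k G) \<longleftrightarrow> i < k \<and> v \<in> pverts G"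
  "(prod_encode (i, u), prod_encode (j, v)) \<in> parcs (copy_graph k G) \<longleftrightarrow>
     i < k \<and> j < k \<and> (i = j \<and> (u, v) \<in> parcs G \<or> i \<noteq> j \<and> u = v \<and> v \<in> pverts G)"
  by (auto simp: copy_graph_def)

lemma copy_graph_vertexE:
  assumes "x \<in> pverts (copy_graph k G)"
  obtains i v where "x = prod_encode (i, v)" "i < k" "v \<in> pverts G"
  using assms by (auto simp: copy_graph_def)

text \<open>Forgetting the copy index sends an edge between copies to a single vertex and any other
  edge to an edge, so walks do not become longer.\<close>

lemma nbh_copy_graph:
  assumes "pair_graph G" "prod_encode (j, u) \<in> nbh (copy_graph k G) s {prod_encode (i, v)}"
  shows "u \<in> nbh G s {v}"
  using assms(2)
proof (induction s arbitrary: j u)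
  case (Suc s)
  show ?case
  proof (cases "prod_encode (j, u) \<in> nbh (copy_graph k G) s {prod_encode (i, v)}")
    case True
    then show ?thesis using Suc.IH by simp
  next
    case False
    then obtain w where w: "w \<in> nbh (copy_graph k G) s {prod_encode (i, v)}"
      "(w, prod_encode (j, u)) \<in> parcs (copy_graph k G)"
      using Suc.prems by auto
    moreover obtain j' u' where "w = prod_encode (j', u')"
      using w(1) nbh_subset copy_graph_vertexE by (metis subsetD)
    ultimately have "u' \<in> nbh G s {v}" "u' = u \<or> (u', u) \<in> parcs G"
      using Suc.IH by auto
    then show ?thesis using assms(1) by (auto simp: pair_graph_iff)
  qed
qed auto

lemma ind_copy_graph:
  assumes "pair_graph G" "\<And>i v. prod_encode (i, v) \<in> W \<Longrightarrow> v \<in> S"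
  shows "ind (copy_graph k G) W = ind (copy_graph k (ind G S)) W"
proof -
  have "x \<in> W \<Longrightarrow> x \<in> pverts (copy_graph k G) \<longleftrightarrow> x \<in> pverts (copy_graph k (ind G S))" for x
    using assms(2) by (auto simp: copy_graph_def)
  moreover have "x \<in> W \<Longrightarrow> y \<in> W \<Longrightarrow>
      (x, y) \<in> parcs (copy_graph k G) \<longleftrightarrow> (x, y) \<in> parcs (copy_graph k (ind G S))" for x y
    using assms by (auto simp: copy_graph_def)
  ultimately show ?thesis by (auto simp: ind_def)
qed

lemma flip_copy_graph:
  assumes "flip c K\<^sub>0 K"
  shows "flip (k * c) (copy_graph k K\<^sub>0) (copy_graph k K)"
proof -
  obtain col and R :: "nat \<Rightarrow> nat \<Rightarrow> bool" where col: "\<And>u. u \<in> pverts K \<Longrightarrow> col u < c"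
    and R: "\<And>u v. u \<in> pverts K \<Longrightarrow> v \<in> pverts K \<Longrightarrow> u \<noteq> v \<Longrightarrow>
      (u, v) \<in> parcs K\<^sub>0 \<longleftrightarrow> ((u, v) \<in> parcs K) \<noteq> R (col u) (col v)"
    using assms unfolding flip_def by blast
  have K: "pair_graph K\<^sub>0" "pair_graph K" "pverts K\<^sub>0 = pverts K"
    using assms by (auto simp: flip_def)
  \<comment> \<open>The new colour records the copy index in base \<open>c\<close>, and
    \<open>R'\<close> flips only inside one copy: edges between different copies are the same in
    both graphs.\<close>
  define col' where "col' x = (case prod_decode x of (i, v) \<Rightarrow> i * c + col v)" for x
  define R' where "R' a b \<longleftrightarrow> a div c = b div c \<and> R (a mod c) (b mod c)" for a b
  have col': "col' (prod_encode (i, v)) = i * c + col v" for i v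
    by (simp add: col'_def)
  have R': "R' (i * c + col u) (j * c + col v) \<longleftrightarrow> i = j \<and> R (col u) (col v)"
    if "u \<in> pverts K" "v \<in> pverts K" for i j u v
    using col[OF that(1)] col[OF that(2)] by (auto simp: R'_def)
  have less: "i * c + col v < k * c" if "i < k" "v \<in> pverts K" for i v
  proof -
    have "i * c + col v < Suc i * c" using col[OF that(2)] by simp
    also have "\<dots> \<le> k * c" using that(1) by (intro mult_le_mono1) simp
    finally show ?thesis .
  qed
  show ?thesis
    unfolding flip_def
  proof (intro conjI exI[of _ col'] exI[of _ R'] ballI impI)
    show "pair_graph (copy_graph k K\<^sub>0)" "pair_graph (copy_graph k K)"
      using K pair_graph_copy_graph by auto
    show "pverts (copy_graph k K\<^sub>0) = pverts (copy_graph k K)"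
      using K by (simp add: copy_graph_def)
  next
    fix x assume "x \<in> pverts (copy_graph k K)"
    then show "col' x < k * c"
      using less by (elim copy_graph_vertexE) (auto simp: col')
  next
    fix x y assume x: "x \<in> pverts (copy_graph k K)" and y: "y \<in> pverts (copy_graph k K)" and "x \<noteq> y"
    obtain i u where u: "x = prod_encode (i, u)" "i < k" "u \<in> pverts K"
      using x by (rule copy_graph_vertexE)
    obtain j v where v: "y = prod_encode (j, v)" "j < k" "v \<in> pverts K"
      using y by (rule copy_graph_vertexE)
    show "(x, y) \<in> parcs (copy_graph k K\<^sub>0) \<longleftrightarrow> ((x, y) \<in> parcs (copy_graph k K)) \<noteq> R' (col' x) (col' y)"
      using u v \<open>x \<noteq> y\<close> R[of u v] K by (cases "i = j") (auto simp: col' R')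
  qed
qed

text \<open>It is essential that \<open>c\<close> does not depend on the radius \<open>s\<close>: the prescribed member of the
  target class is chosen after \<open>c\<close>.\<close>

lemma locality_transduction:
  assumes "valid_transduction T"
  shows "\<exists>c. \<forall>s. \<exists>T' s'. valid_transduction T' \<and> (\<forall>G. pair_graph G \<longrightarrow> (\<forall>K \<in> outputs T G.
    \<exists>K\<^sub>0. flip c K\<^sub>0 K \<and>
      (\<forall>z \<in> pverts K\<^sub>0. \<exists>v \<in> pverts G. ball_graph s K\<^sub>0 z \<in> outputs T' (ball_graph s' G v))))"
  using assms
\<comment> \<open>The last step is split off because its input \<open>K\<close> is accessible only
  through the flip \<open>K\<^sub>0\<close> provided by the induction hypothesis.\<close>
proof (induction T rule: rev_induct)
  case Nil
  have "flip 1 G G" if "pair_graph G" for G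
    unfolding flip_def using that by (auto intro!: exI[of _ "\<lambda>_. 0"] exI[of _ "\<lambda>_ _. False"])
  then show ?case
    by (intro exI[of _ 1] allI) (rule exI[of _ "[]"], auto simp: valid_transduction_def)
next
  case (snoc t T)
  have T: "valid_transduction T" and t: "valid_step t"
    using snoc.prems by (auto simp: valid_transduction_def)
  obtain c where IH: "\<And>s. \<exists>T' s'. valid_transduction T' \<and> (\<forall>G. pair_graph G \<longrightarrow> (\<forall>K \<in> outputs T G.
    \<exists>K\<^sub>0. flip c K\<^sub>0 K \<and>
      (\<forall>z \<in> pverts K\<^sub>0. \<exists>v \<in> pverts G. ball_graph s K\<^sub>0 z \<in> outputs T' (ball_graph s' G v))))"
    using snoc.IH[OF T] by blast
  \<comment> \<open>The step is applied to \<open>K\<close>, but its output is controlled by balls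
    of the flipped graph \<open>K\<^sub>0\<close>; the new number of colours depends on
    \<open>t\<close> and \<open>c\<close> only.\<close>
  have step: "\<exists>c'. \<forall>s. \<exists>T\<^sub>1 s\<^sub>1. valid_transduction T\<^sub>1 \<and> (\<forall>K\<^sub>0 K. flip c K\<^sub>0 K \<longrightarrow> (\<forall>K' \<in> step_outputs t K.
    \<exists>K\<^sub>0'. flip c' K\<^sub>0' K' \<and>
      (\<forall>z \<in> pverts K\<^sub>0'. \<exists>v \<in> pverts K\<^sub>0. ball_graph s K\<^sub>0' z \<in> outputs T\<^sub>1 (ball_graph s\<^sub>1 K\<^sub>0 v))))"
  proof (cases t)
    case (Copy k)
    obtain t' where t': "valid_step t'"
      "\<And>H W. pair_graph H \<Longrightarrow> W \<subseteq> pverts H \<Longrightarrow> ind H W \<in> step_outputs t' H"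
      using ind_step_exists by blast
    \<comment> \<open>A ball of the copied graph projects into a ball of the same radius in
      \<open>K\<^sub>0\<close>. Copying the latter and taking an induced subgraph therefore yields
      the former.\<close>
    have ball: "\<exists>v \<in> pverts K\<^sub>0. ball_graph s (copy_graph k K\<^sub>0) z \<in> outputs [Copy k, t'] (ball_graph s K\<^sub>0 v)"
      if K\<^sub>0: "pair_graph K\<^sub>0" and z: "z \<in> pverts (copy_graph k K\<^sub>0)" for K\<^sub>0 s z
    proof -
      obtain i v where v: "z = prod_encode (i, v)" "i < k" "v \<in> pverts K\<^sub>0"
        using z by (rule copy_graph_vertexE)
      let ?W = "nbh (copy_graph k K\<^sub>0) s {z}" and ?S = "nbh K\<^sub>0 s {v}"
      have W: "prod_encode (j, u) \<in> ?W \<Longrightarrow> u \<in> ?S" for j u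
        using nbh_copy_graph[OF K\<^sub>0] v(1) by blast
      have "x \<in> pverts (copy_graph k (ind K\<^sub>0 ?S))" if x: "x \<in> ?W" for x
      proof -
        have "x \<in> pverts (copy_graph k K\<^sub>0)" using x by (rule subsetD[OF nbh_subset])
        then obtain j u where u: "x = prod_encode (j, u)" "j < k" "u \<in> pverts K\<^sub>0"
          by (rule copy_graph_vertexE)
        then have "u \<in> ?S" using x W by blast
        with u show ?thesis by simp
      qed
      then have "ind (copy_graph k (ind K\<^sub>0 ?S)) ?W \<in> step_outputs t' (copy_graph k (ind K\<^sub>0 ?S))"
        using K\<^sub>0 by (intro t'(2) pair_graph_copy_graph pair_graph_ind) auto
      then have "ball_graph s (copy_graph k K\<^sub>0) z \<in> outputs [Copy k, t'] (ball_graph s K\<^sub>0 v)"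
        using ind_copy_graph[OF K\<^sub>0 W, where k = k] ball_graph_eq[OF pair_graph_copy_graph[OF K\<^sub>0] z]
          ball_graph_eq[OF K\<^sub>0 v(3)] by simp
      with v(3) show ?thesis by blast
    qed
    show ?thesis
    proof (rule exI[of _ "k * c"], rule allI, rule exI[of _ "[Copy k, t']"], rule exI,
        intro conjI allI impI ballI)
      show "valid_transduction [Copy k, t']"
        using t t' Copy by (simp add: valid_transduction_def)
      fix s K\<^sub>0 K K'
      assume fl: "flip c K\<^sub>0 K" and "K' \<in> step_outputs t K"
      then have "flip (k * c) (copy_graph k K\<^sub>0) K'"
        using Copy flip_copy_graph by simp
      moreover have "pair_graph K\<^sub>0" using fl by (simp add: flip_def)
      ultimately show "\<exists>K\<^sub>0'. flip (k * c) K\<^sub>0' K' \<and>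
        (\<forall>z \<in> pverts K\<^sub>0'. \<exists>v \<in> pverts K\<^sub>0. ball_graph s K\<^sub>0' z \<in> outputs [Copy k, t'] (ball_graph s K\<^sub>0 v))"
        using ball by blast
    qed
  next
    case (NonCopying \<Sigma> \<nu> \<eta>)
    \<comment> \<open>Evaluating \<open>\<eta>\<close> in the unflipped graph turns the
      interpretation on \<open>K\<close> into a query on \<open>K\<^sub>0\<close>, whose marks also
      encode the flip. The effect of \<open>\<nu>\<close> is carried by the vertex set of
      \<open>K'\<close>.\<close>
    define F where "F = (\<lambda>K\<^sub>0 N e. sat (unflip c K\<^sub>0 (\<lambda>i. N (3 * i + 1)) (\<lambda>i. N (3 * i + 2)))
      (\<lambda>i. N (3 * i)) e \<eta>)"
    have "free_vars \<eta> \<subseteq> {0, 1}"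
      using t NonCopying by (simp add: simple_interpretation_def)
    then have "dfn {0, 1} F"
      unfolding F_def by (rule dfn_mono[OF dfn_unflip])
    then obtain c' where c': "\<And>s. \<exists>t s'. valid_step t \<and> (\<forall>H M K. pair_graph H \<longrightarrow> pair_graph K \<longrightarrow>
      pverts K \<subseteq> pverts H \<longrightarrow>
      (\<forall>u \<in> pverts K. \<forall>v \<in> pverts K. (u, v) \<in> parcs K \<longleftrightarrow> F H M (env2 u v)) \<longrightarrow>
      (\<exists>K\<^sub>0. flip c' K\<^sub>0 K \<and> (\<forall>z \<in> pverts K\<^sub>0. ball_graph s K\<^sub>0 z \<in> step_outputs t (ball_graph s' H z))))"
      using locality_step by blast
    show ?thesis
    proof (intro exI[of _ c'] allI)
      fix s
      obtain t' s' where t': "valid_step t'" and t'2: "\<And>H M K. pair_graph H \<Longrightarrow> pair_graph K \<Longrightarrow>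
        pverts K \<subseteq> pverts H \<Longrightarrow>
        (\<forall>u \<in> pverts K. \<forall>v \<in> pverts K. (u, v) \<in> parcs K \<longleftrightarrow> F H M (env2 u v)) \<Longrightarrow>
        (\<exists>K\<^sub>0. flip c' K\<^sub>0 K \<and> (\<forall>z \<in> pverts K\<^sub>0. ball_graph s K\<^sub>0 z \<in> step_outputs t' (ball_graph s' H z)))"
        using c'[of s] by blast
      have "\<exists>K\<^sub>0'. flip c' K\<^sub>0' K' \<and>
          (\<forall>z \<in> pverts K\<^sub>0'. \<exists>v \<in> pverts K\<^sub>0. ball_graph s K\<^sub>0' z \<in> outputs [t'] (ball_graph s' K\<^sub>0 v))"
        if fl: "flip c K\<^sub>0 K" and K': "K' \<in> step_outputs t K" for K\<^sub>0 K K'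
      proof -
        have K: "pair_graph K\<^sub>0" "pair_graph K" "pverts K\<^sub>0 = pverts K"
          using fl by (auto simp: flip_def)
        obtain M where M: "K' = interpret_graph \<nu> \<eta> K M"
          using K' NonCopying by auto
        obtain A B where AB: "K = unflip c K\<^sub>0 A B"
          using flip_unflip[OF fl] by blast
        define N where "N s = (if s mod 3 = 0 then M (s div 3)
          else if s mod 3 = 1 then A (s div 3) else B (s div 3))" for s
        have N: "N (3 * i) = M i" "N (3 * i + 1) = A i" "N (3 * i + 2) = B i" for i
        proof -
          have "(3 * i + 1) mod 3 = 1" "(3 * i + 1) div 3 = i"
            "(3 * i + 2) mod 3 = 2" "(3 * i + 2) div 3 = i"
            by presburger+
          then show "N (3 * i) = M i" "N (3 * i + 1) = A i" "N (3 * i + 2) = B i"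
            by (simp_all add: N_def)
        qed
        have F: "F K\<^sub>0 N (env2 u v) = sat2 K M \<eta> u v" for u v
          unfolding F_def N sat2_env2 AB by simp
        have sub: "pverts K' \<subseteq> pverts K\<^sub>0"
          using M K by (auto simp: interpret_graph_def Let_def)
        have "\<exists>K\<^sub>0'. flip c' K\<^sub>0' K' \<and>
            (\<forall>z \<in> pverts K\<^sub>0'. ball_graph s K\<^sub>0' z \<in> step_outputs t' (ball_graph s' K\<^sub>0 z))"
        proof (rule t'2[OF K(1) _ sub])
          show "pair_graph K'" using pair_graph_step[OF t K(2) K'] .
          show "\<forall>u \<in> pverts K'. \<forall>v \<in> pverts K'. (u, v) \<in> parcs K' \<longleftrightarrow> F K\<^sub>0 N (env2 u v)"
            unfolding F M by (auto simp: interpret_graph_def Let_def)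
        qed
        then obtain K\<^sub>0' where "flip c' K\<^sub>0' K'"
          "\<forall>z \<in> pverts K\<^sub>0'. ball_graph s K\<^sub>0' z \<in> step_outputs t' (ball_graph s' K\<^sub>0 z)" by blast
        moreover from this have "pverts K\<^sub>0' \<subseteq> pverts K\<^sub>0" using sub by (auto simp: flip_def)
        ultimately show ?thesis by (intro exI[of _ K\<^sub>0']) auto
      qed
      moreover have "valid_transduction [t']"
        using t' by (simp add: valid_transduction_def)
      ultimately show "\<exists>T\<^sub>1 s\<^sub>1. valid_transduction T\<^sub>1 \<and> (\<forall>K\<^sub>0 K. flip c K\<^sub>0 K \<longrightarrow> (\<forall>K' \<in> step_outputs t K.
        \<exists>K\<^sub>0'. flip c' K\<^sub>0' K' \<and>
          (\<forall>z \<in> pverts K\<^sub>0'. \<exists>v \<in> pverts K\<^sub>0. ball_graph s K\<^sub>0' z \<in> outputs T\<^sub>1 (ball_graph s\<^sub>1 K\<^sub>0 v))))"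
        by (intro exI[of _ "[t']"] exI[of _ s']) blast
    qed
  qed
  then obtain c' where step: "\<And>s. \<exists>T\<^sub>1 s\<^sub>1. valid_transduction T\<^sub>1 \<and> (\<forall>K\<^sub>0 K. flip c K\<^sub>0 K \<longrightarrow> (\<forall>K' \<in> step_outputs t K.
    \<exists>K\<^sub>0'. flip c' K\<^sub>0' K' \<and>
      (\<forall>z \<in> pverts K\<^sub>0'. \<exists>v \<in> pverts K\<^sub>0. ball_graph s K\<^sub>0' z \<in> outputs T\<^sub>1 (ball_graph s\<^sub>1 K\<^sub>0 v))))"
    by blast
  show ?case
  proof (intro exI[of _ c'] allI)
    fix s
    obtain T\<^sub>1 s\<^sub>1 where T\<^sub>1: "valid_transduction T\<^sub>1"
      and T\<^sub>1_out: "\<And>K\<^sub>0 K K'. flip c K\<^sub>0 K \<Longrightarrow> K' \<in> step_outputs t K \<Longrightarrow> \<exists>K\<^sub>0'. flip c' K\<^sub>0' K' \<and>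
        (\<forall>z \<in> pverts K\<^sub>0'. \<exists>v \<in> pverts K\<^sub>0. ball_graph s K\<^sub>0' z \<in> outputs T\<^sub>1 (ball_graph s\<^sub>1 K\<^sub>0 v))"
      using step[of s] by metis
    \<comment> \<open>The hypothesis is used at radius \<open>s\<^sub>1\<close>, the size of the
      ball that the last step requires as input.\<close>
    obtain T' s' where T': "valid_transduction T'"
      and T'_out: "\<And>G K. pair_graph G \<Longrightarrow> K \<in> outputs T G \<Longrightarrow> \<exists>K\<^sub>0. flip c K\<^sub>0 K \<and>
        (\<forall>z \<in> pverts K\<^sub>0. \<exists>v \<in> pverts G. ball_graph s\<^sub>1 K\<^sub>0 z \<in> outputs T' (ball_graph s' G v))"
      using IH[of s\<^sub>1] by metis
    have "\<exists>K\<^sub>0. flip c' K\<^sub>0 K' \<and>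
        (\<forall>z \<in> pverts K\<^sub>0. \<exists>v \<in> pverts G. ball_graph s K\<^sub>0 z \<in> outputs (T' @ T\<^sub>1) (ball_graph s' G v))"
      if G: "pair_graph G" and K': "K' \<in> outputs (T @ [t]) G" for G K'
    proof -
      obtain K where K: "K \<in> outputs T G" "K' \<in> step_outputs t K"
        using K' by (auto simp: outputs_snoc)
      obtain K\<^sub>0 where K\<^sub>0: "flip c K\<^sub>0 K"
        "\<forall>z \<in> pverts K\<^sub>0. \<exists>v \<in> pverts G. ball_graph s\<^sub>1 K\<^sub>0 z \<in> outputs T' (ball_graph s' G v)"
        using T'_out[OF G K(1)] by blast
      obtain K\<^sub>0' where K\<^sub>0': "flip c' K\<^sub>0' K'"
        "\<forall>z \<in> pverts K\<^sub>0'. \<exists>v \<in> pverts K\<^sub>0. ball_graph s K\<^sub>0' z \<in> outputs T\<^sub>1 (ball_graph s\<^sub>1 K\<^sub>0 v)"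
        using T\<^sub>1_out[OF K\<^sub>0(1) K(2)] by blast
      have "\<exists>v \<in> pverts G. ball_graph s K\<^sub>0' z \<in> outputs (T' @ T\<^sub>1) (ball_graph s' G v)"
        if z: "z \<in> pverts K\<^sub>0'" for z
      proof -
        obtain y where y: "y \<in> pverts K\<^sub>0" "ball_graph s K\<^sub>0' z \<in> outputs T\<^sub>1 (ball_graph s\<^sub>1 K\<^sub>0 y)"
          using K\<^sub>0'(2) z by blast
        obtain v where "v \<in> pverts G" "ball_graph s\<^sub>1 K\<^sub>0 y \<in> outputs T' (ball_graph s' G v)"
          using K\<^sub>0(2) y(1) by blast
        with y(2) show ?thesis unfolding outputs_append by blast
      qed
      with K\<^sub>0'(1) show ?thesis by blast
    qed
    moreover have "valid_transduction (T' @ T\<^sub>1)"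
      using T' T\<^sub>1 by (auto simp: valid_transduction_def)
    ultimately show "\<exists>T' s'. valid_transduction T' \<and> (\<forall>G. pair_graph G \<longrightarrow> (\<forall>K \<in> outputs (T @ [t]) G.
      \<exists>K\<^sub>0. flip c' K\<^sub>0 K \<and>
        (\<forall>z \<in> pverts K\<^sub>0. \<exists>v \<in> pverts G. ball_graph s K\<^sub>0 z \<in> outputs T' (ball_graph s' G v))))"
      by (intro exI[of _ "T' @ T\<^sub>1"] exI[of _ s']) blast
  qed
qed

section \<open>Passing between a class and its balls\<close>

lemma transducible_from_loc:
  assumes C: "\<forall>G \<in> C. pair_graph G" and D: "D \<sqsubseteq>\<^sub>F\<^sub>O loc r C"
  shows "D \<sqsubseteq>\<^sub>F\<^sub>O C"
proof -
  obtain T where T: "valid_transduction T" "\<forall>G \<in> D. \<exists>H \<in> loc r C. \<exists>K \<in> outputs T H. graph_iso K G"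
    using D unfolding FO_transducible_def by blast
  obtain t where t: "valid_step t"
    "\<And>H W. pair_graph H \<Longrightarrow> W \<subseteq> pverts H \<Longrightarrow> ind H W \<in> step_outputs t H"
    using ind_step_exists by blast
  have "\<exists>H \<in> C. \<exists>K \<in> outputs (t # T) H. graph_iso K G" if G: "G \<in> D" for G
  proof -
    obtain H v K where HvK: "H \<in> C" "v \<in> pverts H" "K \<in> outputs T (ball_graph r H v)" "graph_iso K G"
      using T(2) G unfolding loc_def by blast
    then have "ball_graph r H v \<in> step_outputs t H"
      using C t(2)[OF _ nbh_subset] by (simp add: ball_graph_eq)
    with HvK show ?thesis by auto
  qed
  then show ?thesis
    unfolding FO_transducible_def using T(1) t(1)
    by (intro exI[of _ "t # T"]) (simp add: valid_transduction_def)
qed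

text \<open>The radius \<open>s\<close> is uniform over the class, because it determines the radius
  of the balls of the source class. The larger member \<open>G'\<close> may depend on
  \<open>G\<close> and \<open>c\<close>, but must work for every flip of every isomorphic copy of
  it.\<close>

definition robust :: "nat ugraph set \<Rightarrow> bool" where
  "robust D \<longleftrightarrow> (\<exists>s. \<forall>c. \<forall>G \<in> D. \<exists>G' \<in> D. \<forall>K K\<^sub>0. graph_iso K G' \<longrightarrow> flip c K\<^sub>0 K \<longrightarrow>
     (\<exists>z \<in> pverts K\<^sub>0. \<exists>W \<subseteq> nbh K\<^sub>0 s {z}. graph_iso (ind K W) G))"

text \<open>To obtain \<open>G\<close>, the transduction is run on a source of the larger member
  \<open>G'\<close>. Some ball of the flipped output contains an induced copy of \<open>G\<close> up
  to the flip; this ball is transduced from a ball of the source, and one more step undoes the flip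
  and selects the copy.\<close>

lemma robust_transducible:
  assumes C: "\<forall>G \<in> C. pair_graph G" and "robust D" and D: "D \<sqsubseteq>\<^sub>F\<^sub>O C"
  shows "\<exists>r. D \<sqsubseteq>\<^sub>F\<^sub>O loc r C"
proof -
  obtain s where s: "\<And>c G. G \<in> D \<Longrightarrow> \<exists>G' \<in> D. \<forall>K K\<^sub>0. graph_iso K G' \<longrightarrow> flip c K\<^sub>0 K \<longrightarrow>
     (\<exists>z \<in> pverts K\<^sub>0. \<exists>W \<subseteq> nbh K\<^sub>0 s {z}. graph_iso (ind K W) G)"
    using assms(2) unfolding robust_def by blast
  obtain T where T: "valid_transduction T" "\<And>G. G \<in> D \<Longrightarrow> \<exists>H \<in> C. \<exists>K \<in> outputs T H. graph_iso K G"
    using D unfolding FO_transducible_def by blast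
  obtain c where "\<And>s. \<exists>T' s'. valid_transduction T' \<and> (\<forall>G. pair_graph G \<longrightarrow> (\<forall>K \<in> outputs T G.
    \<exists>K\<^sub>0. flip c K\<^sub>0 K \<and>
      (\<forall>z \<in> pverts K\<^sub>0. \<exists>v \<in> pverts G. ball_graph s K\<^sub>0 z \<in> outputs T' (ball_graph s' G v))))"
    using locality_transduction[OF T(1)] by blast
  then obtain T' r where T': "valid_transduction T'"
    and T'_out: "\<And>H K. pair_graph H \<Longrightarrow> K \<in> outputs T H \<Longrightarrow> \<exists>K\<^sub>0. flip c K\<^sub>0 K \<and>
      (\<forall>z \<in> pverts K\<^sub>0. \<exists>v \<in> pverts H. ball_graph s K\<^sub>0 z \<in> outputs T' (ball_graph r H v))"
    by metis
  obtain t where t: "valid_step t"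
    "\<And>K\<^sub>0 K S W. flip c K\<^sub>0 K \<Longrightarrow> W \<subseteq> pverts K\<^sub>0 \<Longrightarrow> W \<subseteq> S \<Longrightarrow> ind K W \<in> step_outputs t (ind K\<^sub>0 S)"
    using unflip_step_exists by metis
  have "\<exists>B \<in> loc r C. \<exists>K \<in> outputs (T' @ [t]) B. graph_iso K G" if G: "G \<in> D" for G
  proof -
    obtain G' where G': "G' \<in> D" "\<And>K K\<^sub>0. graph_iso K G' \<Longrightarrow> flip c K\<^sub>0 K \<Longrightarrow>
      \<exists>z \<in> pverts K\<^sub>0. \<exists>W \<subseteq> nbh K\<^sub>0 s {z}. graph_iso (ind K W) G"
      using s[OF G, of c] by blast
    obtain H K where H: "H \<in> C" "K \<in> outputs T H" "graph_iso K G'"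
      using T(2)[OF G'(1)] by blast
    obtain K\<^sub>0 where K\<^sub>0: "flip c K\<^sub>0 K"
      "\<And>z. z \<in> pverts K\<^sub>0 \<Longrightarrow> \<exists>v \<in> pverts H. ball_graph s K\<^sub>0 z \<in> outputs T' (ball_graph r H v)"
      using T'_out[OF _ H(2)] C H(1) by blast
    obtain z W where z: "z \<in> pverts K\<^sub>0" "W \<subseteq> nbh K\<^sub>0 s {z}" "graph_iso (ind K W) G"
      using G'(2)[OF H(3) K\<^sub>0(1)] by blast
    obtain v where v: "v \<in> pverts H" "ball_graph s K\<^sub>0 z \<in> outputs T' (ball_graph r H v)"
      using K\<^sub>0(2)[OF z(1)] by blast
    have "ball_graph s K\<^sub>0 z = ind K\<^sub>0 (nbh K\<^sub>0 s {z})"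
      using K\<^sub>0(1) z(1) by (intro ball_graph_eq) (auto simp: flip_def)
    then have "ind K W \<in> outputs (T' @ [t]) (ball_graph r H v)"
      using v(2) t(2)[OF K\<^sub>0(1) _ z(2)] z(2) nbh_subset[of K\<^sub>0 s "{z}"] by (auto simp: outputs_snoc)
    moreover have "ball_graph r H v \<in> loc r C"
      using H(1) v(1) by (auto simp: loc_def)
    ultimately show ?thesis using z(3) by blast
  qed
  then show ?thesis
    unfolding FO_transducible_def using T' t(1)
    by (intro exI[of _ r] exI[of _ "T' @ [t]"]) (auto simp: valid_transduction_def)
qed

lemma robust_loc_iff:
  assumes "\<forall>G \<in> C. pair_graph G" "robust D"
  shows "(\<forall>r. \<not> D \<sqsubseteq>\<^sub>F\<^sub>O loc r C) \<longleftrightarrow> \<not> D \<sqsubseteq>\<^sub>F\<^sub>O C"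
  using transducible_from_loc[OF assms(1)] robust_transducible[OF assms] by blast


section \<open>Robust classes\<close>

text \<open>The bijection is directed from \<open>G\<close> to \<open>K\<close>, since it will be
  used to locate parts of the prescribed graph inside an output \<open>K\<close>.\<close>

lemma graph_iso_iff:
  assumes "pair_graph K" "pair_graph G"
  shows "graph_iso K G \<longleftrightarrow> (\<exists>h. bij_betw h (pverts G) (pverts K) \<and>
    (\<forall>u \<in> pverts G. \<forall>v \<in> pverts G. (u, v) \<in> parcs G \<longleftrightarrow> (h u, h v) \<in> parcs K))"
proof
  interpret K: pair_graph K by fact
  assume "graph_iso K G"
  then obtain f where f: "pre_digraph.digraph_isomorphism (with_proj K) f"
    "with_proj G = app_iso f (with_proj K)"
    by (auto simp: graph_iso_def digraph_iso_def)
  have V: "pverts G = iso_verts f ` pverts K" and E: "parcs G = iso_arcs f ` parcs K"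
    and fst: "iso_tail f = fst" and snd: "iso_head f = snd"
    using f(2) by (auto simp: with_proj_def app_iso_def)
  have inj: "inj_on (iso_verts f) (pverts K)"
    and arcs: "\<And>a. a \<in> parcs K \<Longrightarrow> iso_arcs f a = (iso_verts f (fst a), iso_verts f (snd a))"
    using f(1) unfolding K.digraph_isomorphism_def fst snd by (auto simp: prod_eq_iff)
  have edge: "(u, v) \<in> parcs K \<longleftrightarrow> (iso_verts f u, iso_verts f v) \<in> parcs G"
    if "u \<in> pverts K" "v \<in> pverts K" for u v
  proof
    assume "(iso_verts f u, iso_verts f v) \<in> parcs G"
    then obtain a where a: "a \<in> parcs K" "iso_verts f u = iso_verts f (fst a)" "iso_verts f v = iso_verts f (snd a)"
      unfolding E using arcs by auto
    then have "u = fst a" "v = snd a"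
      using inj that K.arc_fst_in_verts[OF a(1)] K.arc_snd_in_verts[OF a(1)] by (auto dest: inj_onD)
    with a show "(u, v) \<in> parcs K" by simp
  next
    assume "(u, v) \<in> parcs K"
    then show "(iso_verts f u, iso_verts f v) \<in> parcs G"
      unfolding E using arcs[of "(u, v)"] by force
  qed
  have bij: "bij_betw (iso_verts f) (pverts K) (pverts G)"
    using inj V by (simp add: bij_betw_def)
  show "\<exists>h. bij_betw h (pverts G) (pverts K) \<and>
    (\<forall>u \<in> pverts G. \<forall>v \<in> pverts G. (u, v) \<in> parcs G \<longleftrightarrow> (h u, h v) \<in> parcs K)"
  proof (intro exI conjI ballI)
    let ?h = "inv_into (pverts K) (iso_verts f)"
    show *: "bij_betw ?h (pverts G) (pverts K)" using bij by (rule bij_betw_inv_into)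
    fix u v assume uv: "u \<in> pverts G" "v \<in> pverts G"
    then have "iso_verts f (?h u) = u" "iso_verts f (?h v) = v"
      using V by (auto simp: f_inv_into_f)
    moreover have "?h u \<in> pverts K" "?h v \<in> pverts K"
      using bij_betwE[OF *] uv by auto
    ultimately show "(u, v) \<in> parcs G \<longleftrightarrow> (?h u, ?h v) \<in> parcs K"
      using edge[of "?h u" "?h v"] by simp
  qed
next
  interpret K: pair_graph K by fact
  interpret G: pair_graph G by fact
  assume "\<exists>h. bij_betw h (pverts G) (pverts K) \<and>
    (\<forall>u \<in> pverts G. \<forall>v \<in> pverts G. (u, v) \<in> parcs G \<longleftrightarrow> (h u, h v) \<in> parcs K)"
  then obtain h where h: "bij_betw h (pverts G) (pverts K)"
    "\<And>u v. u \<in> pverts G \<Longrightarrow> v \<in> pverts G \<Longrightarrow> (u, v) \<in> parcs G \<longleftrightarrow> (h u, h v) \<in> parcs K"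
    by blast
  define g where "g = inv_into (pverts G) h"
  have g: "bij_betw g (pverts K) (pverts G)"
    unfolding g_def using h(1) by (rule bij_betw_inv_into)
  have hg: "h (g x) = x" "g x \<in> pverts G" if "x \<in> pverts K" for x
    using that h(1) bij_betwE[OF g] unfolding g_def by (auto simp: bij_betw_inv_into_right)
  have gh: "g (h x) = x" "h x \<in> pverts K" if "x \<in> pverts G" for x
    using that h(1) bij_betwE[OF h(1)] unfolding g_def by (auto simp: bij_betw_inv_into_left)
  have g_arc: "(g u, g v) \<in> parcs G" if "(u, v) \<in> parcs K" for u v
    using that hg K.in_arcsD1[OF that] K.in_arcsD2[OF that] h(2)[of "g u" "g v"] by simp
  let ?f = "\<lparr> iso_verts = g, iso_arcs = map_prod g g, iso_head = snd, iso_tail = fst \<rparr>"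
  have "parcs G = map_prod g g ` parcs K"
  proof (intro equalityI subsetI)
    fix a assume a: "a \<in> parcs G"
    then have v: "fst a \<in> pverts G" "snd a \<in> pverts G"
      using G.arc_fst_in_verts G.arc_snd_in_verts by auto
    then have "(h (fst a), h (snd a)) \<in> parcs K" using h(2)[OF v] a by simp
    moreover have "a = map_prod g g (h (fst a), h (snd a))" using gh v by simp
    ultimately show "a \<in> map_prod g g ` parcs K" by blast
  qed (use g_arc in auto)
  moreover have "pverts G = g ` pverts K" using g by (simp add: bij_betw_def)
  ultimately have "with_proj G = app_iso ?f (with_proj K)"
    by (simp add: with_proj_def app_iso_def)
  moreover have "inj_on (map_prod g g) (parcs K)"
  proof (rule inj_on_subset)
    show "inj_on (map_prod g g) (pverts K \<times> pverts K)"
      using g by (intro map_prod_inj_on) (auto simp: bij_betw_def)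
    show "parcs K \<subseteq> pverts K \<times> pverts K" using assms(1) by (simp add: pair_graph_iff)
  qed
  then have "pre_digraph.digraph_isomorphism (with_proj K) ?f"
    unfolding K.digraph_isomorphism_def
    using g K.wf_digraph by (auto simp: bij_betw_def)
  ultimately show "graph_iso K G"
    unfolding graph_iso_def digraph_iso_def by blast
qed

lemma graph_iso_ind:
  assumes "pair_graph K" "pair_graph G" "inj_on h (pverts G)" "h ` pverts G \<subseteq> pverts K"
    and "\<And>u v. u \<in> pverts G \<Longrightarrow> v \<in> pverts G \<Longrightarrow> (u, v) \<in> parcs G \<longleftrightarrow> (h u, h v) \<in> parcs K"
  shows "graph_iso (ind K (h ` pverts G)) G"
  unfolding graph_iso_iff[OF pair_graph_ind[OF assms(1)] assms(2)]
  using assms by (intro exI[of _ h]) (auto simp: bij_betw_def)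

subsection \<open>Classes closed under disjoint unions and dominating vertices\<close>

lemma equal_colours:
  assumes "\<And>i. i \<le> c \<Longrightarrow> f i < (c :: nat)"
  obtains i j where "i \<le> c" "j \<le> c" "i \<noteq> j" "f i = f j"
proof -
  have "card (f ` {..c}) \<le> card {..<c}"
    using assms by (intro card_mono) auto
  then have "\<not> inj_on f {..c}" by (intro pigeonhole) simp
  then show ?thesis using that by (auto simp: inj_on_def)
qed

text \<open>Two vertices of equal colour, one joined and one not joined to a set, cannot both be separated
  from a vertex of that set by flips.\<close>

lemma flip_tower:
  fixes x :: "nat \<Rightarrow> nat" and y :: "nat \<Rightarrow> nat \<Rightarrow> nat" and g :: "nat \<Rightarrow> nat \<Rightarrow> nat \<Rightarrow> nat"
  assumes flip: "flip c K\<^sub>0 K"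
    and x: "\<And>k. k \<le> c \<Longrightarrow> x k \<in> pverts K"
    and y: "\<And>k i. k \<le> c \<Longrightarrow> i \<le> c \<Longrightarrow> y k i \<in> pverts K"
    and g: "\<And>k i v. k \<le> c \<Longrightarrow> i \<le> c \<Longrightarrow> v \<in> V \<Longrightarrow> g k i v \<in> pverts K"
    and xy: "\<And>k l i. k \<le> c \<Longrightarrow> l \<le> c \<Longrightarrow> i \<le> c \<Longrightarrow>
      y k i \<noteq> x l \<and> ((y k i, x l) \<in> parcs K \<longleftrightarrow> k = l)"
    and yg: "\<And>k i j v. k \<le> c \<Longrightarrow> i \<le> c \<Longrightarrow> j \<le> c \<Longrightarrow> v \<in> V \<Longrightarrow>
      y k i \<noteq> g k j v \<and> ((y k i, g k j v) \<in> parcs K \<longleftrightarrow> i = j)"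
  obtains k i where "k \<le> c" "i \<le> c" "g k i ` V \<subseteq> nbh K\<^sub>0 3 {y k i}"
proof -
  obtain col and R :: "nat \<Rightarrow> nat \<Rightarrow> bool" where col: "\<And>u. u \<in> pverts K \<Longrightarrow> col u < c"
    and R: "\<And>u v. u \<in> pverts K \<Longrightarrow> v \<in> pverts K \<Longrightarrow> u \<noteq> v \<Longrightarrow>
      (u, v) \<in> parcs K\<^sub>0 \<longleftrightarrow> ((u, v) \<in> parcs K) \<noteq> R (col u) (col v)"
    using flip unfolding flip_def by blast
  have K\<^sub>0: "pair_graph K\<^sub>0" "pverts K\<^sub>0 = pverts K"
    using flip by (auto simp: flip_def)
  \<comment> \<open>Equal colours are first found among the \<open>x k\<close>, and then, for this
    fixed \<open>k\<close>, among the \<open>y k i\<close>; in both cases \<open>c + 1\<close>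
    vertices carry only \<open>c\<close> colours.\<close>
  obtain k l where kl: "k \<le> c" "l \<le> c" "k \<noteq> l" "col (x k) = col (x l)"
    using equal_colours[of c "\<lambda>k. col (x k)"] col x by blast
  obtain i j where ij: "i \<le> c" "j \<le> c" "i \<noteq> j" "col (y k i) = col (y k j)"
    using equal_colours[of c "\<lambda>i. col (y k i)"] col y kl(1) by blast
  have step: "v \<in> nbh K\<^sub>0 (Suc r) {z}" if "u \<in> nbh K\<^sub>0 r {z}" "(u, v) \<in> parcs K\<^sub>0" for u v r z
    using that K\<^sub>0(1) by (auto simp: pair_graph_iff)
  have y_self: "y k i \<in> nbh K\<^sub>0 0 {y k i}"
    using y kl(1) ij(1) K\<^sub>0 by simp
  \<comment> \<open>In \<open>K\<close> both \<open>y k i\<close> and \<open>y k j\<close> are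
    joined to \<open>x k\<close> and not to \<open>x l\<close>, while the flip treats all four pairs
    alike. The choice of \<open>m\<close> makes both adjacent to \<open>x m\<close> after the
    flip.\<close>
  define m where "m = (if R (col (y k i)) (col (x k)) then l else k)"
  have m: "(y k i, x m) \<in> parcs K\<^sub>0" "(y k j, x m) \<in> parcs K\<^sub>0"
    using R[OF y x, of k i m] R[OF y x, of k j m] xy[of k m i] xy[of k m j] kl ij
    by (auto simp: m_def split: if_splits)
  have "x m \<in> nbh K\<^sub>0 (Suc 0) {y k i}"
    using step[OF y_self m(1)] .
  moreover have "(x m, y k j) \<in> parcs K\<^sub>0"
    using m(2) K\<^sub>0(1) by (simp add: pair_graph_iff)
  ultimately have y2: "y k j \<in> nbh K\<^sub>0 (Suc (Suc 0)) {y k i}"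
    by (rule step)
  \<comment> \<open>In \<open>K\<close> the vertex \<open>g k i v\<close> is joined to
    \<open>y k i\<close> and not to \<open>y k j\<close>. These have the same colour, so after the
    flip exactly one of them is its neighbour: the distance from \<open>y k i\<close> is 1, or 3
    along \<open>x m\<close> and \<open>y k j\<close>.\<close>
  have "g k i v \<in> nbh K\<^sub>0 3 {y k i}" if v: "v \<in> V" for v
  proof (cases "R (col (y k i)) (col (g k i v))")
    case True
    then have "(y k j, g k i v) \<in> parcs K\<^sub>0"
      using R[OF y g, of k j k i v] yg[of k j i v] kl ij v by auto
    with y2 show ?thesis using step by (metis numeral_3_eq_3)
  next
    case False
    then have "(y k i, g k i v) \<in> parcs K\<^sub>0"
      using R[OF y g, of k i k i v] yg[of k i i v] kl ij v by auto
    from step[OF y_self this] show ?thesis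
      using nbh_mono_radius[of "Suc 0" 3 K\<^sub>0 "{y k i}"] by auto
  qed
  then show ?thesis using that kl(1) ij(1) by blast
qed

definition tower_x :: "nat \<Rightarrow> nat" where
  "tower_x k = prod_encode (0, k)"

definition tower_y :: "nat \<Rightarrow> nat \<Rightarrow> nat" where
  "tower_y k i = prod_encode (1, prod_encode (k, i))"

definition tower_g :: "nat \<Rightarrow> nat \<Rightarrow> nat \<Rightarrow> nat" where
  "tower_g k i v = prod_encode (2, prod_encode (k, prod_encode (i, v)))"

lemma tower_inject [simp]:
  "tower_x k = tower_x k' \<longleftrightarrow> k = k'"
  "tower_y k i = tower_y k' i' \<longleftrightarrow> k = k' \<and> i = i'"
  "tower_g k i v = tower_g k' i' v' \<longleftrightarrow> k = k' \<and> i = i' \<and> v = v'"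
  "tower_x k \<noteq> tower_y k' i" "tower_y k' i \<noteq> tower_x k"
  "tower_x k \<noteq> tower_g k' i v" "tower_g k' i v \<noteq> tower_x k"
  "tower_y k i \<noteq> tower_g k' i' v" "tower_g k' i' v \<noteq> tower_y k i"
  by (auto simp: tower_x_def tower_y_def tower_g_def)

text \<open>For each \<open>k\<close>, the vertex \<open>x k\<close> dominates \<open>c + 1\<close>
  disjoint copies of the graph, each with its own dominating vertex \<open>y k i\<close>; there are
  \<open>c + 1\<close> such components. Arcs point towards the dominating vertices, so that the same
  formula describes the ancestor relation of a forest when \<open>E\<close> is one.\<close>

definition tower_rel :: "nat \<Rightarrow> nat set \<Rightarrow> nat rel \<Rightarrow> nat rel" where
  "tower_rel c V E = {(tower_y k i, tower_x k) | k i. k \<le> c \<and> i \<le> c} \<union>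
     {(tower_g k i v, tower_x k) | k i v. k \<le> c \<and> i \<le> c \<and> v \<in> V} \<union>
     {(tower_g k i v, tower_y k i) | k i v. k \<le> c \<and> i \<le> c \<and> v \<in> V} \<union>
     {(tower_g k i u, tower_g k i v) | k i u v. k \<le> c \<and> i \<le> c \<and> (u, v) \<in> E}"

definition tower_verts :: "nat \<Rightarrow> nat set \<Rightarrow> nat set" where
  "tower_verts c V = tower_x ` {..c} \<union> (\<lambda>(k, i). tower_y k i) ` ({..c} \<times> {..c}) \<union>
     (\<lambda>(k, i, v). tower_g k i v) ` ({..c} \<times> {..c} \<times> V)"

definition tower :: "nat \<Rightarrow> nat ugraph \<Rightarrow> nat ugraph" where
  "tower c G = \<lparr> pverts = tower_verts c (pverts G),
     parcs = tower_rel c (pverts G) (parcs G) \<union> (tower_rel c (pverts G) (parcs G))\<inverse> \<rparr>"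

lemma in_tower_rel [simp]:
  "(tower_y k i, tower_x l) \<in> tower_rel c V E \<longleftrightarrow> k = l \<and> k \<le> c \<and> i \<le> c"
  "(tower_g k i v, tower_x l) \<in> tower_rel c V E \<longleftrightarrow> k = l \<and> k \<le> c \<and> i \<le> c \<and> v \<in> V"
  "(tower_g k i v, tower_y l j) \<in> tower_rel c V E \<longleftrightarrow> k = l \<and> i = j \<and> k \<le> c \<and> i \<le> c \<and> v \<in> V"
  "(tower_g k i u, tower_g l j v) \<in> tower_rel c V E \<longleftrightarrow>
     k = l \<and> i = j \<and> k \<le> c \<and> i \<le> c \<and> (u, v) \<in> E"
  "(tower_x k, z) \<notin> tower_rel c V E" "(tower_y k i, tower_y l j) \<notin> tower_rel c V E"
  "(tower_y k i, tower_g l j v) \<notin> tower_rel c V E"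
  by (auto simp: tower_rel_def)

lemma in_tower_verts [simp]:
  "tower_x k \<in> tower_verts c V \<longleftrightarrow> k \<le> c"
  "tower_y k i \<in> tower_verts c V \<longleftrightarrow> k \<le> c \<and> i \<le> c"
  "tower_g k i v \<in> tower_verts c V \<longleftrightarrow> k \<le> c \<and> i \<le> c \<and> v \<in> V"
  by (auto simp: tower_verts_def image_iff)

lemma tower_rel_subset: "E \<subseteq> V \<times> V \<Longrightarrow> tower_rel c V E \<subseteq> tower_verts c V \<times> tower_verts c V"
  unfolding tower_rel_def by auto

lemma tower_rel_irrefl: "irrefl E \<Longrightarrow> irrefl (tower_rel c V E)"
  unfolding tower_rel_def irrefl_def by auto

lemma pair_graph_tower:
  assumes "pair_graph G"
  shows "pair_graph (tower c G)"
proof -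
  have "irrefl (parcs G)" "parcs G \<subseteq> pverts G \<times> pverts G" "finite (pverts G)"
    using assms by (auto simp: pair_graph_iff irrefl_def)
  then show ?thesis
    using tower_rel_irrefl[of "parcs G" c "pverts G"] tower_rel_subset[of "parcs G" "pverts G" c]
    unfolding pair_graph_iff tower_def by (auto simp: tower_verts_def irrefl_def)
qed

text \<open>The tower with parameter \<open>c\<close> serves as the larger member:
  \<open>flip_tower\<close> finds a copy of \<open>G\<close> within distance 3 of its dominating
  vertex \<open>y k i\<close> after the flip.\<close>

lemma robust_tower:
  assumes D: "\<And>G. G \<in> D \<Longrightarrow> pair_graph G" and closed: "\<And>c G. G \<in> D \<Longrightarrow> tower c G \<in> D"
  shows "robust D"
  unfolding robust_def
proof (intro exI[of _ 3] allI ballI, rule bexI[OF _ closed], intro allI impI)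
  fix c G K K\<^sub>0
  assume G: "G \<in> D" and iso: "graph_iso K (tower c G)" and flip: "flip c K\<^sub>0 K"
  have K: "pair_graph K" "pverts K\<^sub>0 = pverts K" using flip by (auto simp: flip_def)
  obtain h where h: "bij_betw h (pverts (tower c G)) (pverts K)"
    and h_edge: "\<And>u v. u \<in> pverts (tower c G) \<Longrightarrow> v \<in> pverts (tower c G) \<Longrightarrow>
      (u, v) \<in> parcs (tower c G) \<longleftrightarrow> (h u, h v) \<in> parcs K"
    using iso graph_iso_iff[OF K(1) pair_graph_tower[OF D[OF G]]] by blast
  have hV: "h u \<in> pverts K" if "u \<in> pverts (tower c G)" for u
    using bij_betwE[OF h] that by blast
  have h_eq: "h u = h v \<longleftrightarrow> u = v" if "u \<in> pverts (tower c G)" "v \<in> pverts (tower c G)" for u v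
    using bij_betw_imp_inj_on[OF h] that by (auto dest: inj_onD)
  have V: "pverts (tower c G) = tower_verts c (pverts G)" by (simp add: tower_def)
  obtain k i where ki: "k \<le> c" "i \<le> c" and
    near: "(\<lambda>v. h (tower_g k i v)) ` pverts G \<subseteq> nbh K\<^sub>0 3 {h (tower_y k i)}"
  proof (rule flip_tower[OF flip, of "\<lambda>k. h (tower_x k)" "\<lambda>k i. h (tower_y k i)" "pverts G"
        "\<lambda>k i v. h (tower_g k i v)"])
    show "h (tower_y k i) \<noteq> h (tower_x l) \<and> ((h (tower_y k i), h (tower_x l)) \<in> parcs K \<longleftrightarrow> k = l)"
      if "k \<le> c" "l \<le> c" "i \<le> c" for k l i
      using that h_edge[of "tower_y k i" "tower_x l"] h_eq[of "tower_y k i" "tower_x l"]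
      by (simp add: V) (simp add: tower_def)
    show "h (tower_y k i) \<noteq> h (tower_g k j v) \<and>
        ((h (tower_y k i), h (tower_g k j v)) \<in> parcs K \<longleftrightarrow> i = j)"
      if "k \<le> c" "i \<le> c" "j \<le> c" "v \<in> pverts G" for k i j v
      using that h_edge[of "tower_y k i" "tower_g k j v"] h_eq[of "tower_y k i" "tower_g k j v"]
      by (simp add: V) (auto simp add: tower_def)
  qed (auto intro!: hV simp: V)
  let ?h = "\<lambda>v. h (tower_g k i v)"
  have "graph_iso (ind K (?h ` pverts G)) G"
  proof (rule graph_iso_ind[OF K(1) D[OF G]])
    show "inj_on ?h (pverts G)"
      using ki by (auto simp: inj_on_def h_eq V)
    show "?h ` pverts G \<subseteq> pverts K"
      using ki by (auto intro!: hV simp: V)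
    fix u v assume uv: "u \<in> pverts G" "v \<in> pverts G"
    then have "(?h u, ?h v) \<in> parcs K \<longleftrightarrow> (tower_g k i u, tower_g k i v) \<in> parcs (tower c G)"
      using ki h_edge by (simp add: V)
    also have "\<dots> \<longleftrightarrow> (u, v) \<in> parcs G"
      using ki D[OF G] by (auto simp: tower_def pair_graph_iff)
    finally show "(u, v) \<in> parcs G \<longleftrightarrow> (?h u, ?h v) \<in> parcs K" by blast
  qed
  moreover have "h (tower_y k i) \<in> pverts K\<^sub>0"
    unfolding K(2) using ki by (intro hV) (simp add: V)
  ultimately show "\<exists>z \<in> pverts K\<^sub>0. \<exists>W \<subseteq> nbh K\<^sub>0 3 {z}. graph_iso (ind K W) G"
    using near by blast
qed assumption

lemma robust_all_graphs: "robust all_graphs"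
  by (rule robust_tower) (auto simp: all_graphs_def pair_graph_tower)

lemma trivially_perfect_pair_graph:
  assumes "G \<in> trivially_perfect_graphs"
  shows "pair_graph G"
proof -
  obtain F where F: "rooted_forest (pverts G) F" "parcs G = {(u, v). (u, v) \<in> F\<^sup>+ \<or> (v, u) \<in> F\<^sup>+}"
    using assms by (auto simp: trivially_perfect_graphs_def)
  then have "F\<^sup>+ \<subseteq> pverts G \<times> pverts G"
    by (auto simp: rooted_forest_def dest: trancl_subset_Sigma)
  then show ?thesis
    using F by (auto simp: pair_graph_iff rooted_forest_def acyclic_def)
qed

lemma tower_trivially_perfect:
  assumes "G \<in> trivially_perfect_graphs"
  shows "tower c G \<in> trivially_perfect_graphs"
proof -
  obtain F where F: "rooted_forest (pverts G) F" "parcs G = {(u, v). (u, v) \<in> F\<^sup>+ \<or> (v, u) \<in> F\<^sup>+}"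
    using assms by (auto simp: trivially_perfect_graphs_def)
  let ?V = "pverts G"
  have fin: "finite ?V" and FV: "F \<subseteq> ?V \<times> ?V" and sv: "single_valued F" and acyc: "acyclic F"
    using F(1) by (auto simp: rooted_forest_def)
  have FV': "F\<^sup>+ \<subseteq> ?V \<times> ?V" using FV by (rule trancl_subset_Sigma)
  have "finite F" using FV fin by (meson finite_SigmaI finite_subset)
  then have wf: "wf (F\<inverse>)" using acyc by (rule finite_acyclic_wf_converse)
  \<comment> \<open>The finite acyclic parent relation has no infinite ascending chain, so an
    ancestor maximal above \<open>v\<close> exists and is a root.\<close>
  have root: "\<exists>r. (v, r) \<in> F\<^sup>* \<and> r \<in> ?V \<and> r \<notin> Domain F" if "v \<in> ?V" for v
  proof -
    obtain r where r: "r \<in> {w. (v, w) \<in> F\<^sup>*}" "\<And>y. (y, r) \<in> F\<inverse> \<Longrightarrow> y \<notin> {w. (v, w) \<in> F\<^sup>*}"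
      using wfE_min[OF wf, of v "{w. (v, w) \<in> F\<^sup>*}"] by blast
    have "r \<notin> Domain F"
    proof
      assume "r \<in> Domain F"
      then obtain w where "(r, w) \<in> F" by blast
      then show False using r rtrancl_into_rtrancl[of v r F w] by auto
    qed
    moreover have "r \<in> ?V" using r(1) that FV' by (auto simp: rtrancl_eq_or_trancl)
    ultimately show ?thesis using r(1) by blast
  qed
  \<comment> \<open>Only the roots of each copy receive the parent \<open>y k i\<close>, which keeps
    the relation single-valued; the other vertices lie below \<open>y k i\<close> through their
    root.\<close>
  define F' where "F' = {(tower_y k i, tower_x k) | k i. k \<le> c \<and> i \<le> c} \<union>
     {(tower_g k i v, tower_y k i) | k i v. k \<le> c \<and> i \<le> c \<and> v \<in> ?V - Domain F} \<union>
     {(tower_g k i u, tower_g k i v) | k i u v. k \<le> c \<and> i \<le> c \<and> (u, v) \<in> F}"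
  have "F'\<^sup>+ = tower_rel c ?V (F\<^sup>+)"
  proof (intro equalityI subrelI)
    have sub: "F' \<subseteq> tower_rel c ?V (F\<^sup>+)"
      by (auto simp: F'_def)
    have "trans (tower_rel c ?V (F\<^sup>+))"
    proof (rule transI)
      fix p q s assume "(p, q) \<in> tower_rel c ?V (F\<^sup>+)" "(q, s) \<in> tower_rel c ?V (F\<^sup>+)"
      then show "(p, s) \<in> tower_rel c ?V (F\<^sup>+)"
        using FV' unfolding tower_rel_def by (auto intro: trancl_trans)
    qed
    then show "(p, q) \<in> tower_rel c ?V (F\<^sup>+)" if "(p, q) \<in> F'\<^sup>+" for p q
      using trancl_mono[OF that sub] by (simp add: trancl_id)
  next
    fix p q assume "(p, q) \<in> tower_rel c ?V (F\<^sup>+)"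
    have yx: "(tower_y k i, tower_x k) \<in> F'\<^sup>+" if "k \<le> c" "i \<le> c" for k i
      using that by (intro r_into_trancl) (auto simp: F'_def)
    have gg: "(tower_g k i u, tower_g k i v) \<in> F'\<^sup>+" if "k \<le> c" "i \<le> c" "(u, v) \<in> F\<^sup>+" for k i u v
      using that(3)
    proof (induction rule: trancl_induct)
      case (base v)
      then show ?case using that by (intro r_into_trancl) (auto simp: F'_def)
    next
      case (step v w)
      then have "(tower_g k i v, tower_g k i w) \<in> F'" using that by (auto simp: F'_def)
      with step.IH show ?case by (rule trancl_into_trancl)
    qed
    have gy: "(tower_g k i v, tower_y k i) \<in> F'\<^sup>+" if "k \<le> c" "i \<le> c" "v \<in> ?V" for k i v
    proof -
      obtain r where r: "(v, r) \<in> F\<^sup>*" "r \<in> ?V" "r \<notin> Domain F" using root \<open>v \<in> ?V\<close> by blast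
      then have "(tower_g k i r, tower_y k i) \<in> F'" using that by (auto simp: F'_def)
      moreover have "tower_g k i v = tower_g k i r \<or> (tower_g k i v, tower_g k i r) \<in> F'\<^sup>+"
        using r(1) gg that by (auto simp: rtrancl_eq_or_trancl)
      ultimately show ?thesis by (metis r_into_trancl' trancl_into_trancl)
    qed
    show "(p, q) \<in> F'\<^sup>+"
      using \<open>(p, q) \<in> tower_rel c ?V (F\<^sup>+)\<close> yx gg gy trancl_trans[OF gy yx]
      unfolding tower_rel_def by auto
  qed
  note F'_trancl = this
  have "single_valued F'"
    using sv unfolding F'_def single_valued_def by auto
  moreover have "irrefl (F'\<^sup>+)"
    unfolding F'_trancl using acyc by (intro tower_rel_irrefl) (simp add: acyclic_irrefl)
  moreover have "F' \<subseteq> tower_verts c ?V \<times> tower_verts c ?V"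
    using FV by (auto simp: F'_def)
  ultimately have "rooted_forest (tower_verts c ?V) F'"
    using fin by (simp add: rooted_forest_def acyclic_irrefl tower_verts_def)
  moreover have "tower_rel c ?V (parcs G) \<union> (tower_rel c ?V (parcs G))\<inverse> =
      tower_rel c ?V (F\<^sup>+) \<union> (tower_rel c ?V (F\<^sup>+))\<inverse>"
    unfolding F(2) tower_rel_def by auto
  ultimately show ?thesis
    unfolding trivially_perfect_graphs_def tower_def using F'_trancl by auto
qed

lemma robust_trivially_perfect_graphs: "robust trivially_perfect_graphs"
  by (rule robust_tower) (auto simp: trivially_perfect_pair_graph tower_trivially_perfect)

subsection \<open>Half-graphs\<close>

definition half_graph_on :: "nat \<Rightarrow> (nat \<Rightarrow> nat) \<Rightarrow> (nat \<Rightarrow> nat) \<Rightarrow> nat ugraph \<Rightarrow> bool" where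
  "half_graph_on n a b G \<longleftrightarrow> inj_on a {1..n} \<and> inj_on b {1..n} \<and>
     (\<forall>i \<in> {1..n}. \<forall>j \<in> {1..n}. a i \<noteq> b j) \<and> pverts G = a ` {1..n} \<union> b ` {1..n} \<and>
     (\<forall>u v. (u, v) \<in> parcs G \<longleftrightarrow> (\<exists>i \<in> {1..n}. \<exists>j \<in> {1..n}. i \<le> j \<and>
        (u = a i \<and> v = b j \<or> u = b j \<and> v = a i)))"

lemma half_graphs_iff: "G \<in> half_graphs \<longleftrightarrow> (\<exists>n a b. half_graph_on n a b G)"
proof -
  have arcs: "{(a i, b j) | i j. 1 \<le> i \<and> i \<le> j \<and> j \<le> n} \<union> {(b j, a i) | i j. 1 \<le> i \<and> i \<le> j \<and> j \<le> n} =
      {(u, v). \<exists>i \<in> {1..n}. \<exists>j \<in> {1..n}. i \<le> j \<and> (u = a i \<and> v = b j \<or> u = b j \<and> v = a i)}"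
    for n :: nat and a b :: "nat \<Rightarrow> nat"
    by fastforce
  have disj: "a ` {1..n} \<inter> b ` {1..n} = {} \<longleftrightarrow> (\<forall>i \<in> {1..n}. \<forall>j \<in> {1..n}. a i \<noteq> b j)"
    for n :: nat and a b :: "nat \<Rightarrow> nat"
    by blast
  have eq: "E = {(u, v). Q u v} \<longleftrightarrow> (\<forall>u v. (u, v) \<in> E \<longleftrightarrow> Q u v)" for E :: "nat rel" and Q
    by auto
  show ?thesis
    unfolding half_graphs_def half_graph_on_def mem_Collect_eq arcs disj eq ..
qed

lemma half_graph_on_pair_graph:
  assumes "half_graph_on n a b G"
  shows "pair_graph G"
proof -
  have V: "pverts G = a ` {1..n} \<union> b ` {1..n}"
    and ab: "\<forall>i \<in> {1..n}. \<forall>j \<in> {1..n}. a i \<noteq> b j"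
    and E: "\<And>u v. (u, v) \<in> parcs G \<longleftrightarrow> (\<exists>i \<in> {1..n}. \<exists>j \<in> {1..n}. i \<le> j \<and>
        (u = a i \<and> v = b j \<or> u = b j \<and> v = a i))"
    using assms unfolding half_graph_on_def by blast+
  have "parcs G \<subseteq> pverts G \<times> pverts G"
    by (rule subrelI) (unfold E V, blast)
  moreover have "(v, u) \<in> parcs G" if "(u, v) \<in> parcs G" for u v
    using that unfolding E by blast
  moreover have "(v, v) \<notin> parcs G" for v
    unfolding E using ab by metis
  ultimately show ?thesis
    unfolding pair_graph_iff using V by simp
qed

text \<open>By pigeonhole some colour class has at least \<open>n\<close> elements; \<open>p\<close>
  lists it in increasing order, which preserves the order on indices that defines a
  half-graph.\<close>

lemma monochromatic_subsequence:
  assumes "\<And>i. i \<in> {1..N} \<Longrightarrow> f i < (m :: nat)" "n * m \<le> N" "0 < m"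
  obtains p where "\<And>i j. i < j \<Longrightarrow> j < n \<Longrightarrow> p i < (p j :: nat)"
    and "\<And>i. i < n \<Longrightarrow> p i \<in> {1..N}" and "\<And>i j. i < n \<Longrightarrow> j < n \<Longrightarrow> f (p i) = f (p j)"
proof -
  obtain y where y: "N \<le> card (f -` {y} \<inter> {1..N}) * m"
    using pigeonhole_card[of f "{1..N}" "{..<m}"] assms by auto
  let ?S = "f -` {y} \<inter> {1..N}"
  have "n * m \<le> card ?S * m" using assms(2) y by linarith
  then have n: "n \<le> card ?S" using assms(3) by simp
  have fin: "finite ?S" by simp
  define p where "p i = sorted_list_of_set ?S ! i" for i
  have len: "length (sorted_list_of_set ?S) = card ?S" by simp
  have p: "p i \<in> ?S" if "i < n" for i
    using nth_mem[of i "sorted_list_of_set ?S"] that n fin by (simp add: p_def)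
  show ?thesis
  proof (rule that[of p])
    show "p i < p j" if "i < j" "j < n" for i j
      using sorted_wrt_nth_less[OF sorted_list_of_set.strict_sorted_key_list_of_set[of ?S], of i j] that n
      by (simp add: p_def)
  qed (use p in auto)
qed

text \<open>On indices whose pairs of colours coincide, the flip either keeps or complements all
  adjacencies between the two sides at once. In both cases two additional extreme indices connect
  the rest within distance 2.\<close>

lemma robust_half_graphs: "robust half_graphs"
  unfolding robust_def
proof (intro exI[of _ 2] allI ballI)
  fix c G assume G: "G \<in> half_graphs"
  then obtain n a b where half: "half_graph_on n a b G"
    unfolding half_graphs_iff by blast
  then have a: "inj_on a {1..n}" and b: "inj_on b {1..n}"
    and ab: "\<And>i j. i \<in> {1..n} \<Longrightarrow> j \<in> {1..n} \<Longrightarrow> a i \<noteq> b j"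
    and VG: "pverts G = a ` {1..n} \<union> b ` {1..n}"
    and EG: "\<And>u v. (u, v) \<in> parcs G \<longleftrightarrow> (\<exists>i \<in> {1..n}. \<exists>j \<in> {1..n}. i \<le> j \<and>
        (u = a i \<and> v = b j \<or> u = b j \<and> v = a i))"
    unfolding half_graph_on_def by blast+
  \<comment> \<open>There are at most \<open>c * c\<close> pairs of colours, and
    \<open>n + 2\<close> equally coloured indices are wanted: \<open>1\<close> to \<open>n\<close>
    for \<open>G\<close>, and \<open>0\<close> and \<open>n + 1\<close> for the connecting vertices.
    The \<open>+ 1\<close> keeps \<open>N\<close> positive even for \<open>c = 0\<close>, and the
    colour of an existing vertex then shows \<open>0 < c\<close>.\<close>
  define N where "N = (n + 2) * (c * c + 1)"
  define A B :: "nat \<Rightarrow> nat" where "A i = 2 * i" and "B i = 2 * i + 1" for i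
  define G' where "G' = graph_on (A ` {1..N} \<union> B ` {1..N}) (\<lambda>u v. \<exists>i \<in> {1..N}. \<exists>j \<in> {1..N}. i \<le> j \<and>
        (u = A i \<and> v = B j \<or> u = B j \<and> v = A i))"
  have AB: "A i \<noteq> B j" "B j \<noteq> A i" "A i = A j \<longleftrightarrow> i = j" "B i = B j \<longleftrightarrow> i = j" for i j
    unfolding A_def B_def by presburger+
  have half': "half_graph_on N A B G'"
    unfolding half_graph_on_def
  proof (intro conjI allI)
    show "(u, v) \<in> parcs G' \<longleftrightarrow> (\<exists>i \<in> {1..N}. \<exists>j \<in> {1..N}. i \<le> j \<and>
        (u = A i \<and> v = B j \<or> u = B j \<and> v = A i))" for u v
      unfolding G'_def graph_on_simps by blast
  qed (auto simp: G'_def AB inj_on_def)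
  then have G': "G' \<in> half_graphs"
    unfolding half_graphs_iff by blast
  show "\<exists>G' \<in> half_graphs. \<forall>K K\<^sub>0. graph_iso K G' \<longrightarrow> flip c K\<^sub>0 K \<longrightarrow>
     (\<exists>z \<in> pverts K\<^sub>0. \<exists>W \<subseteq> nbh K\<^sub>0 2 {z}. graph_iso (ind K W) G)"
  proof (intro bexI[OF _ G'] allI impI)
    fix K K\<^sub>0 assume iso: "graph_iso K G'" and flip: "flip c K\<^sub>0 K"
    obtain col and R :: "nat \<Rightarrow> nat \<Rightarrow> bool" where col: "\<And>u. u \<in> pverts K \<Longrightarrow> col u < c"
      and R: "\<And>u v. u \<in> pverts K \<Longrightarrow> v \<in> pverts K \<Longrightarrow> u \<noteq> v \<Longrightarrow>
        (u, v) \<in> parcs K\<^sub>0 \<longleftrightarrow> ((u, v) \<in> parcs K) \<noteq> R (col u) (col v)"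
      using flip unfolding flip_def by blast
    have K: "pair_graph K" "pair_graph K\<^sub>0" "pverts K\<^sub>0 = pverts K"
      using flip by (auto simp: flip_def)
    obtain h where h: "bij_betw h (pverts G') (pverts K)"
      and h_edge: "\<And>u v. u \<in> pverts G' \<Longrightarrow> v \<in> pverts G' \<Longrightarrow>
        (u, v) \<in> parcs G' \<longleftrightarrow> (h u, h v) \<in> parcs K"
      using iso graph_iso_iff[OF K(1) half_graph_on_pair_graph[OF half']] by blast
    have V: "A i \<in> pverts G'" "B i \<in> pverts G'" if "i \<in> {1..N}" for i
      using that by (auto simp: G'_def)
    have hV: "h u \<in> pverts K" if "u \<in> pverts G'" for u
      using bij_betwE[OF h] that by blast
    have h_eq: "h u = h v \<longleftrightarrow> u = v" if "u \<in> pverts G'" "v \<in> pverts G'" for u v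
      using bij_betw_imp_inj_on[OF h] that by (auto dest: inj_onD)
    have "1 \<in> {1..N}" by (simp add: N_def)
    then have "0 < c" using col[OF hV[OF V(1)]] by fastforce
    \<comment> \<open>The pair of colours at index \<open>i\<close>, written as a two-digit number
      in base \<open>c\<close>; \<open>div\<close> and \<open>mod\<close> recover the
      digits.\<close>
    define f where "f i = col (h (A i)) * c + col (h (B i))" for i
    have f: "f i < c * c" if "i \<in> {1..N}" for i
    proof -
      have "f i < Suc (col (h (A i))) * c" using col[OF hV[OF V(2)[OF that]]] by (simp add: f_def)
      also have "\<dots> \<le> c * c" using col[OF hV[OF V(1)[OF that]]] by (intro mult_le_mono1) simp
      finally show ?thesis .
    qed
    obtain p where p_less: "\<And>i j. i < j \<Longrightarrow> j < n + 2 \<Longrightarrow> p i < p j"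
      and pN: "\<And>i. i < n + 2 \<Longrightarrow> p i \<in> {1..N}"
      and p_eq: "\<And>i j. i < n + 2 \<Longrightarrow> j < n + 2 \<Longrightarrow> f (p i) = f (p j)"
      using monochromatic_subsequence[of N f "c * c" "n + 2"] f \<open>0 < c\<close> by (auto simp: N_def)
    have p_le: "p i \<le> p j \<longleftrightarrow> i \<le> j" if "i < n + 2" "j < n + 2" for i j
      using p_less[of i j] p_less[of j i] that by (cases i j rule: linorder_cases) auto
    define P Q where "P i = h (A (p i))" and "Q i = h (B (p i))" for i
    have PV: "P i \<in> pverts K" and QV: "Q i \<in> pverts K" if "i < n + 2" for i
      using that pN V hV by (auto simp: P_def Q_def)
    have PQ: "P i \<noteq> Q j" "Q j \<noteq> P i" "P i = P j \<longleftrightarrow> i = j" "Q i = Q j \<longleftrightarrow> i = j"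
      if "i < n + 2" "j < n + 2" for i j
      using that pN V h_eq AB p_le[of i j] p_le[of j i] by (auto simp: P_def Q_def)
    have PQ_edge: "(P i, Q j) \<in> parcs K \<longleftrightarrow> i \<le> j" "(Q j, P i) \<in> parcs K \<longleftrightarrow> i \<le> j"
      "(P i, P j) \<notin> parcs K" "(Q i, Q j) \<notin> parcs K"
      if ij: "i < n + 2" "j < n + 2" for i j
    proof -
      have "(A (p i), B (p j)) \<in> parcs G' \<longleftrightarrow> i \<le> j" "(B (p j), A (p i)) \<in> parcs G' \<longleftrightarrow> i \<le> j"
        "(A (p i), A (p j)) \<notin> parcs G'" "(B (p i), B (p j)) \<notin> parcs G'"
        using pN[OF ij(1)] pN[OF ij(2)] p_le[OF ij] by (auto simp: G'_def AB)
      then show "(P i, Q j) \<in> parcs K \<longleftrightarrow> i \<le> j" "(Q j, P i) \<in> parcs K \<longleftrightarrow> i \<le> j"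
        "(P i, P j) \<notin> parcs K" "(Q i, Q j) \<notin> parcs K"
        using h_edge V pN[OF ij(1)] pN[OF ij(2)] by (auto simp: P_def Q_def)
    qed
    have col_eq: "col (P i) = col (P 0)" "col (Q i) = col (Q 0)" if "i < n + 2" for i
    proof -
      have *: "f (p i) = col (P i) * c + col (Q i)" for i by (simp add: f_def P_def Q_def)
      have "col (P i) = f (p i) div c" "col (Q i) = f (p i) mod c" if "i < n + 2" for i
        using col[OF QV[OF that]] by (simp_all add: *)
      then show "col (P i) = col (P 0)" "col (Q i) = col (Q 0)"
        using p_eq[OF that, of 0] that by auto
    qed
    define \<rho> where "\<rho> = R (col (P 0)) (col (Q 0))"
    have edge\<^sub>0: "(P i, Q j) \<in> parcs K\<^sub>0 \<longleftrightarrow> (i \<le> j) \<noteq> \<rho>" "(Q j, P i) \<in> parcs K\<^sub>0 \<longleftrightarrow> (i \<le> j) \<noteq> \<rho>"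
      if ij: "i < n + 2" "j < n + 2" for i j
    proof -
      show "(P i, Q j) \<in> parcs K\<^sub>0 \<longleftrightarrow> (i \<le> j) \<noteq> \<rho>"
        using R[OF PV[OF ij(1)] QV[OF ij(2)]] PQ(1)[OF ij] PQ_edge(1)[OF ij] col_eq[OF ij(1)] col_eq[OF ij(2)]
        by (simp add: \<rho>_def)
      then show "(Q j, P i) \<in> parcs K\<^sub>0 \<longleftrightarrow> (i \<le> j) \<noteq> \<rho>"
        using K(2) unfolding pair_graph_iff by blast
    qed
    have step: "v \<in> nbh K\<^sub>0 (Suc r) {z}" if "u \<in> nbh K\<^sub>0 r {z}" "(u, v) \<in> parcs K\<^sub>0" for u v r z
      using that K(2) by (auto simp: pair_graph_iff)
    have near: "\<exists>z \<in> pverts K\<^sub>0. \<forall>i \<in> {1..n}. P i \<in> nbh K\<^sub>0 2 {z} \<and> Q i \<in> nbh K\<^sub>0 2 {z}"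
    \<comment> \<open>Without complementation, \<open>P 0\<close> is joined to every
      \<open>Q i\<close> and \<open>Q (n + 1)\<close> to every \<open>P i\<close>. With it,
      \<open>P i\<close> and \<open>Q j\<close> are adjacent exactly for \<open>j < i\<close>, so
      \<open>Q 0\<close> is joined to every \<open>P i\<close> with \<open>0 < i\<close>, and
      \<open>P (n + 1)\<close> to every \<open>Q i\<close> with \<open>i < n + 1\<close>.\<close>
    proof (cases \<rho>)
      case False
      have 0: "P 0 \<in> nbh K\<^sub>0 0 {P 0}" using PV[of 0] K by simp
      have Q: "Q i \<in> nbh K\<^sub>0 (Suc 0) {P 0}" if "i < n + 2" for i
        using step[OF 0, of "Q i"] edge\<^sub>0(1)[of 0 i] that False by simp
      have "P i \<in> nbh K\<^sub>0 2 {P 0}" if "i < n + 2" for i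
        using step[OF Q[of "n + 1"], of "P i"] edge\<^sub>0(2)[of i "n + 1"] that False
        by (simp add: numeral_2_eq_2 del: nbh.simps)
      moreover have "Q i \<in> nbh K\<^sub>0 2 {P 0}" if "i < n + 2" for i
        using Q[OF that] nbh_mono_radius[of "Suc 0" 2 K\<^sub>0 "{P 0}"] by (auto simp del: nbh.simps)
      ultimately show ?thesis using PV[of 0] K(3) by (intro bexI[of _ "P 0"]) auto
    next
      case True
      have 0: "Q 0 \<in> nbh K\<^sub>0 0 {Q 0}" using QV[of 0] K by simp
      have P: "P i \<in> nbh K\<^sub>0 (Suc 0) {Q 0}" if "0 < i" "i < n + 2" for i
        using step[OF 0, of "P i"] edge\<^sub>0(2)[of i 0] that True by simp
      have "Q i \<in> nbh K\<^sub>0 2 {Q 0}" if "i < n + 1" for i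
        using step[OF P[of "n + 1"], of "Q i"] edge\<^sub>0(1)[of "n + 1" i] that True
        by (simp add: numeral_2_eq_2 del: nbh.simps)
      moreover have "P i \<in> nbh K\<^sub>0 2 {Q 0}" if "0 < i" "i < n + 2" for i
        using P[OF that] nbh_mono_radius[of "Suc 0" 2 K\<^sub>0 "{Q 0}"] by (auto simp del: nbh.simps)
      ultimately show ?thesis using QV[of 0] K(3) by (intro bexI[of _ "Q 0"]) auto
    qed
    \<comment> \<open>The embedding sends \<open>a i\<close> to \<open>P i\<close> and
      \<open>b i\<close> to \<open>Q i\<close>; it avoids the connecting indices \<open>0\<close>
      and \<open>n + 1\<close>.\<close>
    define g where "g x = (if x \<in> a ` {1..n} then P (inv_into {1..n} a x) else Q (inv_into {1..n} b x))" for x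
    have ga: "g (a i) = P i" if "i \<in> {1..n}" for i
      using that a by (simp add: g_def)
    have gb: "g (b i) = Q i" if "i \<in> {1..n}" for i
    proof -
      have "b i \<notin> a ` {1..n}" using ab that by fastforce
      then show ?thesis using that b by (simp add: g_def)
    qed
    have neq: "a i \<noteq> b j" "b j \<noteq> a i" and eq: "a i = a j \<longleftrightarrow> i = j" "b i = b j \<longleftrightarrow> i = j"
      if "i \<in> {1..n}" "j \<in> {1..n}" for i j
      using that ab[of i j] inj_on_eq_iff[OF a] inj_on_eq_iff[OF b] by auto
    have EG': "(a i, b j) \<in> parcs G \<longleftrightarrow> i \<le> j" "(b j, a i) \<in> parcs G \<longleftrightarrow> i \<le> j"
      "(a i, a j) \<notin> parcs G" "(b i, b j) \<notin> parcs G" if ij: "i \<in> {1..n}" "j \<in> {1..n}" for i j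
      unfolding EG using ij neq eq by (metis, metis, metis, metis)
    have "graph_iso (ind K (g ` pverts G)) G"
    proof (rule graph_iso_ind[OF K(1) half_graph_on_pair_graph[OF half]])
      show "inj_on g (pverts G)"
        unfolding VG inj_on_def using PQ by (auto simp: ga gb)
      show "g ` pverts G \<subseteq> pverts K"
        unfolding VG using PV QV by (auto simp: ga gb)
      show "(u, v) \<in> parcs G \<longleftrightarrow> (g u, g v) \<in> parcs K" if "u \<in> pverts G" "v \<in> pverts G" for u v
        using that unfolding VG by (auto simp: ga gb EG' PQ_edge)
    qed
    moreover have "\<exists>z \<in> pverts K\<^sub>0. g ` pverts G \<subseteq> nbh K\<^sub>0 2 {z}"
      using near unfolding VG by (fastforce simp: ga gb)
    ultimately show "\<exists>z \<in> pverts K\<^sub>0. \<exists>W \<subseteq> nbh K\<^sub>0 2 {z}. graph_iso (ind K W) G"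
      by blast
  qed
qed

theorem theorem1p9:
  fixes C :: "nat ugraph set"
  assumes "\<forall>G \<in> C. pair_graph G"
  shows "(locally_monadically_dependent C \<longleftrightarrow> monadically_dependent C) \<and>
         (locally_monadically_straight C \<longleftrightarrow> monadically_straight C) \<and>
         (locally_monadically_stable C \<longleftrightarrow> monadically_stable C)"
  unfolding locally_monadically_dependent_def locally_monadically_straight_def
    locally_monadically_stable_def monadically_dependent_def monadically_straight_def
    monadically_stable_def
  using robust_loc_iff[OF assms] robust_all_graphs robust_trivially_perfect_graphs robust_half_graphs
  by simp

end
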